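(* Let $x_0,x_1,x_2,\ldots$ be i.i.d. integer random variables uniformly distributed on $[1,k]$, i.e. on $\{1,\ldots,k\}$. Put $y_i:=|x_i-x_{i-1}|$ for $i\ge1$, $M:=\mathbb{E}(y_i)=\frac{(k-1)(k+1)}{3k}$, $Q_m(j):=\sum_{i=1}^{j}y_i$, and $\sigma:=\sqrt{V^*}$ with $$V^*:=\frac{(k-1)(k+1)(k^2+1)}{15k^2}.$$ Then $$\frac{Q_m(\lfloor mt\rfloor)-Mmt}{\sigma\sqrt{m}}\Rightarrow B(t),\qquad m\to\infty,\quad t\in[0,1],$$ where $B(t)$ is the standard Brownian motion.
   Context: $\Rightarrow$ denotes weak convergence of random functions of $t\in[0,1]$ in the space of all right-continuous functions that have left limits, endowed with the Skorohod metric. The constant $V^*$ is the coefficient of $n$ in the dominant term of the variance of the perimeter $\sum_{i=1}^{n-1}y_i+x_0+x_{n-1}+2n$ of the word $x_0x_1\cdots x_{n-1}$. *)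

theory Defs
  imports "HOL-Probability.Probability"
begin

definition cadlag :: "(real \<Rightarrow> real) \<Rightarrow> bool" where
  "cadlag f \<longleftrightarrow>
     (\<forall>t\<in>{0..<1}. (f \<longlongrightarrow> f t) (at_right t)) \<and>
     (\<forall>t\<in>{0<..1}. \<exists>l. (f \<longlongrightarrow> l) (at_left t))"

text \<open>Elements are functions on the unit interval, represented extensionally
  (their value outside the interval is fixed).\<close>

typedef skorohod = "{f \<in> extensional {0..1::real}. cadlag f}"
  morphisms app_skorohod Abs_skorohod
proof
  have "((restrict (\<lambda>t. 0) {0..1::real} :: real \<Rightarrow> real) \<longlongrightarrow> 0) (at_right t)" if "t \<in> {0..<1}" for t
  proof -
    have "\<forall>\<^sub>F s in at_right t. s \<in> {t<..<1}"
      using that by (intro eventually_at_right_real) auto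
    then have "\<forall>\<^sub>F s in at_right t. (restrict (\<lambda>t. 0) {0..1::real} :: real \<Rightarrow> real) s = 0"
      by eventually_elim (use that in auto)
    then show ?thesis by (rule tendsto_eventually)
  qed
  moreover have "((restrict (\<lambda>t. 0) {0..1::real} :: real \<Rightarrow> real) \<longlongrightarrow> 0) (at_left t)" if "t \<in> {0<..1}" for t
  proof -
    have "\<forall>\<^sub>F s in at_left t. s \<in> {0<..<t}"
      using that by (intro eventually_at_left_real) auto
    then have "\<forall>\<^sub>F s in at_left t. (restrict (\<lambda>t. 0) {0..1::real} :: real \<Rightarrow> real) s = 0"
      by eventually_elim (use that in auto)
    then show ?thesis by (rule tendsto_eventually)
  qed
  ultimately have "cadlag (restrict (\<lambda>t. 0) {0..1})"
    unfolding cadlag_def by (intro conjI ballI exI[of _ 0]) simp_all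
  then show "restrict (\<lambda>t. 0) {0..1} \<in> {f \<in> extensional {0..1::real}. cadlag f}" by simp
qed

definition time_changes :: "(real \<Rightarrow> real) set" where
  "time_changes = {u. strict_mono_on {0..1} u \<and> continuous_on {0..1} u \<and> u ` {0..1} = {0..1}}"

definition skorohod_close :: "skorohod \<Rightarrow> skorohod \<Rightarrow> real \<Rightarrow> bool" where
  "skorohod_close f g \<epsilon> \<longleftrightarrow>
     (\<exists>u\<in>time_changes. \<forall>t\<in>{0..1}.
        \<bar>u t - t\<bar> \<le> \<epsilon> \<and> \<bar>app_skorohod f t - app_skorohod g (u t)\<bar> \<le> \<epsilon>)"

lemma id_time_change: "(\<lambda>t. t) \<in> time_changes"
  by (auto simp: time_changes_def strict_mono_on_def)

lemma time_change_in: "u \<in> time_changes \<Longrightarrow> t \<in> {0..1} \<Longrightarrow> u t \<in> {0..1}"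
  unfolding time_changes_def by blast

lemma compose_time_change:
  assumes u: "u \<in> time_changes" and v: "v \<in> time_changes"
  shows "(\<lambda>t. v (u t)) \<in> time_changes"
proof -
  have "strict_mono_on {0..1} (\<lambda>t. v (u t))"
    using u v time_change_in[OF u] by (simp add: time_changes_def strict_mono_on_def)
  moreover have "continuous_on {0..1} (\<lambda>t. v (u t))"
    using u v by (auto simp: time_changes_def intro!: continuous_on_compose2[of "{0..1}" v])
  moreover have "(\<lambda>t. v (u t)) ` {0..1} = {0..1}"
    using u v by (simp add: time_changes_def image_image[symmetric])
  ultimately show ?thesis by (simp add: time_changes_def)
qed

lemma inverse_time_change:
  assumes u: "u \<in> time_changes"
  shows "\<exists>v\<in>time_changes. \<forall>t\<in>{0..1}. u (v t) = t"
proof -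
  have sm: "strict_mono_on {0..1} u" and im: "u ` {0..1} = {0..1}"
    and co: "continuous_on {0..1} u"
    using u by (auto simp: time_changes_def)
  have inj: "inj_on u {0..1}" using sm by (rule strict_mono_on_imp_inj_on)
  define v where "v = inv_into {0..1} u"
  have uv: "u (v t) = t" if "t \<in> {0..1}" for t
    unfolding v_def using that im by (intro f_inv_into_f) simp
  have vu: "v (u t) = t" if "t \<in> {0..1}" for t
    unfolding v_def using that inj by simp
  have vin: "v t \<in> {0..1}" if "t \<in> {0..1}" for t
    unfolding v_def using that im by (intro inv_into_into) simp
  have "strict_mono_on {0..1} v"
  proof (rule strict_mono_onI)
    fix r s :: real assume rs: "r \<in> {0..1}" "s \<in> {0..1}" "r < s"
    show "v r < v s"
    proof (rule ccontr)
      assume "\<not> v r < v s"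
      then have "v s < v r \<or> v s = v r" by auto
      then have "u (v s) \<le> u (v r)"
      proof
        assume "v s < v r"
        then have "u (v s) < u (v r)" by (rule strict_mono_onD[OF sm vin[OF rs(2)] vin[OF rs(1)]])
        then show ?thesis by simp
      qed simp
      then show False using uv rs by simp
    qed
  qed
  moreover have "continuous_on {0..1} v"
    using continuous_on_inv[OF co compact_Icc, of v] vu im by simp
  moreover have "v ` {0..1} = {0..1}"
  proof (intro equalityI subsetI)
    fix s assume "s \<in> v ` {0..1}" then show "s \<in> {0..1}" using vin by blast
  next
    fix s :: real assume s: "s \<in> {0..1}"
    then have "u s \<in> {0..1}" using im by blast
    then show "s \<in> v ` {0..1}" using vu[OF s] by (metis imageI)
  qed
  ultimately have "v \<in> time_changes" by (simp add: time_changes_def)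
  then show ?thesis using uv by blast
qed

lemma cadlag_bounded:
  assumes "cadlag f"
  shows "bounded (f ` {0..1})"
proof -
  let ?P = "\<lambda>a b. bounded (f ` ({a..b} \<inter> {0..1}))"
  have "?P 0 1"
  proof (rule Bolzano[of 0 1 ?P])
    show "(0::real) \<le> 1" by simp
  next
    fix a b c :: real assume "?P a b" "?P b c" "a \<le> b" "b \<le> c"
    then have "bounded (f ` ({a..b} \<inter> {0..1}) \<union> f ` ({b..c} \<inter> {0..1}))" by simp
    moreover have "{a..c} \<inter> {0..1} \<subseteq> ({a..b} \<inter> {0..1}) \<union> ({b..c} \<inter> {0..1})" by auto
    then have "f ` ({a..c} \<inter> {0..1}) \<subseteq> f ` ({a..b} \<inter> {0..1}) \<union> f ` ({b..c} \<inter> {0..1})" by blast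
    ultimately show "?P a c" by (rule bounded_subset)
  next
    fix x :: real assume x: "0 \<le> x" "x \<le> 1"
    have "\<exists>d>0. bounded (f ` ({x<..<x+d} \<inter> {0..1}))"
    proof (cases "x < 1")
      case True
      with x assms have "(f \<longlongrightarrow> f x) (at_right x)" by (simp add: cadlag_def)
      then have "\<forall>\<^sub>F s in at_right x. dist (f s) (f x) < 1" by (rule tendstoD) simp
      then obtain b where b: "b > x" "\<And>s. x < s \<Longrightarrow> s < b \<Longrightarrow> dist (f s) (f x) < 1"
        unfolding eventually_at_right_field by blast
      have "f ` ({x<..<x+(b-x)} \<inter> {0..1}) \<subseteq> cball (f x) 1"
        using b(2) by (force simp: dist_commute)
      then have "bounded (f ` ({x<..<x+(b-x)} \<inter> {0..1}))"
        using bounded_cball bounded_subset by blast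
      then show ?thesis using b(1) by (intro exI[of _ "b-x"]) simp
    next
      case False
      then have "{x<..<x+1} \<inter> {0..1} = {}" using x by auto
      then show ?thesis by (intro exI[of _ 1]) simp
    qed
    then obtain d1 where d1: "d1 > 0" "bounded (f ` ({x<..<x+d1} \<inter> {0..1}))" by blast
    have "\<exists>d>0. bounded (f ` ({x-d<..<x} \<inter> {0..1}))"
    proof (cases "0 < x")
      case True
      with x assms obtain l where "(f \<longlongrightarrow> l) (at_left x)" unfolding cadlag_def by (meson greaterThanAtMost_iff)
      then have "\<forall>\<^sub>F s in at_left x. dist (f s) l < 1" by (rule tendstoD) simp
      then obtain b where b: "b < x" "\<And>s. b < s \<Longrightarrow> s < x \<Longrightarrow> dist (f s) l < 1"
        unfolding eventually_at_left_field by blast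
      have "f ` ({x-(x-b)<..<x} \<inter> {0..1}) \<subseteq> cball l 1"
        using b(2) by (force simp: dist_commute)
      then have "bounded (f ` ({x-(x-b)<..<x} \<inter> {0..1}))"
        using bounded_cball bounded_subset by blast
      then show ?thesis using b(1) by (intro exI[of _ "x-b"]) simp
    next
      case False
      then have "{x-1<..<x} \<inter> {0..1} = {}" using x by auto
      then show ?thesis by (intro exI[of _ 1]) simp
    qed
    then obtain d2 where d2: "d2 > 0" "bounded (f ` ({x-d2<..<x} \<inter> {0..1}))" by blast
    show "\<exists>d>0. \<forall>a b. a \<le> x \<and> x \<le> b \<and> b - a < d \<longrightarrow> ?P a b"
    proof (intro exI[of _ "min d1 d2"] conjI allI impI)
      show "min d1 d2 > 0" using d1 d2 by simp
      fix a b :: real assume ab: "a \<le> x \<and> x \<le> b \<and> b - a < min d1 d2"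
      have "{a..b} \<subseteq> {x} \<union> {x<..<x+d1} \<union> {x-d2<..<x}" using ab by auto
      then have "f ` ({a..b} \<inter> {0..1}) \<subseteq>
          {f x} \<union> f ` ({x<..<x+d1} \<inter> {0..1}) \<union> f ` ({x-d2<..<x} \<inter> {0..1})" by blast
      moreover have "bounded ({f x} \<union> f ` ({x<..<x+d1} \<inter> {0..1}) \<union> f ` ({x-d2<..<x} \<inter> {0..1}))"
        using d1 d2 by simp
      ultimately show "?P a b" using bounded_subset by blast
    qed
  qed
  then show ?thesis by simp
qed

lemma skorohod_close_nonneg: "skorohod_close f g e \<Longrightarrow> 0 \<le> e"
proof -
  assume "skorohod_close f g e"
  then obtain u where "\<forall>t\<in>{0..1}. \<bar>u t - t\<bar> \<le> e \<and> \<bar>app_skorohod f t - app_skorohod g (u t)\<bar> \<le> e"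
    unfolding skorohod_close_def by blast
  from bspec[OF this, of 0] have "\<bar>u 0 - 0\<bar> \<le> e" by simp
  then show "0 \<le> e" by linarith
qed

lemma skorohod_close_refl: "skorohod_close f f 0"
  unfolding skorohod_close_def using id_time_change by (intro bexI[of _ "\<lambda>t. t"]) auto

lemma skorohod_close_mono:
  assumes "skorohod_close f g d" "d \<le> e"
  shows "skorohod_close f g e"
proof -
  obtain u where u: "u \<in> time_changes" and
    c: "\<And>t. t \<in> {0..1} \<Longrightarrow> \<bar>u t - t\<bar> \<le> d \<and> \<bar>app_skorohod f t - app_skorohod g (u t)\<bar> \<le> d"
    using assms(1) unfolding skorohod_close_def by blast
  have "\<bar>u t - t\<bar> \<le> e \<and> \<bar>app_skorohod f t - app_skorohod g (u t)\<bar> \<le> e" if "t \<in> {0..1}" for t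
    using c[OF that] assms(2) by linarith
  then show ?thesis unfolding skorohod_close_def using u by blast
qed

lemma skorohod_close_ex: "\<exists>e. skorohod_close f g e"
proof -
  have "bounded (app_skorohod f ` {0..1})" "bounded (app_skorohod g ` {0..1})"
    using app_skorohod[of f] app_skorohod[of g] by (auto intro: cadlag_bounded)
  then obtain a b where ab: "\<And>t. t \<in> {0..1} \<Longrightarrow> \<bar>app_skorohod f t\<bar> \<le> a"
      "\<And>t. t \<in> {0..1} \<Longrightarrow> \<bar>app_skorohod g t\<bar> \<le> b"
    unfolding bounded_iff by (auto simp del: atLeastAtMost_iff)
  have "\<bar>t - t\<bar> \<le> a + b \<and> \<bar>app_skorohod f t - app_skorohod g t\<bar> \<le> a + b" if "t \<in> {0..1}" for t
    using ab[OF that] by linarith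
  then show ?thesis
    unfolding skorohod_close_def using id_time_change by (intro exI[of _ "a + b"] bexI[of _ "\<lambda>t. t"]) blast+
qed

lemma skorohod_close_sym:
  assumes "skorohod_close f g e"
  shows "skorohod_close g f e"
proof -
  obtain u where u: "u \<in> time_changes" and
    c: "\<And>t. t \<in> {0..1} \<Longrightarrow> \<bar>u t - t\<bar> \<le> e \<and> \<bar>app_skorohod f t - app_skorohod g (u t)\<bar> \<le> e"
    using assms unfolding skorohod_close_def by blast
  obtain v where v: "v \<in> time_changes" and uv: "\<And>t. t \<in> {0..1} \<Longrightarrow> u (v t) = t"
    using inverse_time_change[OF u] by blast
  have "\<bar>v t - t\<bar> \<le> e \<and> \<bar>app_skorohod g t - app_skorohod f (v t)\<bar> \<le> e" if t: "t \<in> {0..1}" for t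
    using c[OF time_change_in[OF v t]] uv[OF t] by (simp add: abs_minus_commute)
  then show ?thesis unfolding skorohod_close_def using v by blast
qed

lemma skorohod_close_trans:
  assumes "skorohod_close f g d" "skorohod_close g h e"
  shows "skorohod_close f h (d + e)"
proof -
  obtain u where u: "u \<in> time_changes" and
    cu: "\<And>t. t \<in> {0..1} \<Longrightarrow> \<bar>u t - t\<bar> \<le> d \<and> \<bar>app_skorohod f t - app_skorohod g (u t)\<bar> \<le> d"
    using assms(1) unfolding skorohod_close_def by blast
  obtain v where v: "v \<in> time_changes" and
    cv: "\<And>t. t \<in> {0..1} \<Longrightarrow> \<bar>v t - t\<bar> \<le> e \<and> \<bar>app_skorohod g t - app_skorohod h (v t)\<bar> \<le> e"
    using assms(2) unfolding skorohod_close_def by blast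
  have "\<bar>v (u t) - t\<bar> \<le> d + e \<and> \<bar>app_skorohod f t - app_skorohod h (v (u t))\<bar> \<le> d + e"
    if t: "t \<in> {0..1}" for t
    using cu[OF t] cv[OF time_change_in[OF u t]] by linarith
  then show ?thesis
    unfolding skorohod_close_def by (intro bexI[OF _ compose_time_change[OF u v]]) blast
qed

lemma skorohod_close_zero_imp_eq:
  assumes close: "\<And>e. e > 0 \<Longrightarrow> skorohod_close f g e"
  shows "f = g"
proof -
  have cf: "cadlag (app_skorohod f)" and cg: "cadlag (app_skorohod g)"
    and ef: "app_skorohod f \<in> extensional {0..1}" and eg: "app_skorohod g \<in> extensional {0..1}"
    using app_skorohod by auto
  have main: "\<bar>app_skorohod f t - app_skorohod g t\<bar> \<le> 3 * e"
    if t: "t \<in> {0..1}" and e: "e > 0" for t e :: real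
  proof (cases "t < 1")
    case True
    with t have "t \<in> {0..<1}" by simp
    with cf cg have "(app_skorohod f \<longlongrightarrow> app_skorohod f t) (at_right t)"
      and "(app_skorohod g \<longlongrightarrow> app_skorohod g t) (at_right t)" by (auto simp: cadlag_def)
    then have "\<forall>\<^sub>F s in at_right t. dist (app_skorohod f s) (app_skorohod f t) < e"
      and "\<forall>\<^sub>F s in at_right t. dist (app_skorohod g s) (app_skorohod g t) < e"
      using e by (auto intro: tendstoD)
    then have "\<forall>\<^sub>F s in at_right t. dist (app_skorohod f s) (app_skorohod f t) < e \<and>
        dist (app_skorohod g s) (app_skorohod g t) < e"
      by (rule eventually_conj)
    then obtain b where b: "b > t" and bb: "\<And>s. t < s \<Longrightarrow> s < b \<Longrightarrow>
        dist (app_skorohod f s) (app_skorohod f t) < e \<and> dist (app_skorohod g s) (app_skorohod g t) < e"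
      unfolding eventually_at_right_field by blast
    define d where "d = min b 1 - t"
    have d: "d > 0" "t + d \<le> b" "t + d \<le> 1" using b True by (auto simp: d_def)
    define s where "s = t + d / 2"
    have s: "s \<in> {0..1}" "t < s" "s < b" using d t by (auto simp: s_def)
    have "min e (d / 4) > 0" using e d by simp
    then obtain u where u: "u \<in> time_changes" and
      c: "\<And>t. t \<in> {0..1} \<Longrightarrow> \<bar>u t - t\<bar> \<le> min e (d/4) \<and> \<bar>app_skorohod f t - app_skorohod g (u t)\<bar> \<le> min e (d/4)"
      using close[of "min e (d / 4)"] unfolding skorohod_close_def by blast
    have "t < u s" "u s < b" using c[OF s(1)] d by (simp_all add: s_def) (simp_all add: abs_if split: if_splits)
    then have "dist (app_skorohod g (u s)) (app_skorohod g t) < e" using bb by blast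
    moreover have "dist (app_skorohod f s) (app_skorohod f t) < e" using bb s by blast
    ultimately show ?thesis using c[OF s(1)] unfolding dist_real_def by linarith
  next
    case False
    with t have t1: "t = 1" by simp
    obtain u where u: "u \<in> time_changes" and
      c: "\<And>t. t \<in> {0..1} \<Longrightarrow> \<bar>u t - t\<bar> \<le> e \<and> \<bar>app_skorohod f t - app_skorohod g (u t)\<bar> \<le> e"
      using close[OF e] unfolding skorohod_close_def by blast
    have "(1::real) \<in> u ` {0..1}" using u by (simp add: time_changes_def)
    then obtain r where r: "r \<in> {0..1}" "u r = 1" by force
    have "u r \<le> u 1"
    proof (cases "r = 1")
      case False
      then have "r < 1" using r by simp
      moreover have "strict_mono_on {0..1} u" using u by (simp add: time_changes_def)
      ultimately have "u r < u 1" using strict_mono_onD[of "{0..1}" u r 1] r(1) by simp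
      then show ?thesis by simp
    qed simp
    moreover have "u 1 \<in> {0..1}" using time_change_in[OF u] by simp
    ultimately have "u 1 = 1" using r by auto
    then show ?thesis using c[of 1] t1 e by auto
  qed
  have "app_skorohod f t = app_skorohod g t" if "t \<in> {0..1}" for t
  proof (rule ccontr)
    assume "app_skorohod f t \<noteq> app_skorohod g t"
    then have "0 < \<bar>app_skorohod f t - app_skorohod g t\<bar> / 6" by simp
    from main[OF that this] this show False by simp
  qed
  then have "app_skorohod f = app_skorohod g"
    by (intro extensionalityI[OF ef eg])
  then show ?thesis by (simp add: app_skorohod_inject)
qed

text \<open>The Skorohod metric is
  \<open>d(f,g) = inf {max (sup |u t - t|) (sup |f t - g (u t)|)}\<close>, the infimum being over all
  time changes \<open>u\<close>.\<close>

instantiation skorohod :: metric_space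
begin

definition dist_skorohod :: "skorohod \<Rightarrow> skorohod \<Rightarrow> real" where
  "dist_skorohod f g = Inf {\<epsilon>. skorohod_close f g \<epsilon>}"

definition uniformity_skorohod :: "(skorohod \<times> skorohod) filter" where
  "uniformity_skorohod = (INF e\<in>{0<..}. principal {(x, y). dist x y < e})"

definition open_skorohod :: "skorohod set \<Rightarrow> bool" where
  "open_skorohod U = (\<forall>x\<in>U. \<forall>\<^sub>F (x', y) in uniformity. x' = x \<longrightarrow> y \<in> U)"

instance
proof
  show "uniformity = (INF e\<in>{0<..}. principal {(x, y::skorohod). dist x y < e})"
    by (rule uniformity_skorohod_def)
  show "open U = (\<forall>x\<in>U. \<forall>\<^sub>F (x', y) in uniformity. x' = x \<longrightarrow> y \<in> U)" for U :: "skorohod set"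
    by (rule open_skorohod_def)
  have ne: "{e. skorohod_close f g e} \<noteq> {}" for f g using skorohod_close_ex by blast
  have bdd: "bdd_below {e. skorohod_close f g e}" for f g
    using skorohod_close_nonneg by (intro bdd_belowI[of _ 0]) blast
  have nonneg: "0 \<le> dist f g" for f g :: skorohod
    unfolding dist_skorohod_def using ne skorohod_close_nonneg by (intro cInf_greatest) auto
  have less: "\<exists>d. skorohod_close f g d \<and> d < dist f g + e" if "e > 0" for f g :: skorohod and e
    using cInf_lessD[OF ne, of f g "dist f g + e"] that unfolding dist_skorohod_def by auto
  have le: "dist f g \<le> d" if "skorohod_close f g d" for f g :: skorohod and d
    unfolding dist_skorohod_def using that bdd by (intro cInf_lower) auto
  have sym: "dist f g = dist g f" for f g :: skorohod
    unfolding dist_skorohod_def using skorohod_close_sym by (intro arg_cong[where f = Inf]) blast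
  show "dist f g = 0 \<longleftrightarrow> f = g" for f g :: skorohod
  proof
    assume "f = g" then show "dist f g = 0"
      using le[OF skorohod_close_refl[of f]] nonneg[of f f] by simp
  next
    assume 0: "dist f g = 0"
    show "f = g"
    proof (rule skorohod_close_zero_imp_eq)
      fix e :: real assume "e > 0"
      then obtain d where d: "skorohod_close f g d" "d < e" using less[of e f g] 0 by auto
      then show "skorohod_close f g e" using skorohod_close_mono by auto
    qed
  qed
  show "dist f g \<le> dist f h + dist g h" for f g h :: skorohod
  proof (rule field_le_epsilon)
    fix e :: real assume "e > 0"
    then have e: "e / 2 > 0" by simp
    obtain a where a: "skorohod_close f h a" "a < dist f h + e / 2" using less[OF e] by blast
    obtain b where b: "skorohod_close g h b" "b < dist g h + e / 2" using less[OF e] by blast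
    have "dist f g \<le> a + b"
      by (intro le skorohod_close_trans[OF a(1) skorohod_close_sym[OF b(1)]])
    then show "dist f g \<le> dist f h + dist g h + e" using a b by simp
  qed
qed

end

text \<open>The point of the Skorohod space given by a function on the reals
  (meaningful if the function is cadlag on the unit interval).\<close>

definition path :: "(real \<Rightarrow> real) \<Rightarrow> skorohod" where
  "path f = Abs_skorohod (restrict f {0..1})"

definition random_function :: "'a measure \<Rightarrow> (real \<Rightarrow> 'a \<Rightarrow> real) \<Rightarrow> bool" where
  "random_function M Z \<longleftrightarrow>
     (\<forall>\<omega>\<in>space M. cadlag (\<lambda>t. Z t \<omega>)) \<and>
     (\<lambda>\<omega>. path (\<lambda>t. Z t \<omega>)) \<in> borel_measurable M"

definition weak_conv_skorohod ::
  "'a measure \<Rightarrow> (nat \<Rightarrow> real \<Rightarrow> 'a \<Rightarrow> real) \<Rightarrow> 'b measure \<Rightarrow> (real \<Rightarrow> 'b \<Rightarrow> real) \<Rightarrow> bool" where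
  "weak_conv_skorohod M Z N W \<longleftrightarrow>
     (\<forall>m. random_function M (Z m)) \<and> random_function N W \<and>
     (\<forall>F :: skorohod \<Rightarrow> real. continuous_on UNIV F \<and> bounded (range F) \<longrightarrow>
        (\<lambda>m. LINT \<omega>|M. F (path (\<lambda>t. Z m t \<omega>))) \<longlonglongrightarrow> (LINT \<omega>|N. F (path (\<lambda>t. W t \<omega>))))"

definition standard_brownian_motion :: "'b measure \<Rightarrow> (real \<Rightarrow> 'b \<Rightarrow> real) \<Rightarrow> bool" where
  "standard_brownian_motion N W \<longleftrightarrow>
     prob_space N \<and>
     (\<forall>t\<in>{0..1}. W t \<in> borel_measurable N) \<and>
     (\<forall>\<omega>\<in>space N. W 0 \<omega> = 0 \<and> continuous_on {0..1} (\<lambda>t. W t \<omega>)) \<and>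
     (\<forall>s t. 0 \<le> s \<and> s < t \<and> t \<le> 1 \<longrightarrow>
        distributed N lborel (\<lambda>\<omega>. W t \<omega> - W s \<omega>) (normal_density 0 (sqrt (t - s)))) \<and>
     (\<forall>n (\<tau> :: nat \<Rightarrow> real). mono_on {..n} \<tau> \<and> \<tau> ` {..n} \<subseteq> {0..1} \<longrightarrow>
        prob_space.indep_vars N (\<lambda>_. borel) (\<lambda>i \<omega>. W (\<tau> (Suc i)) \<omega> - W (\<tau> i) \<omega>) {..<n})"

end

theory Submission
  imports Defs "HOL-Real_Asymp.Real_Asymp"
begin

text \<open>
  The centred terms \<open>\<xi>\<^sub>i = |x\<^sub>i - x\<^sub>i\<^sub>+\<^sub>1| - M\<close> are bounded and one-dependent, so the statement is Donsker's
  theorem for such a sequence. A portmanteau argument reduces weak convergence to bounded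
  Lipschitz functionals of the path. The path is compared with the step path through \<open>r\<close> block
  sums; dropping one term per block makes the blocks independent. The oscillation inside the
  blocks is controlled by Hoeffding's inequality (for the even and the odd terms separately) and
  Ottaviani's argument. For fixed \<open>r\<close> each block sum is asymptotically normal: the
  characteristic functions of the partial sums satisfy
  \<open>\<phi>\<^sub>l\<^sub>+\<^sub>1 = (1 - \<theta>\<^sup>2 V / 2) \<phi>\<^sub>l + O(\<theta>\<^sup>3)\<close> with \<open>V = E \<xi>\<^sub>0\<^sup>2 + 2 E \<xi>\<^sub>0 \<xi>\<^sub>1\<close>, because \<open>\<xi>\<^sub>l\<close> interacts with
  the past only through \<open>\<xi>\<^sub>l\<^sub>-\<^sub>1\<close>.
\<close>

section \<open>Paths in the Skorohod space\<close>

text \<open>Of the special form of the Skorohod metric only one estimate is used: uniform distance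
  bounds it. Comparison with step paths then takes the place of a tightness argument, and Lipschitz
  functionals turn closeness of paths into closeness of integrals. Two limits are taken in order, m
  to infinity with the number r of blocks fixed, then r to infinity. This order dictates the quality
  of the oscillation estimate. It must survive a union bound over r + 1 blocks of length about m / r
  at a level proportional to the square root of m; second moments would give a probability of order
  1 / r for each block, and the sum would not vanish. An exponential inequality gives a bound
  exponential in - r for each block, free of m. The covariance in V is found by conditioning on the
  letter that two neighbouring differences share: given it they are independent with equal means, so
  a sum of squares of a quadratic polynomial remains.\<close>

lemma cadlag_cong:
  assumes "\<And>t. t \<in> {0..1} \<Longrightarrow> f t = g t"
  shows "cadlag f \<longleftrightarrow> cadlag g"
proof -
  have *: "cadlag g" if eq: "\<And>t. t \<in> {0..1} \<Longrightarrow> f t = g t" and f: "cadlag f" for f g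
    unfolding cadlag_def
  proof (intro conjI ballI)
    fix t :: real assume t: "t \<in> {0..<1}"
    have "\<forall>\<^sub>F s in at_right t. s \<in> {t<..<1}"
      using t by (intro eventually_at_right_real) auto
    then have "\<forall>\<^sub>F s in at_right t. f s = g s"
      by eventually_elim (use t eq in auto)
    moreover have "(f \<longlongrightarrow> g t) (at_right t)"
      using f t eq by (auto simp: cadlag_def)
    ultimately show "(g \<longlongrightarrow> g t) (at_right t)"
      by (rule Lim_transform_eventually[rotated])
  next
    fix t :: real assume t: "t \<in> {0<..1}"
    have "\<forall>\<^sub>F s in at_left t. s \<in> {0<..<t}"
      using t by (intro eventually_at_left_real) auto
    then have "\<forall>\<^sub>F s in at_left t. f s = g s"
      by eventually_elim (use t eq in auto)
    moreover obtain l where "(f \<longlongrightarrow> l) (at_left t)"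
      using f t unfolding cadlag_def by blast
    ultimately show "\<exists>l. (g \<longlongrightarrow> l) (at_left t)"
      using Lim_transform_eventually by blast
  qed
  show ?thesis using *[of f g] *[of g f] assms by auto
qed

lemma app_skorohod_path:
  assumes "cadlag f"
  shows "app_skorohod (path f) = restrict f {0..1}"
  unfolding path_def
  using assms cadlag_cong[of f "restrict f {0..1}"] by (intro Abs_skorohod_inverse) auto

lemma path_cong:
  assumes "\<And>t. t \<in> {0..1} \<Longrightarrow> f t = g t"
  shows "path f = path g"
  unfolding path_def using assms by (metis restrict_ext)

text \<open>The identity is a competitor in the infimum over time changes. All later estimates in
  the Skorohod metric go through this bound.\<close>

lemma dist_path_le:
  assumes "cadlag f" "cadlag g" "\<And>t. t \<in> {0..1} \<Longrightarrow> \<bar>f t - g t\<bar> \<le> e"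
  shows "dist (path f) (path g) \<le> e"
proof -
  have "0 \<le> e" using assms(3)[of 0] by simp
  then have "skorohod_close (path f) (path g) e"
    unfolding skorohod_close_def
    by (intro bexI[OF _ id_time_change]) (use assms in \<open>simp add: app_skorohod_path\<close>)
  moreover have "bdd_below {e. skorohod_close (path f) (path g) e}"
    using skorohod_close_nonneg by (intro bdd_belowI[of _ 0]) blast
  ultimately show ?thesis
    unfolding dist_skorohod_def by (intro cInf_lower) auto
qed

lemma cadlag_continuous_on:
  assumes "continuous_on {0..1} f"
  shows "cadlag f"
  unfolding cadlag_def
proof (intro conjI ballI exI)
  fix t :: real assume t: "t \<in> {0..<1}"
  then have "(f \<longlongrightarrow> f t) (at t within {0..1})"
    using assms by (auto simp: continuous_on_def)
  then have "(f \<longlongrightarrow> f t) (at t within {t..1})"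
    by (rule tendsto_within_subset) (use t in auto)
  moreover have "at t within {t..1} = at_right t"
    using t by (intro at_within_Icc_at_right) auto
  ultimately show "(f \<longlongrightarrow> f t) (at_right t)" by simp
next
  fix t :: real assume t: "t \<in> {0<..1}"
  then have "(f \<longlongrightarrow> f t) (at t within {0..1})"
    using assms by (auto simp: continuous_on_def)
  then have "(f \<longlongrightarrow> f t) (at t within {0..t})"
    by (rule tendsto_within_subset) (use t in auto)
  moreover have "at t within {0..t} = at_left t"
    using t by (intro at_within_Icc_at_left) auto
  ultimately show "(f \<longlongrightarrow> f t) (at_left t)" by simp
qed

lemma cadlag_diff:
  assumes "cadlag f" "cadlag g"
  shows "cadlag (\<lambda>t. f t - g t)"
  unfolding cadlag_def
proof (intro conjI ballI)
  show "((\<lambda>t. f t - g t) \<longlongrightarrow> f t - g t) (at_right t)" if "t \<in> {0..<1}" for t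
    using assms that by (intro tendsto_diff) (auto simp: cadlag_def)
  show "\<exists>l. ((\<lambda>t. f t - g t) \<longlongrightarrow> l) (at_left t)" if t: "t \<in> {0<..1}" for t
  proof -
    obtain l l' where "(f \<longlongrightarrow> l) (at_left t)" "(g \<longlongrightarrow> l') (at_left t)"
      using assms t unfolding cadlag_def by blast
    then show ?thesis using tendsto_diff by blast
  qed
qed

lemma cadlag_step:
  assumes r: "0 \<le> r"
  shows "cadlag (\<lambda>t. a (nat \<lfloor>r * t\<rfloor>))"
\<comment> \<open>The degenerate case occurs for \<open>m = 0\<close>: weak convergence asks for a
  random function at every index.\<close>
proof (cases "r = 0")
  case False
  with r have r: "0 < r" by simp
  show ?thesis
    unfolding cadlag_def
  proof (intro conjI ballI exI)
    fix t :: real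
    have "t < (of_int \<lfloor>r * t\<rfloor> + 1) / r"
      using r by (simp add: pos_less_divide_eq mult.commute)
    then have "\<forall>\<^sub>F s in at_right t. s \<in> {t<..<(of_int \<lfloor>r * t\<rfloor> + 1) / r}"
      by (rule eventually_at_right_real)
    then have "\<forall>\<^sub>F s in at_right t. \<lfloor>r * s\<rfloor> = \<lfloor>r * t\<rfloor>"
    proof eventually_elim
      case (elim s)
      then have "r * t < r * s" "r * s < of_int \<lfloor>r * t\<rfloor> + 1"
        using r by (auto simp: pos_less_divide_eq mult.commute)
      moreover have "of_int \<lfloor>r * t\<rfloor> \<le> r * t" by simp
      ultimately show ?case by (intro floor_unique) linarith+
    qed
    then show "((\<lambda>t. a (nat \<lfloor>r * t\<rfloor>)) \<longlongrightarrow> a (nat \<lfloor>r * t\<rfloor>)) (at_right t)"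
      by (intro tendsto_eventually) (auto elim: eventually_mono)
  next
    fix t :: real
    have "(of_int \<lceil>r * t\<rceil> - 1) / r < t"
      using r by (simp add: pos_divide_less_eq mult.commute) linarith
    then have "\<forall>\<^sub>F s in at_left t. s \<in> {(of_int \<lceil>r * t\<rceil> - 1) / r<..<t}"
      by (rule eventually_at_left_real)
    \<comment> \<open>Just left of \<open>t\<close> the index is
      \<open>\<lceil>r * t\<rceil> - 1\<close>; it differs from the index at \<open>t\<close> only
      when \<open>r * t\<close> is an integer, that is, at a jump.\<close>
    then have "\<forall>\<^sub>F s in at_left t. \<lfloor>r * s\<rfloor> = \<lceil>r * t\<rceil> - 1"
    proof eventually_elim
      case (elim s)
      then have "r * s < r * t" "of_int \<lceil>r * t\<rceil> - 1 < r * s"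
        using r by (auto simp: pos_divide_less_eq mult.commute)
      moreover have "r * t \<le> of_int \<lceil>r * t\<rceil>" by simp
      ultimately show ?case by (intro floor_unique) (simp_all, linarith)
    qed
    then show "((\<lambda>t. a (nat \<lfloor>r * t\<rfloor>)) \<longlongrightarrow> a (nat (\<lceil>r * t\<rceil> - 1))) (at_left t)"
      by (intro tendsto_eventually) (auto elim: eventually_mono)
  qed
qed (simp add: cadlag_continuous_on)

lemma cadlag_step_drift: "0 \<le> r \<Longrightarrow> cadlag (\<lambda>t. a (nat \<lfloor>r * t\<rfloor>) - c * t)"
  by (intro cadlag_diff cadlag_step cadlag_continuous_on continuous_intros)

lemma floor_mult_le:
  assumes "t \<in> {0..1::real}"
  shows "nat \<lfloor>real r * t\<rfloor> \<le> r"
proof -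
  have "real r * t \<le> real r" using assms by (simp add: mult_left_le)
  then show ?thesis by linarith
qed

text \<open>On the unit interval the index never exceeds \<open>r\<close>, so the path sees finitely
  many coordinates and the sum of their differences bounds the uniform distance. In the product
  topology measurability and continuity can be checked coordinate by coordinate; the drift
  \<open>c * t\<close> is there for the centring.\<close>

lemma continuous_on_path_step:
  "continuous_on UNIV (\<lambda>a. path (\<lambda>t. a (nat \<lfloor>real r * t\<rfloor>) - c * t))"
  unfolding continuous_on_def
proof (intro ballI)
  fix a :: "nat \<Rightarrow> real"
  let ?p = "\<lambda>a. path (\<lambda>t. a (nat \<lfloor>real r * t\<rfloor>) - c * t)"
  have le: "dist (?p b) (?p a) \<le> (\<Sum>i\<le>r. \<bar>b i - a i\<bar>)" for b
  proof (rule dist_path_le)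
    fix t :: real assume "t \<in> {0..1}"
    then have "nat \<lfloor>real r * t\<rfloor> \<in> {..r}" using floor_mult_le by simp
    then have "\<bar>b (nat \<lfloor>real r * t\<rfloor>) - a (nat \<lfloor>real r * t\<rfloor>)\<bar> \<le> (\<Sum>i\<le>r. \<bar>b i - a i\<bar>)"
      by (intro member_le_sum) auto
    then show "\<bar>b (nat \<lfloor>real r * t\<rfloor>) - c * t - (a (nat \<lfloor>real r * t\<rfloor>) - c * t)\<bar> \<le> (\<Sum>i\<le>r. \<bar>b i - a i\<bar>)"
      by simp
  qed (auto intro: cadlag_step_drift)
  have coord: "((\<lambda>b. b i) \<longlongrightarrow> a i) (at a)" for i
    using continuous_on_product_then_coordinatewise[OF continuous_on_id, of "UNIV :: (nat \<Rightarrow> real) set" i]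
    by (auto simp: continuous_on_def)
  have "((\<lambda>b. \<Sum>i\<le>r. \<bar>b i - a i\<bar>) \<longlongrightarrow> (\<Sum>i\<le>r. \<bar>a i - a i\<bar>)) (at a)"
    by (intro tendsto_intros coord)
  then have "((\<lambda>b. \<Sum>i\<le>r. \<bar>b i - a i\<bar>) \<longlongrightarrow> 0) (at a)"
    by simp
  then have "((\<lambda>b. dist (?p b) (?p a)) \<longlongrightarrow> 0) (at a)"
    by (rule Lim_null_comparison[rotated]) (simp add: le)
  then show "(?p \<longlongrightarrow> ?p a) (at a)"
    by (rule tendsto_dist_iff[THEN iffD2])
qed

lemma measurable_path_step:
  assumes [measurable]: "\<And>i. a i \<in> borel_measurable P"
  shows "(\<lambda>\<omega>. path (\<lambda>t. a (nat \<lfloor>real r * t\<rfloor>) \<omega> - c * t)) \<in> borel_measurable P"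
proof -
  have "(\<lambda>\<omega> i. a i \<omega>) \<in> borel_measurable P"
    by (intro measurable_coordinatewise_then_product) measurable
  from measurable_compose[OF this borel_measurable_continuous_onI[OF continuous_on_path_step]]
  show ?thesis .
qed

text \<open>Uniform continuity: the sampling point lies less than \<open>1 / real (Suc r)\<close>
  below \<open>t\<close>. Writing \<open>Suc r\<close> keeps the mesh meaningful at every
  index.\<close>

lemma path_step_tendsto:
  assumes "continuous_on {0..1} f"
  shows "(\<lambda>r. path (\<lambda>t. f (real (nat \<lfloor>real (Suc r) * t\<rfloor>) / real (Suc r)))) \<longlonglongrightarrow> path f"
proof (rule metric_LIMSEQ_I)
  fix e :: real assume e: "0 < e"
  have "uniformly_continuous_on {0..1} f"
    using assms by (intro compact_uniformly_continuous) auto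
  then obtain d where d: "0 < d" "\<And>s t. s \<in> {0..1} \<Longrightarrow> t \<in> {0..1} \<Longrightarrow> dist s t < d \<Longrightarrow> dist (f s) (f t) < e / 2"
    using e unfolding uniformly_continuous_on_def by (metis half_gt_zero)
  obtain N where N: "1 / real (Suc N) < d"
    using reals_Archimedean[OF d(1)] by (auto simp: inverse_eq_divide)
  show "\<exists>N. \<forall>r\<ge>N. dist (path (\<lambda>t. f (real (nat \<lfloor>real (Suc r) * t\<rfloor>) / real (Suc r)))) (path f) < e"
  proof (intro exI allI impI)
    fix r assume r: "N \<le> r"
    let ?s = "\<lambda>t. real (nat \<lfloor>real (Suc r) * t\<rfloor>) / real (Suc r)"
    have "dist (path (\<lambda>t. f (?s t))) (path f) \<le> e / 2"
    proof (rule dist_path_le)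
      show "cadlag (\<lambda>t. f (?s t))"
        by (rule cadlag_step[where a = "\<lambda>i. f (real i / real (Suc r))"]) simp
      show "cadlag f" using assms by (rule cadlag_continuous_on)
      fix t :: real assume t: "t \<in> {0..1}"
      define i where "i = nat \<lfloor>real (Suc r) * t\<rfloor>"
      have "0 \<le> real (Suc r) * t" using t by (intro mult_nonneg_nonneg) auto
      then have i: "real i \<le> real (Suc r) * t" "real (Suc r) * t < real i + 1"
        unfolding i_def by linarith+
      then have "real i / real (Suc r) \<le> t" "t < (real i + 1) / real (Suc r)"
        by (simp_all only: pos_divide_le_eq pos_less_divide_eq mult.commute of_nat_0_less_iff zero_less_Suc)
      then have "?s t \<le> t" "t - ?s t < 1 / real (Suc r)"
        unfolding i_def[symmetric] by (simp_all only: add_divide_distrib)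
      moreover have "1 / real (Suc r) \<le> 1 / real (Suc N)"
        using r by (intro divide_left_mono) auto
      ultimately have "dist (?s t) t < d"
        using N by (simp add: dist_real_def)
      moreover have "0 \<le> ?s t" by simp
      moreover have "?s t \<le> 1" using \<open>?s t \<le> t\<close> t unfolding atLeastAtMost_iff by linarith
      ultimately have "?s t \<in> {0..1}" "dist (?s t) t < d" by (simp_all only: atLeastAtMost_iff)
      then have "dist (f (?s t)) (f t) < e / 2" using d(2) t by blast
      then show "\<bar>f (?s t) - f t\<bar> \<le> e / 2" by (simp add: dist_real_def)
    qed
    then show "dist (path (\<lambda>t. f (?s t))) (path f) < e" using e by simp
  qed
qed

lemma measurable_path_sample:
  assumes meas: "\<And>t. t \<in> {0..1} \<Longrightarrow> W t \<in> borel_measurable N"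
  shows "(\<lambda>\<omega>. path (\<lambda>t. W (real (nat \<lfloor>real (Suc r) * t\<rfloor>) / real (Suc r)) \<omega>)) \<in> borel_measurable N"
proof -
  \<comment> \<open>\<open>W\<close> is measurable only at times of the unit interval; indices
    beyond \<open>Suc r\<close> would leave it, so they receive the value 0.\<close>
  define a where "a i = (if i \<le> Suc r then W (real i / real (Suc r)) else (\<lambda>_. 0))" for i
  have "a i \<in> borel_measurable N" for i
    unfolding a_def using meas by auto
  from measurable_path_step[of a N "Suc r" 0, OF this]
  have "(\<lambda>\<omega>. path (\<lambda>t. a (nat \<lfloor>real (Suc r) * t\<rfloor>) \<omega>)) \<in> borel_measurable N" by simp
  moreover have "path (\<lambda>t. a (nat \<lfloor>real (Suc r) * t\<rfloor>) \<omega>) =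
      path (\<lambda>t. W (real (nat \<lfloor>real (Suc r) * t\<rfloor>) / real (Suc r)) \<omega>)" for \<omega>
    unfolding a_def by (intro path_cong) (use floor_mult_le in presburger)
  ultimately show ?thesis by simp
qed

text \<open>Measurability is given at single times only. The whole path is a pointwise limit of
  sampled paths, each a continuous image of finitely many coordinates.\<close>

lemma random_function_continuous:
  assumes meas: "\<And>t. t \<in> {0..1} \<Longrightarrow> W t \<in> borel_measurable N"
    and cont: "\<And>\<omega>. \<omega> \<in> space N \<Longrightarrow> continuous_on {0..1} (\<lambda>t. W t \<omega>)"
  shows "random_function N W"
  unfolding random_function_def
proof (intro conjI ballI)
  show "cadlag (\<lambda>t. W t \<omega>)" if "\<omega> \<in> space N" for \<omega>
    using cont[OF that] by (rule cadlag_continuous_on)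
  show "(\<lambda>\<omega>. path (\<lambda>t. W t \<omega>)) \<in> borel_measurable N"
  proof (rule borel_measurable_LIMSEQ_metric)
    show "(\<lambda>r. path (\<lambda>t. W (real (nat \<lfloor>real (Suc r) * t\<rfloor>) / real (Suc r)) \<omega>)) \<longlonglongrightarrow> path (\<lambda>t. W t \<omega>)"
      if "\<omega> \<in> space N" for \<omega>
      using cont[OF that] by (rule path_step_tendsto)
  qed (rule measurable_path_sample[OF meas])
qed

section \<open>Weak convergence\<close>

text \<open>Inf-convolution: the infimum over \<open>y\<close> of
  \<open>F y + real n * dist x y\<close> is Lipschitz with constant \<open>n\<close>, lies below
  \<open>F\<close> and tends to \<open>F\<close> pointwise by continuity. Dominated convergence
  carries this over to the integrals.\<close>

lemma lipschitz_lower_approx: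
  fixes F :: "'c::metric_space \<Rightarrow> real" and Y :: "'b \<Rightarrow> 'c"
  assumes N: "prob_space N" and Y[measurable]: "Y \<in> borel_measurable N"
    and F: "continuous_on UNIV F" "bounded (range F)" and e: "0 < e"
  obtains G L where "\<And>x y. \<bar>G x - G y\<bar> \<le> L * dist x y" "bounded (range G)" "\<And>x. G x \<le> F x"
    "(LINT \<omega>|N. F (Y \<omega>)) - e < (LINT \<omega>|N. G (Y \<omega>))"
proof -
  interpret N: prob_space N by (rule N)
  obtain K where K: "\<And>x. \<bar>F x\<bar> \<le> K"
    using F(2) unfolding bounded_iff by auto
  define G where "G n x = (INF y. F y + real n * dist x y)" for n x
  have lower: "- K \<le> F y + real n * dist x y" for n x y
  proof -
    have "- K \<le> F y" using K[of y] by linarith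
    moreover have "0 \<le> real n * dist x y" by simp
    ultimately show ?thesis by linarith
  qed
  have bdd: "bdd_below (range (\<lambda>y. F y + real n * dist x y))" for n x
    using lower by (intro bdd_belowI2) blast
  have le: "G n x \<le> F y + real n * dist x y" for n x y
    unfolding G_def using bdd by (rule cINF_lower) simp
  have GF: "G n x \<le> F x" for n x
    using le[of n x x] by simp
  have GK: "\<bar>G n x\<bar> \<le> K" for n x
  proof -
    have "- K \<le> G n x" unfolding G_def using lower by (intro cINF_greatest) auto
    then show ?thesis using GF[of n x] K[of x] by linarith
  qed
  have lip: "\<bar>G n x - G n y\<bar> \<le> real n * dist x y" for n x y
  proof -
    have *: "G n x - real n * dist x y \<le> G n y" for x y
      unfolding G_def[of n y]
    proof (intro cINF_greatest)
      fix z
      have "real n * dist x z \<le> real n * (dist x y + dist y z)"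
        by (intro mult_left_mono dist_triangle) auto
      then show "G n x - real n * dist x y \<le> F z + real n * dist y z"
        using le[of n x z] by (simp add: distrib_left)
    qed auto
    show ?thesis using *[of x y] *[of y x] by (simp add: dist_commute)
  qed
  have lim: "(\<lambda>n. G n x) \<longlonglongrightarrow> F x" for x
  proof (rule LIMSEQ_I)
    fix d :: real assume d: "0 < d"
    have "(F \<longlongrightarrow> F x) (at x)" using F(1) by (simp add: continuous_on_def)
    then have "\<forall>\<^sub>F y in at x. dist (F y) (F x) < d / 2" using d by (intro tendstoD) auto
    then obtain \<delta> where \<delta>: "0 < \<delta>" "\<And>y. dist y x < \<delta> \<Longrightarrow> y \<noteq> x \<Longrightarrow> dist (F y) (F x) < d / 2"
      unfolding eventually_at by auto
    \<comment> \<open>Outside the ball of radius \<open>\<delta>\<close> the penalty has to outweigh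
      \<open>2 * K\<close>, the largest possible oscillation of \<open>F\<close>.\<close>
    obtain n0 :: nat where n0: "2 * K / \<delta> < real n0"
      using reals_Archimedean2 by blast
    show "\<exists>n0. \<forall>n\<ge>n0. norm (G n x - F x) < d"
    proof (intro exI allI impI)
      fix n assume n: "n0 \<le> n"
      have "F x - d / 2 \<le> G n x"
        unfolding G_def
      proof (intro cINF_greatest)
        fix y
        show "F x - d / 2 \<le> F y + real n * dist x y"
        proof (cases "dist y x < \<delta>")
          case True
          then have "dist (F y) (F x) < d / 2" using \<delta>(2) d by (cases "y = x") auto
          then have "F x - d / 2 \<le> F y" unfolding dist_real_def by linarith
          moreover have "0 \<le> real n * dist x y" by simp
          ultimately show ?thesis by linarith
        next
          case False
          have "2 * K < real n0 * \<delta>" using n0 \<delta>(1) by (simp add: divide_less_eq)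
          also have "\<dots> \<le> real n * dist x y"
            using n False \<delta>(1) by (intro mult_mono) (auto simp: dist_commute)
          finally have "2 * K < real n * dist x y" .
          then show ?thesis using K[of x] K[of y] d by linarith
        qed
      qed auto
      then show "norm (G n x - F x) < d" using GF[of n x] d by simp
    qed
  qed
  have cont: "continuous_on UNIV (G n)" for n
  proof -
    have "(real n)-lipschitz_on UNIV (G n)"
      using lip[of n] by (intro lipschitz_onI) (simp_all add: dist_real_def)
    then show ?thesis by (rule lipschitz_on_continuous_on)
  qed
  have [measurable]: "G n \<in> borel_measurable borel" "F \<in> borel_measurable borel" for n
    using cont F(1) by (auto intro: borel_measurable_continuous_onI)
  have "(\<lambda>n. LINT \<omega>|N. G n (Y \<omega>)) \<longlonglongrightarrow> (LINT \<omega>|N. F (Y \<omega>))"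
  proof (rule integral_dominated_convergence[where w = "\<lambda>_. K"])
    show "AE \<omega> in N. (\<lambda>n. G n (Y \<omega>)) \<longlonglongrightarrow> F (Y \<omega>)" using lim by simp
    show "AE \<omega> in N. norm (G n (Y \<omega>)) \<le> K" for n using GK by simp
  qed simp_all
  then have "\<forall>\<^sub>F n in sequentially. (LINT \<omega>|N. F (Y \<omega>)) - e < (LINT \<omega>|N. G n (Y \<omega>))"
    by (rule order_tendstoD) (use e in simp)
  then obtain n where "(LINT \<omega>|N. F (Y \<omega>)) - e < (LINT \<omega>|N. G n (Y \<omega>))"
    by (auto simp: eventually_sequentially)
  moreover have "bounded (range (G n))"
    using GK[of n] unfolding bounded_iff by auto
  ultimately show ?thesis using that[of "G n" "real n"] lip GF by blast
qed

text \<open>A Lipschitz minorant with almost the same limit integral gives the lower half of the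
  convergence; the upper half is the lower half for \<open>- F\<close>.\<close>

lemma lipschitz_portmanteau:
  fixes F :: "'c::metric_space \<Rightarrow> real" and X :: "nat \<Rightarrow> 'a \<Rightarrow> 'c" and Y :: "'b \<Rightarrow> 'c"
  assumes P: "prob_space P" and X[measurable]: "\<And>m. X m \<in> borel_measurable P"
    and N: "prob_space N" and Y[measurable]: "Y \<in> borel_measurable N"
    and lip: "\<And>(G :: 'c \<Rightarrow> real) L. (\<And>x y. \<bar>G x - G y\<bar> \<le> L * dist x y) \<Longrightarrow> bounded (range G) \<Longrightarrow>
      (\<lambda>m. LINT \<omega>|P. G (X m \<omega>)) \<longlonglongrightarrow> (LINT \<omega>|N. G (Y \<omega>))"
    and F: "continuous_on UNIV F" "bounded (range F)"
  shows "(\<lambda>m. LINT \<omega>|P. F (X m \<omega>)) \<longlonglongrightarrow> (LINT \<omega>|N. F (Y \<omega>))"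
proof -
  interpret P: prob_space P by (rule P)
  have lower: "\<forall>\<^sub>F m in sequentially. (LINT \<omega>|N. F (Y \<omega>)) - e < (LINT \<omega>|P. F (X m \<omega>))"
    if F: "continuous_on UNIV F" "bounded (range F)" and e: "0 < e" for F :: "'c \<Rightarrow> real" and e
  proof -
    obtain G L where G: "\<And>x y. \<bar>G x - G y\<bar> \<le> L * dist x y" "bounded (range G)" "\<And>x. G x \<le> F x"
      "(LINT \<omega>|N. F (Y \<omega>)) - e < (LINT \<omega>|N. G (Y \<omega>))"
      using lipschitz_lower_approx[OF N Y F e] by metis
    have "\<bar>L\<bar>-lipschitz_on UNIV G"
    proof (rule lipschitz_onI)
      fix x y :: 'c
      have "L * dist x y \<le> \<bar>L\<bar> * dist x y" by (intro mult_right_mono) auto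
      then show "dist (G x) (G y) \<le> \<bar>L\<bar> * dist x y"
        unfolding dist_real_def using G(1)[of x y] by linarith
    qed simp
    then have "continuous_on UNIV G" by (rule lipschitz_on_continuous_on)
    then have [measurable]: "G \<in> borel_measurable borel" by (rule borel_measurable_continuous_onI)
    have [measurable]: "F \<in> borel_measurable borel" using F(1) by (rule borel_measurable_continuous_onI)
    have int: "integrable P (\<lambda>\<omega>. H (X m \<omega>))"
      if [measurable]: "H \<in> borel_measurable borel" and b: "bounded (range H)" for H :: "'c \<Rightarrow> real" and m
    proof -
      obtain K where "\<And>x. \<bar>H x\<bar> \<le> K" using b unfolding bounded_iff by auto
      then show ?thesis by (intro P.integrable_const_bound[where B = K]) auto
    qed
    have "\<forall>\<^sub>F m in sequentially. (LINT \<omega>|N. F (Y \<omega>)) - e < (LINT \<omega>|P. G (X m \<omega>))"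
      by (rule order_tendstoD(1)[OF lip[OF G(1,2)] G(4)])
    then show ?thesis
    proof eventually_elim
      case (elim m)
      also have "(LINT \<omega>|P. G (X m \<omega>)) \<le> (LINT \<omega>|P. F (X m \<omega>))"
        by (intro integral_mono int G F) auto
      finally show ?case .
    qed
  qed
  show ?thesis
  proof (rule order_tendstoI)
    fix a assume "a < (LINT \<omega>|N. F (Y \<omega>))"
    then show "\<forall>\<^sub>F m in sequentially. a < (LINT \<omega>|P. F (X m \<omega>))"
      using lower[OF F, of "(LINT \<omega>|N. F (Y \<omega>)) - a"] by simp
  next
    fix a assume a: "(LINT \<omega>|N. F (Y \<omega>)) < a"
    have "continuous_on UNIV (\<lambda>x. - F x)" "bounded (range (\<lambda>x. - F x))"
      using F by (auto simp: bounded_iff intro!: continuous_intros)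
    from lower[OF this, of "a - (LINT \<omega>|N. F (Y \<omega>))"] a
    show "\<forall>\<^sub>F m in sequentially. (LINT \<omega>|P. F (X m \<omega>)) < a" by simp
  qed
qed

section \<open>Functionals of finitely many independent variables\<close>

lemma indep_vars_PiM_components:
  assumes fin: "finite I" "I \<noteq> {}" and M: "\<And>i. prob_space (M i)"
  shows "prob_space.indep_vars (PiM I M) M (\<lambda>i \<omega>. \<omega> i) I"
proof -
  interpret product_prob_space M I by (rule product_prob_spaceI) (rule M)
  have "distr (PiM I M) (PiM I M) (\<lambda>\<omega>. restrict \<omega> I) = distr (PiM I M) (PiM I M) (\<lambda>\<omega>. \<omega>)"
    by (intro distr_cong) (auto simp: space_PiM)
  also have "\<dots> = PiM I (\<lambda>i. distr (PiM I M) (M i) (\<lambda>\<omega>. \<omega> i))"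
    using M by (auto intro!: PiM_cong simp: distr_PiM_component)
  finally show ?thesis
    by (subst P.indep_vars_iff_distr_eq_PiM'[OF fin(2)]) auto
qed

text \<open>The integral depends on the marginal laws alone, so the variables may be exchanged for
  others with the same laws on a different space.\<close>

lemma (in prob_space) integral_indep_vars_PiM:
  fixes \<Psi> :: "('i \<Rightarrow> 'c) \<Rightarrow> real"
  assumes "I \<noteq> {}" and indep: "indep_vars S W I"
    and \<Psi>: "\<Psi> \<in> borel_measurable (PiM I S)"
  shows "(LINT \<omega>|M. \<Psi> (\<lambda>i\<in>I. W i \<omega>)) = (LINT u|PiM I (\<lambda>i. distr M (S i) (W i)). \<Psi> u)"
proof -
  have rv: "random_variable (S i) (W i)" if "i \<in> I" for i
    using indep that unfolding indep_vars_def by simp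
  have "(LINT u|PiM I (\<lambda>i. distr M (S i) (W i)). \<Psi> u) = (LINT u|distr M (PiM I S) (\<lambda>\<omega>. \<lambda>i\<in>I. W i \<omega>). \<Psi> u)"
    using indep_vars_iff_distr_eq_PiM'[THEN iffD1, OF assms(1) rv indep] by simp
  also have "\<dots> = (LINT \<omega>|M. \<Psi> (\<lambda>i\<in>I. W i \<omega>))"
    by (intro integral_distr \<Psi> measurable_restrict rv)
  finally show ?thesis ..
qed

text \<open>Independence lets the Skorokhod representation, available for real random variables, be
  applied to each coordinate separately, on a product space.\<close>

lemma indep_vars_weak_conv:
  fixes X :: "nat \<Rightarrow> 'i::countable \<Rightarrow> 'a \<Rightarrow> real" and Z :: "'i \<Rightarrow> 'b \<Rightarrow> real"
    and \<Psi> :: "('i \<Rightarrow> real) \<Rightarrow> real"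
  assumes P: "prob_space P" and N: "prob_space N" and I: "finite I" "I \<noteq> {}"
    and X: "\<And>m. prob_space.indep_vars P (\<lambda>_. borel) (X m) I"
    and Z: "prob_space.indep_vars N (\<lambda>_. borel) Z I"
    and conv: "\<And>i. i \<in> I \<Longrightarrow> weak_conv_m (\<lambda>m. distr P borel (X m i)) (distr N borel (Z i))"
    and \<Psi>: "continuous_on UNIV \<Psi>" "bounded (range \<Psi>)"
  shows "(\<lambda>m. LINT \<omega>|P. \<Psi> (\<lambda>i. if i \<in> I then X m i \<omega> else 0)) \<longlonglongrightarrow>
    (LINT \<omega>|N. \<Psi> (\<lambda>i. if i \<in> I then Z i \<omega> else 0))"
proof -
  interpret P: prob_space P by (rule P)
  interpret N: prob_space N by (rule N)
  have rvX: "X m i \<in> borel_measurable P" if "i \<in> I" for m i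
    using X[of m] that unfolding P.indep_vars_def by simp
  have rvZ: "Z i \<in> borel_measurable N" if "i \<in> I" for i
    using Z that unfolding N.indep_vars_def by simp
  have "\<exists>(\<Omega> :: real measure) (Y_seq :: nat \<Rightarrow> real \<Rightarrow> real) (Y :: real \<Rightarrow> real).
    prob_space \<Omega> \<and> (\<forall>m. Y_seq m \<in> borel_measurable \<Omega>) \<and>
    (\<forall>m. distr \<Omega> borel (Y_seq m) = distr P borel (X m i)) \<and>
    Y \<in> borel_measurable \<Omega> \<and> distr \<Omega> borel Y = distr N borel (Z i) \<and>
    (\<forall>x \<in> space \<Omega>. (\<lambda>m. Y_seq m x) \<longlonglongrightarrow> Y x)" if "i \<in> I" for i
    using Skorohod[OF _ _ conv[OF that]] rvX rvZ that
    by (auto simp: P.real_distribution_distr N.real_distribution_distr)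
  \<comment> \<open>The product needs a probability measure at every index; a point mass serves
    outside \<open>I\<close>.\<close>
  moreover have "prob_space (return borel (0::real))"
    by (rule prob_space_return) simp
  ultimately have "\<exists>(\<Omega> :: real measure) (Y_seq :: nat \<Rightarrow> real \<Rightarrow> real) (Y :: real \<Rightarrow> real).
    prob_space \<Omega> \<and> (i \<in> I \<longrightarrow> (\<forall>m. Y_seq m \<in> borel_measurable \<Omega>) \<and>
    (\<forall>m. distr \<Omega> borel (Y_seq m) = distr P borel (X m i)) \<and>
    Y \<in> borel_measurable \<Omega> \<and> distr \<Omega> borel Y = distr N borel (Z i) \<and>
    (\<forall>x \<in> space \<Omega>. (\<lambda>m. Y_seq m x) \<longlonglongrightarrow> Y x))" for i
    by (cases "i \<in> I") blast+
  then obtain \<Omega> :: "'i \<Rightarrow> real measure" and V :: "'i \<Rightarrow> nat \<Rightarrow> real \<Rightarrow> real" and V' :: "'i \<Rightarrow> real \<Rightarrow> real"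
    where \<Omega>: "\<And>i. prob_space (\<Omega> i)" and V: "\<And>i. i \<in> I \<Longrightarrow> (\<forall>m. V i m \<in> borel_measurable (\<Omega> i)) \<and>
    (\<forall>m. distr (\<Omega> i) borel (V i m) = distr P borel (X m i)) \<and>
    V' i \<in> borel_measurable (\<Omega> i) \<and> distr (\<Omega> i) borel (V' i) = distr N borel (Z i) \<and>
    (\<forall>x \<in> space (\<Omega> i). (\<lambda>m. V i m x) \<longlonglongrightarrow> V' i x)"
    by metis
  interpret \<Omega>: product_prob_space \<Omega> I by (rule product_prob_spaceI) (rule \<Omega>)
  let ?\<Omega> = "PiM I \<Omega>"
  \<comment> \<open>\<open>\<Psi>\<close> reads total functions, whereas points of the product are
    \<open>undefined\<close> off \<open>I\<close>; padding with 0 reconciles the two.\<close>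
  define ext where "ext u = (\<lambda>i. if i \<in> I then u i else (0::real))" for u :: "'i \<Rightarrow> real"
  have ext_restrict: "ext (restrict u I) = ext u" for u by (auto simp: ext_def)
  have "ext \<in> borel_measurable (PiM I (\<lambda>_. borel))"
  proof (rule measurable_coordinatewise_then_product)
    show "(\<lambda>u. ext u i) \<in> borel_measurable (PiM I (\<lambda>_. borel))" for i
      unfolding ext_def by (cases "i \<in> I") auto
  qed
  from measurable_compose[OF this borel_measurable_continuous_onI[OF \<Psi>(1)]]
  have meas: "(\<lambda>u. \<Psi> (ext u)) \<in> borel_measurable (PiM I (\<lambda>_. borel))" .
  obtain K where K: "\<And>u. \<bar>\<Psi> u\<bar> \<le> K" using \<Psi>(2) unfolding bounded_iff by auto
  \<comment> \<open>Both sides are integrals against the same product of marginal laws; used for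
    each \<open>X m\<close> and for \<open>Z\<close>.\<close>
  have couple: "(LINT \<omega>|R. \<Psi> (ext (\<lambda>i. W i \<omega>))) = (LINT x|?\<Omega>. \<Psi> (ext (\<lambda>i. f i (x i))))"
    if R: "prob_space R" and W: "prob_space.indep_vars R (\<lambda>_. borel) W I"
      and f[measurable]: "\<And>i. i \<in> I \<Longrightarrow> f i \<in> borel_measurable (\<Omega> i)"
      and eq: "\<And>i. i \<in> I \<Longrightarrow> distr (\<Omega> i) borel (f i) = distr R borel (W i)" for R :: "'d measure" and W f
  proof -
    interpret R: prob_space R by (rule R)
    have "\<Omega>.indep_vars (\<lambda>_. borel) (\<lambda>i x. f i (x i)) I"
      by (rule \<Omega>.indep_vars_compose2[OF indep_vars_PiM_components[OF I \<Omega>] f])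
    then have "(LINT x|?\<Omega>. \<Psi> (ext (\<lambda>i\<in>I. f i (x i)))) =
      (LINT u|PiM I (\<lambda>i. distr ?\<Omega> borel (\<lambda>x. f i (x i))). \<Psi> (ext u))"
      by (intro \<Omega>.integral_indep_vars_PiM I meas)
    also have "PiM I (\<lambda>i. distr ?\<Omega> borel (\<lambda>x. f i (x i))) = PiM I (\<lambda>i. distr R borel (W i))"
    proof (rule PiM_cong)
      fix i assume i: "i \<in> I"
      have "distr ?\<Omega> borel (\<lambda>x. f i (x i)) = distr (distr ?\<Omega> (\<Omega> i) (\<lambda>x. x i)) borel (f i)"
        using i by (subst distr_distr) (auto simp: comp_def)
      also have "\<dots> = distr R borel (W i)"
        using i \<Omega> eq by (simp add: distr_PiM_component)
      finally show "distr ?\<Omega> borel (\<lambda>x. f i (x i)) = distr R borel (W i)" .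
    qed simp
    also have "(LINT u|PiM I (\<lambda>i. distr R borel (W i)). \<Psi> (ext u)) = (LINT \<omega>|R. \<Psi> (ext (\<lambda>i\<in>I. W i \<omega>)))"
      by (intro R.integral_indep_vars_PiM[symmetric] I meas W)
    finally show ?thesis by (simp only: ext_restrict)
  qed
  have coord: "(\<lambda>x. \<Psi> (ext (\<lambda>i. f i (x i)))) \<in> borel_measurable ?\<Omega>"
    if f[measurable]: "\<And>i. i \<in> I \<Longrightarrow> f i \<in> borel_measurable (\<Omega> i)" for f
  proof -
    have "(\<lambda>x. \<lambda>i\<in>I. f i (x i)) \<in> measurable ?\<Omega> (PiM I (\<lambda>_. borel))"
      by (intro measurable_restrict) measurable
    from measurable_compose[OF this meas] show ?thesis by (simp only: ext_restrict)
  qed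
  \<comment> \<open>On the coupled space every coordinate converges pointwise, hence so does the
    argument of \<open>\<Psi>\<close> in the product topology.\<close>
  have "(\<lambda>m. LINT x|?\<Omega>. \<Psi> (ext (\<lambda>i. V i m (x i)))) \<longlonglongrightarrow> (LINT x|?\<Omega>. \<Psi> (ext (\<lambda>i. V' i (x i))))"
  proof (rule integral_dominated_convergence[where w = "\<lambda>_. K"])
    show "AE x in ?\<Omega>. (\<lambda>m. \<Psi> (ext (\<lambda>i. V i m (x i)))) \<longlonglongrightarrow> \<Psi> (ext (\<lambda>i. V' i (x i)))"
    proof (rule AE_I2)
      fix x assume x: "x \<in> space ?\<Omega>"
      have "(\<lambda>m. ext (\<lambda>i. V i m (x i)) i) \<longlonglongrightarrow> ext (\<lambda>i. V' i (x i)) i" for i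
        using V[of i] x by (cases "i \<in> I") (auto simp: ext_def space_PiM PiE_def Pi_def)
      then have "(\<lambda>m. ext (\<lambda>i. V i m (x i))) \<longlonglongrightarrow> ext (\<lambda>i. V' i (x i))"
        by (simp add: limitin_componentwise flip: limitin_canonical_iff euclidean_product_topology)
      then show "(\<lambda>m. \<Psi> (ext (\<lambda>i. V i m (x i)))) \<longlonglongrightarrow> \<Psi> (ext (\<lambda>i. V' i (x i)))"
        by (intro continuous_on_tendsto_compose[OF \<Psi>(1)]) auto
    qed
    show "AE x in ?\<Omega>. norm (\<Psi> (ext (\<lambda>i. V i m (x i)))) \<le> K" for m using K by simp
  qed (use V in \<open>auto intro!: coord\<close>)
  then show ?thesis
    using couple[OF P X, of "\<lambda>i. V i m" m for m] couple[OF N Z, of V'] V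
    by (simp add: ext_def)
qed

section \<open>One-dependent sequences\<close>

lemma cmod_iexp_minus_1: "cmod (iexp y - 1) \<le> \<bar>y\<bar>"
  using iexp_approx1[of y 0] by simp

lemma cmod_iexp_approx_1: "cmod (iexp y - 1 - \<i> * y) \<le> y\<^sup>2 / 2"
  using iexp_approx1[of y 1] by (simp add: diff_diff_eq power2_eq_square)

lemma cmod_iexp_approx_2: "cmod (iexp y - 1 - \<i> * y + y\<^sup>2 / 2) \<le> \<bar>y\<bar> ^ 3 / 6"
proof -
  have "(\<Sum>k\<le>2. (\<i> * complex_of_real y) ^ k / fact k) = 1 + \<i> * y - y\<^sup>2 / 2"
    by (simp add: numeral_2_eq_2 power_mult_distrib)
  then show ?thesis
    using iexp_approx1[of y 2] by (simp add: numeral_3_eq_3 fact_numeral numeral_2_eq_2 algebra_simps)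
qed

text \<open>Here \<open>a\<close>, \<open>b\<close>, \<open>d\<close> are the last three terms and
  \<open>y0\<close> is the sum before them. The increment is expanded so that each product of terms
  is multiplied by an exponential sharing no letter with it: \<open>d\<close> and
  \<open>d\<^sup>2\<close> stand beside the sum without \<open>b\<close>, and \<open>b * d\<close>
  beside the sum without \<open>a\<close>. Each such removal costs only third order in
  \<open>\<theta>\<close>.\<close>

lemma iexp_step_remainder:
  fixes \<theta> y0 a b d K :: real
  assumes "\<bar>a\<bar> \<le> K" "\<bar>b\<bar> \<le> K" "\<bar>d\<bar> \<le> K"
  shows "cmod (iexp (\<theta> * (y0 + a + b + d)) - iexp (\<theta> * (y0 + a + b)) -
    (\<i> * \<theta> * (iexp (\<theta> * (y0 + a)) * d) - \<theta>\<^sup>2 * (iexp (\<theta> * y0) * (b * d)) -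
     \<theta>\<^sup>2 / 2 * (iexp (\<theta> * (y0 + a)) * d\<^sup>2))) \<le> 3 * (\<bar>\<theta>\<bar> ^ 3 * K ^ 3)"
    (is "cmod ?R \<le> _")
proof -
  have K: "0 \<le> K" using assms(1) by linarith
  have bnd: "\<bar>\<theta> * a\<bar> \<le> \<bar>\<theta>\<bar> * K" "\<bar>\<theta> * b\<bar> \<le> \<bar>\<theta>\<bar> * K" "\<bar>\<theta> * d\<bar> \<le> \<bar>\<theta>\<bar> * K"
    using assms by (simp_all add: abs_mult mult_left_mono)
  define U0 where "U0 = iexp (\<theta> * y0)"
  define Ea where "Ea = iexp (\<theta> * a)"
  define Eb where "Eb = iexp (\<theta> * b)"
  define Ed where "Ed = iexp (\<theta> * d)"
  have U1: "iexp (\<theta> * (y0 + a)) = U0 * Ea"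
    and U2: "iexp (\<theta> * (y0 + a + b)) = U0 * Ea * Eb"
    and U3: "iexp (\<theta> * (y0 + a + b + d)) = U0 * Ea * Eb * Ed"
    unfolding U0_def Ea_def Eb_def Ed_def by (simp_all add: distrib_left exp_add)
  have norms: "cmod U0 = 1" "cmod Ea = 1" "cmod Eb = 1"
    unfolding U0_def Ea_def Eb_def by simp_all
  \<comment> \<open>\<open>?t1\<close> is the Taylor remainder in \<open>d\<close>,
    \<open>?t2\<close> the one in \<open>b\<close> inside the linear term; \<open>?t3\<close> and
    \<open>?t4\<close> pay for removing \<open>b\<close> from the quadratic and \<open>a\<close>
    from the mixed term. The constants 1/6, 1/2, 1/2 and 1 add up to less than 3.\<close>
  let ?t1 = "U0 * Ea * Eb * (Ed - 1 - \<i> * of_real (\<theta> * d) + of_real ((\<theta> * d)\<^sup>2) / 2)"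
  let ?t2 = "U0 * Ea * (Eb - 1 - \<i> * of_real (\<theta> * b)) * (\<i> * of_real (\<theta> * d))"
  let ?t3 = "U0 * Ea * (Eb - 1) * (of_real ((\<theta> * d)\<^sup>2) / 2)"
  let ?t4 = "U0 * (Ea - 1) * of_real (\<theta> * b) * of_real (\<theta> * d)"
  have R: "?R = ?t1 + ?t2 - ?t3 - ?t4"
    unfolding U1 U2 U3 U0_def[symmetric]
    by (simp add: algebra_simps power2_eq_square) (simp add: diff_divide_distrib)
  have "cmod ?t1 \<le> (\<bar>\<theta>\<bar> * K) ^ 3 / 6"
  proof -
    have "cmod ?t1 \<le> \<bar>\<theta> * d\<bar> ^ 3 / 6"
      using cmod_iexp_approx_2[of "\<theta> * d"] norms by (simp add: norm_mult Ed_def)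
    also have "\<dots> \<le> (\<bar>\<theta>\<bar> * K) ^ 3 / 6"
      using bnd by (intro divide_right_mono power_mono) auto
    finally show ?thesis .
  qed
  moreover have "cmod ?t2 \<le> (\<bar>\<theta>\<bar> * K) ^ 3 / 2"
  proof -
    have "cmod ?t2 \<le> ((\<theta> * b)\<^sup>2 / 2) * \<bar>\<theta> * d\<bar>"
      using mult_right_mono[OF cmod_iexp_approx_1[of "\<theta> * b"], of "\<bar>\<theta> * d\<bar>"] norms
      by (simp add: norm_mult Eb_def abs_mult)
    also have "\<dots> = (\<bar>\<theta> * b\<bar>\<^sup>2 / 2) * \<bar>\<theta> * d\<bar>" by simp
    also have "\<dots> \<le> ((\<bar>\<theta>\<bar> * K)\<^sup>2 / 2) * (\<bar>\<theta>\<bar> * K)"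
      using bnd K by (intro mult_mono divide_right_mono power_mono) auto
    finally show ?thesis by (simp add: power2_eq_square power3_eq_cube)
  qed
  moreover have "cmod ?t3 \<le> (\<bar>\<theta>\<bar> * K) ^ 3 / 2"
  proof -
    have "cmod ?t3 \<le> \<bar>\<theta> * b\<bar> * ((\<theta> * d)\<^sup>2 / 2)"
      using cmod_iexp_minus_1[of "\<theta> * b"] norms
      by (simp add: norm_mult norm_divide Eb_def mult_right_mono norm_power power_mult_distrib)
    also have "\<dots> = \<bar>\<theta> * b\<bar> * (\<bar>\<theta> * d\<bar>\<^sup>2 / 2)" by simp
    also have "\<dots> \<le> (\<bar>\<theta>\<bar> * K) * ((\<bar>\<theta>\<bar> * K)\<^sup>2 / 2)"
      using bnd K by (intro mult_mono divide_right_mono power_mono) auto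
    finally show ?thesis by (simp add: power2_eq_square power3_eq_cube)
  qed
  moreover have "cmod ?t4 \<le> (\<bar>\<theta>\<bar> * K) ^ 3"
  proof -
    have "cmod ?t4 = cmod (Ea - 1) * \<bar>\<theta> * b\<bar> * \<bar>\<theta> * d\<bar>"
      using norms by (simp add: norm_mult abs_mult)
    also have "\<dots> \<le> (\<bar>\<theta>\<bar> * K) * (\<bar>\<theta>\<bar> * K) * (\<bar>\<theta>\<bar> * K)"
      using bnd K order_trans[OF cmod_iexp_minus_1[of "\<theta> * a"] bnd(1)]
      by (intro mult_mono) (auto simp: Ea_def)
    finally show ?thesis by (simp add: power3_eq_cube)
  qed
  moreover have "cmod (?t1 + ?t2 - ?t3 - ?t4) \<le> cmod ?t1 + cmod ?t2 + cmod ?t3 + cmod ?t4"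
    by (intro order_trans[OF norm_triangle_ineq4] add_mono norm_triangle_ineq order_refl)
  moreover have "0 \<le> (\<bar>\<theta>\<bar> * K) ^ 3" using K by simp
  moreover have "\<bar>\<theta>\<bar> ^ 3 * K ^ 3 = (\<bar>\<theta>\<bar> * K) ^ 3" by (simp add: power_mult_distrib)
  ultimately show ?thesis unfolding R by linarith
qed

lemma (in prob_space) integrable_bounded_complex:
  assumes "f \<in> borel_measurable M" "\<And>\<omega>. cmod (f \<omega>) \<le> K"
  shows "integrable M f"
  using assms by (intro integrable_const_bound[where B = K]) auto

lemma (in prob_space) norm_expectation_le:
  fixes f :: "'a \<Rightarrow> 'd::{banach, second_countable_topology}"
  assumes f: "f \<in> borel_measurable M" "\<And>\<omega>. norm (f \<omega>) \<le> K"
  shows "norm (expectation f) \<le> K"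
proof -
  have int: "integrable M f" using f by (intro integrable_const_bound[where B = K]) auto
  have "norm (expectation f) \<le> expectation (\<lambda>\<omega>. norm (f \<omega>))" by (rule integral_norm_bound)
  also have "\<dots> \<le> expectation (\<lambda>_. K)" by (intro integral_mono integrable_norm int) (use f in auto)
  finally show ?thesis by (simp add: prob_space)
qed

text \<open>Comparison with \<open>exp (- x m) ^ l m\<close>: for bases between 0 and 1 the powers
  differ by at most \<open>l m\<close> times the difference of the bases, which is at most the
  square of \<open>x m\<close>, while \<open>l m * x m\<close> converges.\<close>

lemma tendsto_power_exp:
  fixes x :: "nat \<Rightarrow> real" and l :: "nat \<Rightarrow> nat"
  assumes x: "x \<longlonglongrightarrow> 0" "\<And>m. 0 \<le> x m" and lx: "(\<lambda>m. real (l m) * x m) \<longlonglongrightarrow> y"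
  shows "(\<lambda>m. (1 - x m) ^ l m) \<longlonglongrightarrow> exp (- y)"
proof -
  have "\<forall>\<^sub>F m in sequentially. x m < 1"
    using order_tendstoD(2)[OF x(1), of 1] by simp
  then have "\<forall>\<^sub>F m in sequentially. norm ((1 - x m) ^ l m - exp (- (real (l m) * x m))) \<le> real (l m) * x m * x m"
  proof eventually_elim
    case (elim m)
    have "norm ((1 - x m) ^ l m - exp (- x m) ^ l m) \<le> real (l m) * norm ((1 - x m) - exp (- x m))"
      using x(2)[of m] elim by (intro norm_power_diff) auto
    also have "norm ((1 - x m) - exp (- x m)) \<le> x m * x m"
    proof -
      have "1 - x m \<le> exp (- x m)"
        using exp_ge_add_one_self[of "- x m"] by simp
      moreover have "exp (- x m) \<le> 1 - x m + x m * x m"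
      proof -
        \<comment> \<open>The right-hand side equals \<open>1 + x m ^ 3\<close>.\<close>
        have "1 \<le> (1 - x m + x m * x m) * (1 + x m)"
          using x(2)[of m] by (simp add: algebra_simps)
        also have "\<dots> \<le> (1 - x m + x m * x m) * exp (x m)"
          using x(2)[of m] elim exp_ge_add_one_self[of "x m"] by (intro mult_left_mono) auto
        finally show ?thesis by (simp add: exp_minus inverse_eq_divide pos_divide_le_eq)
      qed
      ultimately show ?thesis by simp
    qed
    finally show ?case
      by (simp add: exp_of_nat_mult[symmetric] mult.assoc mult_left_mono)
  qed
  moreover have "(\<lambda>m. real (l m) * x m * x m) \<longlonglongrightarrow> 0"
    using tendsto_mult[OF lx x(1)] by simp
  ultimately have *: "(\<lambda>m. (1 - x m) ^ l m - exp (- (real (l m) * x m))) \<longlonglongrightarrow> 0"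
    by (rule Lim_null_comparison)
  have "(\<lambda>m. exp (- (real (l m) * x m))) \<longlonglongrightarrow> exp (- y)"
    by (intro tendsto_exp tendsto_minus lx)
  from this * show ?thesis by (rule Lim_transform)
qed

lemma real_div_bounds:
  assumes "0 < r"
  shows "real (m div r) \<le> real m / real r" "real m / real r - 1 < real (m div r)"
proof -
  show "real (m div r) \<le> real m / real r" by (rule of_nat_div_le_of_nat)
  have "m < r * (m div r) + r"
    using mod_less_divisor[OF assms, of m] mult_div_mod_eq[of r m] by linarith
  then have "real m < real r * real (m div r) + real r"
    by (metis of_nat_add of_nat_less_iff of_nat_mult)
  then have "real m / real r < real (m div r) + 1"
    using assms by (simp add: pos_divide_less_eq algebra_simps)
  then show "real m / real r - 1 < real (m div r)" by simp
qed

section \<open>Increments of Brownian motion on a grid\<close>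

lemma brownian_increment_distr:
  assumes B: "standard_brownian_motion N B" and r: "0 < r" "j < r"
  shows "distr N borel (\<lambda>\<omega>. sqrt (real r) * (B (real (Suc j) / real r) \<omega> - B (real j / real r) \<omega>)) = std_normal_distribution"
proof -
  let ?s = "real j / real r" and ?t = "real (Suc j) / real r"
  have N: "prob_space N" using B by (simp add: standard_brownian_motion_def)
  then interpret N: prob_space N .
  have st: "0 \<le> ?s" "?s < ?t" "?t \<le> 1" "?t - ?s = 1 / real r"
    using r by (simp_all add: divide_strict_right_mono flip: diff_divide_distrib)
  then have "distributed N lborel (\<lambda>\<omega>. B ?t \<omega> - B ?s \<omega>) (normal_density 0 (sqrt (?t - ?s)))"
    using B unfolding standard_brownian_motion_def by blast
  then have "distributed N lborel (\<lambda>\<omega>. B ?t \<omega> - B ?s \<omega>) (normal_density 0 (sqrt (1 / real r)))"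
    unfolding st(4) .
  then have "distributed N lborel (\<lambda>\<omega>. (B ?t \<omega> - B ?s \<omega> - 0) / sqrt (1 / real r)) std_normal_density"
    by (subst (asm) N.normal_standard_normal_convert) (use r in auto)
  then have "distr N lborel (\<lambda>\<omega>. (B ?t \<omega> - B ?s \<omega> - 0) / sqrt (1 / real r)) = std_normal_distribution"
    by (rule distributed_distr_eq_density[symmetric, THEN sym])
  moreover have "(\<lambda>\<omega>. (B ?t \<omega> - B ?s \<omega> - 0) / sqrt (1 / real r)) = (\<lambda>\<omega>. sqrt (real r) * (B ?t \<omega> - B ?s \<omega>))"
    using r by (simp add: real_sqrt_divide mult.commute)
  moreover have "distr N lborel f = distr N borel f" for f :: "'a \<Rightarrow> real"
    by (rule distr_cong) auto
  ultimately show ?thesis by simp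
qed

lemma brownian_indep_increments:
  assumes B: "standard_brownian_motion N B" and r: "0 < r"
  shows "prob_space.indep_vars N (\<lambda>_. borel) (\<lambda>j \<omega>. B (real (Suc j) / real r) \<omega> - B (real j / real r) \<omega>) {..<r}"
proof -
  have "mono_on {..r} (\<lambda>i. real i / real r)" by (auto intro!: mono_onI divide_right_mono)
  moreover have "(\<lambda>i. real i / real r) ` {..r} \<subseteq> {0..1}" using r by auto
  ultimately show ?thesis using B unfolding standard_brownian_motion_def by blast
qed

section \<open>Sums over letters and their independence\<close>

text \<open>\<open>v + 2 * c\<close> is the limiting variance per term: terms two or more apart
  share no letter and are uncorrelated. Stationarity enters only through the three constant moments,
  and \<open>C\<close> bounds the terms everywhere, as the expansions and the maximal inequality
  require.\<close>

locale one_dependent_sequence = prob_space +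
  fixes S :: "'c measure" and x :: "nat \<Rightarrow> 'a \<Rightarrow> 'c" and h :: "'c \<Rightarrow> 'c \<Rightarrow> real" and C v c :: real
  assumes indep: "indep_vars (\<lambda>_. S) x UNIV"
    and h_measurable: "case_prod h \<in> borel_measurable (S \<Otimes>\<^sub>M S)"
    and h_bound: "\<And>a b. \<bar>h a b\<bar> \<le> C"
    and mean: "\<And>i. expectation (\<lambda>\<omega>. h (x i \<omega>) (x (Suc i) \<omega>)) = 0"
    and var: "\<And>i. expectation (\<lambda>\<omega>. (h (x i \<omega>) (x (Suc i) \<omega>))\<^sup>2) = v"
    and cov: "\<And>i. expectation (\<lambda>\<omega>. h (x i \<omega>) (x (Suc i) \<omega>) * h (x (Suc i) \<omega>) (x (Suc (Suc i)) \<omega>)) = c"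
    and pos: "0 < v + 2 * c" "0 < C"
begin

definition \<xi> :: "nat \<Rightarrow> 'a \<Rightarrow> real" where
  "\<xi> i \<omega> = h (x i \<omega>) (x (Suc i) \<omega>)"

definition D :: "nat \<Rightarrow> nat \<Rightarrow> 'a \<Rightarrow> real" where
  "D s l \<omega> = (\<Sum>i<l. \<xi> (s + i) \<omega>)"

text \<open>The sigma-algebra of the letters with index in \<open>A\<close>. Keeping it as a measure
  lets independence be reduced to disjointness of index sets.\<close>

definition gen :: "nat set \<Rightarrow> 'a measure" where
  "gen A = vimage_algebra (space M) (\<lambda>\<omega>. \<lambda>i\<in>A. x i \<omega>) (PiM A (\<lambda>_. S))"

lemma x_measurable [measurable]: "x i \<in> measurable M S"
  using indep unfolding indep_vars_def by simp

lemma space_gen [simp]: "space (gen A) = space M"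
  by (simp add: gen_def)

lemma sets_gen: "sets (gen A) = sigma_sets (space M) {(\<lambda>\<omega>. \<lambda>i\<in>A. x i \<omega>) -` B \<inter> space M |B. B \<in> sets (PiM A (\<lambda>_. S))}"
  unfolding gen_def by (rule sets_vimage_algebra)

lemma sets_gen_subset: "sets (gen A) \<subseteq> sets M"
  unfolding sets_gen
proof (rule sets.sigma_sets_subset, safe)
  have [measurable]: "(\<lambda>\<omega>. \<lambda>i\<in>A. x i \<omega>) \<in> measurable M (PiM A (\<lambda>_. S))"
    by (intro measurable_restrict x_measurable)
  fix B assume "B \<in> sets (PiM A (\<lambda>_. S))"
  then show "(\<lambda>\<omega>. \<lambda>i\<in>A. x i \<omega>) -` B \<inter> space M \<in> events" by measurable
qed

lemma measurable_gen_imp: "W \<in> measurable (gen A) N \<Longrightarrow> W \<in> measurable M N"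
  using sets_gen_subset[of A] by (auto simp: measurable_def)

lemma indep_vars_gen:
  assumes disj: "disjoint_family_on K L" and W: "\<And>j. j \<in> L \<Longrightarrow> W j \<in> measurable (gen (K j)) (N j)"
  shows "indep_vars N W L"
proof -
  have "indep_vars (\<lambda>j. PiM (K j) (\<lambda>_. S)) (\<lambda>j \<omega>. \<lambda>i\<in>K j. x i \<omega>) L"
    by (rule indep_vars_restrict[OF indep _ disj]) simp
  then have "indep_sets (\<lambda>j. sets (gen (K j))) L"
    unfolding indep_vars_def sets_gen by simp
  then have "indep_sets (\<lambda>j. sigma_sets (space M) {W j -` A \<inter> space M |A. A \<in> sets (N j)}) L"
  proof (rule indep_sets_mono_sets)
    fix j assume j: "j \<in> L"
    have "sigma_sets (space (gen (K j))) {W j -` A \<inter> space (gen (K j)) |A. A \<in> sets (N j)} \<subseteq> sets (gen (K j))"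
      using W[OF j] by (intro sets.sigma_sets_subset) (auto simp: measurable_sets simp del: space_gen)
    then show "sigma_sets (space M) {W j -` A \<inter> space M |A. A \<in> sets (N j)} \<subseteq> sets (gen (K j))" by simp
  qed
  then show ?thesis
    unfolding indep_vars_def using measurable_gen_imp[OF W] by simp
qed

lemma indep_var_gen:
  assumes "A \<inter> B = {}" "W \<in> measurable (gen A) N" "W' \<in> measurable (gen B) N'"
  shows "indep_var N W N' W'"
  unfolding indep_var_def
  by (rule indep_vars_gen[where K = "case_bool A B"])
     (use assms in \<open>auto simp: disjoint_family_on_def split: bool.splits\<close>)

lemma x_gen: "i \<in> A \<Longrightarrow> x i \<in> measurable (gen A) S"
proof -
  assume i: "i \<in> A"
  have "(\<lambda>\<omega>. \<lambda>i\<in>A. x i \<omega>) \<in> measurable (gen A) (PiM A (\<lambda>_. S))"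
    unfolding gen_def using measurable_space[OF x_measurable]
    by (intro measurable_vimage_algebra1) (auto simp: space_PiM)
  from measurable_compose[OF this measurable_component_singleton[OF i]] i
  show ?thesis by simp
qed

lemma \<xi>_gen: "i \<in> A \<Longrightarrow> Suc i \<in> A \<Longrightarrow> \<xi> i \<in> borel_measurable (gen A)"
  unfolding \<xi>_def using measurable_compose[OF measurable_Pair[OF x_gen x_gen] h_measurable] by simp

text \<open>A sum of \<open>l\<close> terms reads \<open>l + 1\<close> letters, up to and including
  \<open>s + l\<close>. This extra letter is the whole dependence between adjacent sums.\<close>

lemma D_gen: "{s..s + l} \<subseteq> A \<Longrightarrow> D s l \<in> borel_measurable (gen A)"
  unfolding D_def by (intro borel_measurable_sum \<xi>_gen) auto

lemma \<xi>_measurable [measurable]: "\<xi> i \<in> borel_measurable M"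
  by (rule measurable_gen_imp[OF \<xi>_gen[of i UNIV]]) auto

lemma D_measurable [measurable]: "D s l \<in> borel_measurable M"
  unfolding D_def by measurable

lemma \<xi>_bound: "\<bar>\<xi> i \<omega>\<bar> \<le> C"
  unfolding \<xi>_def by (rule h_bound)

lemma D_0 [simp]: "D s 0 \<omega> = 0" by (simp add: D_def)

lemma D_Suc: "D s (Suc l) \<omega> = D s l \<omega> + \<xi> (s + l) \<omega>"
  by (simp add: D_def)

lemma D_add: "D s (l + l') \<omega> = D s l \<omega> + D (s + l) l' \<omega>"
  by (induction l') (simp_all add: D_Suc add.assoc)

text \<open>With \<open>n - 1\<close> terms the block reads exactly the \<open>n\<close> letters
  whose index has quotient \<open>j\<close> by \<open>n\<close>, so different blocks share
  none.\<close>

lemma indep_vars_blocks: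
  assumes "0 < n"
  shows "indep_vars (\<lambda>_. borel) (\<lambda>j. D (j * n) (n - 1)) J"
proof (rule indep_vars_gen[where K = "\<lambda>j. {j * n..j * n + (n - 1)}"])
  show "disjoint_family_on (\<lambda>j. {j * n..j * n + (n - 1)}) J"
    unfolding disjoint_family_on_def
  proof (intro ballI impI)
    fix i j :: nat assume "i \<noteq> j"
    show "{i * n..i * n + (n - 1)} \<inter> {j * n..j * n + (n - 1)} = {}"
    proof (rule ccontr)
      assume "{i * n..i * n + (n - 1)} \<inter> {j * n..j * n + (n - 1)} \<noteq> {}"
      then obtain k where "k \<in> {i * n..i * n + (n - 1)}" "k \<in> {j * n..j * n + (n - 1)}" by blast
      then have "k div n = i" "k div n = j"
        using \<open>0 < n\<close> by (auto intro!: div_nat_eqI simp: mult.commute[of n])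
      then show False using \<open>i \<noteq> j\<close> by simp
    qed
  qed
qed (auto intro: D_gen)

section \<open>Recursion for the characteristic functions of partial sums\<close>

definition \<phi> :: "real \<Rightarrow> nat \<Rightarrow> nat \<Rightarrow> complex" where
  "\<phi> \<theta> s l = (CLINT \<omega>|M. iexp (\<theta> * D s l \<omega>))"

lemma \<phi>_diff: "cmod (\<phi> \<theta> s (Suc l) - \<phi> \<theta> s l) \<le> \<bar>\<theta>\<bar> * C"
proof -
  have "\<phi> \<theta> s (Suc l) - \<phi> \<theta> s l = (CLINT \<omega>|M. iexp (\<theta> * D s (Suc l) \<omega>) - iexp (\<theta> * D s l \<omega>))"
    unfolding \<phi>_def by (intro Bochner_Integration.integral_diff[symmetric] integrable_bounded_complex[where K = 1]) auto
  also have "cmod \<dots> \<le> \<bar>\<theta>\<bar> * C"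
  proof (rule norm_expectation_le)
    fix \<omega>
    have "iexp (\<theta> * D s (Suc l) \<omega>) - iexp (\<theta> * D s l \<omega>) =
        iexp (\<theta> * D s l \<omega>) * (iexp (\<theta> * \<xi> (s + l) \<omega>) - 1)"
      by (simp add: D_Suc distrib_left right_diff_distrib exp_add)
    also have "cmod \<dots> \<le> \<bar>\<theta> * \<xi> (s + l) \<omega>\<bar>"
      using cmod_iexp_minus_1[of "\<theta> * \<xi> (s + l) \<omega>"] by (simp add: norm_mult)
    also have "\<dots> \<le> \<bar>\<theta>\<bar> * C"
      unfolding abs_mult by (intro mult_left_mono \<xi>_bound) simp
    finally show "cmod (iexp (\<theta> * D s (Suc l) \<omega>) - iexp (\<theta> * D s l \<omega>)) \<le> \<bar>\<theta>\<bar> * C" .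
  qed measurable
  finally show ?thesis .
qed

lemma v_bound: "\<bar>v\<bar> \<le> C\<^sup>2" and c_bound: "\<bar>c\<bar> \<le> C\<^sup>2"
proof -
  have 1: "\<bar>\<xi> i \<omega> * \<xi> j \<omega>\<bar> \<le> C\<^sup>2" for i j \<omega>
    unfolding abs_mult power2_eq_square using \<xi>_bound pos by (intro mult_mono) auto
  have 2: "\<bar>LINT \<omega>|M. \<xi> i \<omega> * \<xi> j \<omega>\<bar> \<le> C\<^sup>2" for i j
    unfolding real_norm_def[symmetric]
    by (rule norm_expectation_le) (use 1 in auto)
  show "\<bar>v\<bar> \<le> C\<^sup>2" using 2[of 0 0] var[of 0] by (simp only: \<xi>_def power2_eq_square)
  show "\<bar>c\<bar> \<le> C\<^sup>2" using 2[of 0 1] cov[of 0] by (simp add: \<xi>_def)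
qed

text \<open>In the expansion of the last term the linear part has mean 0, the mixed part gives
  \<open>c\<close> times the value at \<open>l\<close>, and the quadratic part gives half of
  \<open>v\<close> times the value at \<open>l + 1\<close>. The indices \<open>l + 2\<close> and
  \<open>l + 3\<close> leave room for the three detached terms.\<close>

lemma \<phi>_step:
  "cmod (\<phi> \<theta> s (l + 3) - (1 - \<theta>\<^sup>2 * (v + 2 * c) / 2) * \<phi> \<theta> s (l + 2)) \<le> 6 * (\<bar>\<theta>\<bar> ^ 3 * C ^ 3)"
proof -
  define a b d where "a = \<xi> (s + l)" and "b = \<xi> (s + l + 1)" and "d = \<xi> (s + l + 2)"
  have [measurable]: "a \<in> borel_measurable M" "b \<in> borel_measurable M" "d \<in> borel_measurable M"
    unfolding a_def b_def d_def by auto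
  have bnd: "\<bar>a \<omega>\<bar> \<le> C" "\<bar>b \<omega>\<bar> \<le> C" "\<bar>d \<omega>\<bar> \<le> C" for \<omega>
    unfolding a_def b_def d_def by (rule \<xi>_bound)+
  have D1: "D s (l + 1) \<omega> = D s l \<omega> + a \<omega>" and D2: "D s (l + 2) \<omega> = D s l \<omega> + a \<omega> + b \<omega>"
    and D3: "D s (l + 3) \<omega> = D s l \<omega> + a \<omega> + b \<omega> + d \<omega>" for \<omega>
    unfolding a_def b_def d_def by (simp_all add: D_Suc numeral_2_eq_2 numeral_3_eq_3)
  let ?f1 = "\<lambda>\<omega>. iexp (\<theta> * D s (l + 1) \<omega>) * complex_of_real (d \<omega>)"
  let ?f2 = "\<lambda>\<omega>. iexp (\<theta> * D s l \<omega>) * complex_of_real (b \<omega> * d \<omega>)"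
  let ?f3 = "\<lambda>\<omega>. iexp (\<theta> * D s (l + 1) \<omega>) * complex_of_real ((d \<omega>)\<^sup>2)"
  have bd: "\<bar>b \<omega> * d \<omega>\<bar> \<le> C\<^sup>2" "(d \<omega>)\<^sup>2 \<le> C\<^sup>2" for \<omega>
    using bnd[of \<omega>] pos power_mono[of "\<bar>d \<omega>\<bar>" C 2]
    by (auto simp: abs_mult power2_eq_square intro!: mult_mono)
  have int1: "integrable M ?f1" and int2: "integrable M ?f2" and int3: "integrable M ?f3"
  proof -
    show "integrable M ?f1"
      using bnd by (intro integrable_bounded_complex[where K = C]) (auto simp: norm_mult)
    show "integrable M ?f2"
      using bd by (intro integrable_bounded_complex[where K = "C\<^sup>2"])
        (auto simp: norm_mult simp del: of_real_mult)
    show "integrable M ?f3"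
      using bd by (intro integrable_bounded_complex[where K = "C\<^sup>2"])
        (auto simp: norm_mult simp del: of_real_power)
  qed
  \<comment> \<open>\<open>d\<close> begins at letter \<open>s + l + 2\<close>, so it is independent
    of \<open>D s (l + 1)\<close>; \<open>b * d\<close> begins one letter earlier and needs the
    shorter sum \<open>D s l\<close>.\<close>
  have gens: "D s (l + 1) \<in> borel_measurable (gen {s..s + l + 1})" "d \<in> borel_measurable (gen {s + l + 2..})"
    "D s l \<in> borel_measurable (gen {s..s + l})" "b \<in> borel_measurable (gen {s + l + 1..})"
    "d \<in> borel_measurable (gen {s + l + 1..})"
    unfolding b_def d_def by (auto intro!: D_gen \<xi>_gen)
  note gens[measurable]
  have intd: "integrable M (\<lambda>\<omega>. complex_of_real (d \<omega>))"
    using bnd by (intro integrable_bounded_complex[where K = C]) auto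
  have intbd: "integrable M (\<lambda>\<omega>. complex_of_real (b \<omega> * d \<omega>))"
    and intd2: "integrable M (\<lambda>\<omega>. complex_of_real ((d \<omega>)\<^sup>2))"
    using bd by (auto intro!: integrable_bounded_complex[where K = "C\<^sup>2"] simp del: of_real_mult of_real_power)
  have E1: "(CLINT \<omega>|M. ?f1 \<omega>) = 0"
  proof -
    have "(CLINT \<omega>|M. ?f1 \<omega>) = (CLINT \<omega>|M. iexp (\<theta> * D s (l + 1) \<omega>)) * (CLINT \<omega>|M. of_real (d \<omega>))"
    proof (rule indep_var_lebesgue_integral)
      show "indep_var borel (\<lambda>\<omega>. iexp (\<theta> * D s (l + 1) \<omega>)) borel (\<lambda>\<omega>. complex_of_real (d \<omega>))"
        by (rule indep_var_gen[of "{s..s + l + 1}" "{s + l + 2..}"]) (force, measurable)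
    qed (use intd in \<open>auto intro!: integrable_bounded_complex[where K = 1]\<close>)
    also have "(CLINT \<omega>|M. of_real (d \<omega>)) = complex_of_real (LINT \<omega>|M. d \<omega>)" by simp
    also have "(LINT \<omega>|M. d \<omega>) = 0" unfolding d_def \<xi>_def using mean[of "s + l + 2"] by simp
    finally show ?thesis by simp
  qed
  have E2: "(CLINT \<omega>|M. ?f2 \<omega>) = \<phi> \<theta> s l * c"
  proof -
    have "(CLINT \<omega>|M. ?f2 \<omega>) = (CLINT \<omega>|M. iexp (\<theta> * D s l \<omega>)) * (CLINT \<omega>|M. of_real (b \<omega> * d \<omega>))"
    proof (rule indep_var_lebesgue_integral)
      show "indep_var borel (\<lambda>\<omega>. iexp (\<theta> * D s l \<omega>)) borel (\<lambda>\<omega>. complex_of_real (b \<omega> * d \<omega>))"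
        by (rule indep_var_gen[of "{s..s + l}" "{s + l + 1..}"]) (force, measurable)
    qed (use intbd in \<open>auto intro!: integrable_bounded_complex[where K = 1] simp del: of_real_mult\<close>)
    also have "(CLINT \<omega>|M. of_real (b \<omega> * d \<omega>)) = complex_of_real (LINT \<omega>|M. b \<omega> * d \<omega>)"
      by (rule integral_complex_of_real)
    also have "(LINT \<omega>|M. b \<omega> * d \<omega>) = c" unfolding b_def d_def \<xi>_def using cov[of "s + l + 1"] by simp
    finally show ?thesis by (simp add: \<phi>_def)
  qed
  have E3: "(CLINT \<omega>|M. ?f3 \<omega>) = \<phi> \<theta> s (l + 1) * v"
  proof -
    have "(CLINT \<omega>|M. ?f3 \<omega>) = (CLINT \<omega>|M. iexp (\<theta> * D s (l + 1) \<omega>)) * (CLINT \<omega>|M. of_real ((d \<omega>)\<^sup>2))"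
    proof (rule indep_var_lebesgue_integral)
      show "indep_var borel (\<lambda>\<omega>. iexp (\<theta> * D s (l + 1) \<omega>)) borel (\<lambda>\<omega>. complex_of_real ((d \<omega>)\<^sup>2))"
        by (rule indep_var_gen[of "{s..s + l + 1}" "{s + l + 2..}"]) (force, measurable)
    qed (use intd2 in \<open>auto intro!: integrable_bounded_complex[where K = 1] simp del: of_real_power\<close>)
    also have "(CLINT \<omega>|M. of_real ((d \<omega>)\<^sup>2)) = complex_of_real (LINT \<omega>|M. (d \<omega>)\<^sup>2)"
      by (rule integral_complex_of_real)
    also have "(LINT \<omega>|M. (d \<omega>)\<^sup>2) = v" unfolding d_def \<xi>_def using var[of "s + l + 2"] by simp
    finally show ?thesis by (simp add: \<phi>_def)
  qed
  let ?g = "\<lambda>\<omega>. \<i> * \<theta> * ?f1 \<omega> - \<theta>\<^sup>2 * ?f2 \<omega> - \<theta>\<^sup>2 / 2 * ?f3 \<omega>"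
  have intg: "integrable M ?g"
    by (intro Bochner_Integration.integrable_diff integrable_mult_right int1 int2 int3)
  have Eg: "(CLINT \<omega>|M. ?g \<omega>) = - (\<theta>\<^sup>2 * (\<phi> \<theta> s l * c)) - \<theta>\<^sup>2 / 2 * (\<phi> \<theta> s (l + 1) * v)"
    using int1 int2 int3 E1 E2 E3
    by (simp only: Bochner_Integration.integral_diff Bochner_Integration.integrable_diff
        integrable_mult_right integral_mult_right_zero) simp
  have int: "integrable M (\<lambda>\<omega>. iexp (\<theta> * D s l \<omega>))" for l
    by (intro integrable_bounded_complex[where K = 1]) auto
  have "\<phi> \<theta> s (l + 3) - \<phi> \<theta> s (l + 2) - (CLINT \<omega>|M. ?g \<omega>) =
      (CLINT \<omega>|M. iexp (\<theta> * D s (l + 3) \<omega>) - iexp (\<theta> * D s (l + 2) \<omega>) - ?g \<omega>)"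
    unfolding \<phi>_def by (simp only: Bochner_Integration.integral_diff Bochner_Integration.integrable_diff int intg)
  also have "cmod \<dots> \<le> 3 * (\<bar>\<theta>\<bar> ^ 3 * C ^ 3)"
  proof (rule norm_expectation_le)
    fix \<omega>
    show "cmod (iexp (\<theta> * D s (l + 3) \<omega>) - iexp (\<theta> * D s (l + 2) \<omega>) - ?g \<omega>) \<le> 3 * (\<bar>\<theta>\<bar> ^ 3 * C ^ 3)"
      using iexp_step_remainder[OF bnd, of \<theta> "D s l \<omega>" \<omega> \<omega> \<omega>] unfolding D1 D2 D3
      by (simp only: of_real_mult of_real_power)
  qed measurable
  finally have 1: "cmod (\<phi> \<theta> s (l + 3) - \<phi> \<theta> s (l + 2) - (CLINT \<omega>|M. ?g \<omega>)) \<le> 3 * (\<bar>\<theta>\<bar> ^ 3 * C ^ 3)" .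
  \<comment> \<open>Moving both values to index \<open>l + 2\<close> costs one factor
    \<open>\<bar>\<theta>\<bar> * C\<close> for each index crossed, on top of the factor
    \<open>\<theta>\<^sup>2\<close>. This adds 2 and 1 to the constant 3 of the expansion.\<close>
  define e0 where "e0 = \<phi> \<theta> s (l + 2) - \<phi> \<theta> s l"
  define e1 where "e1 = \<phi> \<theta> s (l + 2) - \<phi> \<theta> s (l + 1)"
  have e1: "cmod e1 \<le> \<bar>\<theta>\<bar> * C"
    using \<phi>_diff[of \<theta> s "l + 1"] by (simp add: e1_def)
  have e0: "cmod e0 \<le> 2 * (\<bar>\<theta>\<bar> * C)"
  proof -
    have "e0 = e1 + (\<phi> \<theta> s (l + 1) - \<phi> \<theta> s l)" by (simp add: e0_def e1_def)
    then show ?thesis using norm_triangle_ineq[of e1 "\<phi> \<theta> s (l + 1) - \<phi> \<theta> s l"] e1 \<phi>_diff[of \<theta> s l] by simp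
  qed
  have "\<phi> \<theta> s (l + 3) - (1 - \<theta>\<^sup>2 * (v + 2 * c) / 2) * \<phi> \<theta> s (l + 2) =
      (\<phi> \<theta> s (l + 3) - \<phi> \<theta> s (l + 2) - (CLINT \<omega>|M. ?g \<omega>)) + (\<theta>\<^sup>2 * c * e0 + \<theta>\<^sup>2 * v / 2 * e1)"
    unfolding Eg e0_def e1_def by (simp add: field_simps)
  also have "cmod \<dots> \<le> 3 * (\<bar>\<theta>\<bar> ^ 3 * C ^ 3) + (2 * (\<bar>\<theta>\<bar> ^ 3 * C ^ 3) + \<bar>\<theta>\<bar> ^ 3 * C ^ 3)"
  proof (intro order_trans[OF norm_triangle_ineq] add_mono 1)
    have "cmod (\<theta>\<^sup>2 * c * e0) = \<theta>\<^sup>2 * \<bar>c\<bar> * cmod e0" by (simp add: norm_mult norm_power)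
    also have "\<dots> \<le> \<theta>\<^sup>2 * C\<^sup>2 * (2 * (\<bar>\<theta>\<bar> * C))"
      using c_bound e0 by (intro mult_mono) auto
    also have "\<dots> = \<bar>\<theta>\<bar>\<^sup>2 * C\<^sup>2 * (2 * (\<bar>\<theta>\<bar> * C))" by simp
    also have "\<dots> = 2 * (\<bar>\<theta>\<bar> ^ 3 * C ^ 3)" unfolding power2_eq_square power3_eq_cube by (simp only: mult_ac)
    finally show "cmod (\<theta>\<^sup>2 * c * e0) \<le> 2 * (\<bar>\<theta>\<bar> ^ 3 * C ^ 3)" .
    have "cmod (\<theta>\<^sup>2 * v / 2 * e1) = \<theta>\<^sup>2 * \<bar>v\<bar> * cmod e1 / 2" by (simp add: norm_mult norm_divide norm_power)
    also have "\<dots> \<le> \<theta>\<^sup>2 * \<bar>v\<bar> * cmod e1" by simp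
    also have "\<dots> \<le> \<theta>\<^sup>2 * C\<^sup>2 * (\<bar>\<theta>\<bar> * C)"
      using v_bound e1 by (intro mult_mono) auto
    also have "\<dots> = \<bar>\<theta>\<bar>\<^sup>2 * C\<^sup>2 * (\<bar>\<theta>\<bar> * C)" by simp
    also have "\<dots> = \<bar>\<theta>\<bar> ^ 3 * C ^ 3" unfolding power2_eq_square power3_eq_cube by (simp only: mult_ac)
    finally show "cmod (\<theta>\<^sup>2 * v / 2 * e1) \<le> \<bar>\<theta>\<bar> ^ 3 * C ^ 3" .
  qed
  also have "\<dots> = 6 * (\<bar>\<theta>\<bar> ^ 3 * C ^ 3)" by linarith
  finally show ?thesis .
qed

text \<open>The hypothesis says that \<open>1 - \<theta>\<^sup>2 * (v + 2 * c) / 2\<close> is at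
  least -1. As this factor then has modulus at most 1, the errors of the single steps merely add up;
  the last summand comes from the two terms present at the start.\<close>

lemma \<phi>_approx:
  assumes "\<theta>\<^sup>2 * (v + 2 * c) \<le> 4"
  shows "cmod (\<phi> \<theta> s (l + 2) - (1 - \<theta>\<^sup>2 * (v + 2 * c) / 2) ^ l) \<le>
    real l * (6 * (\<bar>\<theta>\<bar> ^ 3 * C ^ 3)) + 2 * (\<bar>\<theta>\<bar> * C)"
proof (induction l)
  case 0
  have "\<phi> \<theta> s 0 = 1" by (simp add: \<phi>_def prob_space)
  then have "\<phi> \<theta> s 2 - 1 = (\<phi> \<theta> s 2 - \<phi> \<theta> s 1) + (\<phi> \<theta> s 1 - \<phi> \<theta> s 0)" by simp
  then have "cmod (\<phi> \<theta> s 2 - 1) \<le> cmod (\<phi> \<theta> s 2 - \<phi> \<theta> s 1) + cmod (\<phi> \<theta> s 1 - \<phi> \<theta> s 0)"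
    by (metis norm_triangle_ineq)
  then show ?case using \<phi>_diff[of \<theta> s 0] \<phi>_diff[of \<theta> s 1] by (simp add: numeral_2_eq_2)
next
  case (Suc l)
  define \<rho> where "\<rho> = 1 - \<theta>\<^sup>2 * (v + 2 * c) / 2"
  have \<rho>: "\<bar>\<rho>\<bar> \<le> 1" using assms pos by (simp add: \<rho>_def abs_le_iff)
  have "\<phi> \<theta> s (Suc l + 2) - complex_of_real \<rho> ^ Suc l =
     (\<phi> \<theta> s (l + 3) - \<rho> * \<phi> \<theta> s (l + 2)) + \<rho> * (\<phi> \<theta> s (l + 2) - complex_of_real \<rho> ^ l)"
    by (simp add: algebra_simps numeral_3_eq_3)
  also have "cmod \<dots> \<le> 6 * (\<bar>\<theta>\<bar> ^ 3 * C ^ 3) + (real l * (6 * (\<bar>\<theta>\<bar> ^ 3 * C ^ 3)) + 2 * (\<bar>\<theta>\<bar> * C))"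
  proof (intro order_trans[OF norm_triangle_ineq] add_mono)
    show "cmod (\<phi> \<theta> s (l + 3) - \<rho> * \<phi> \<theta> s (l + 2)) \<le> 6 * (\<bar>\<theta>\<bar> ^ 3 * C ^ 3)"
    proof -
      have "cmod (\<phi> \<theta> s (l + 3) - \<rho> * \<phi> \<theta> s (l + 2)) =
        cmod (\<phi> \<theta> s (l + 3) - (1 - \<theta>\<^sup>2 * (v + 2 * c) / 2) * \<phi> \<theta> s (l + 2))"
        by (simp add: \<rho>_def)
      then show ?thesis using \<phi>_step[of \<theta> s l] by linarith
    qed
    have "cmod (\<rho> * (\<phi> \<theta> s (l + 2) - complex_of_real \<rho> ^ l)) \<le> 1 * cmod (\<phi> \<theta> s (l + 2) - complex_of_real \<rho> ^ l)"
      unfolding norm_mult norm_of_real using \<rho> by (intro mult_right_mono) auto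
    also have "\<dots> \<le> real l * (6 * (\<bar>\<theta>\<bar> ^ 3 * C ^ 3)) + 2 * (\<bar>\<theta>\<bar> * C)"
      using Suc by (simp add: \<rho>_def)
    finally show "cmod (\<rho> * (\<phi> \<theta> s (l + 2) - complex_of_real \<rho> ^ l)) \<le>
      real l * (6 * (\<bar>\<theta>\<bar> ^ 3 * C ^ 3)) + 2 * (\<bar>\<theta>\<bar> * C)" .
  qed
  finally show ?case by (simp add: \<rho>_def distrib_right)
qed

section \<open>Tail and maximal inequalities\<close>

text \<open>Terms of equal parity read disjoint pairs of letters. One of the two halves must reach
  \<open>\<eta> / 2\<close>, and Hoeffding with ranges of width \<open>2 * C\<close> gives the 8 in
  the exponent; two two-sided bounds give the factor 4. The bound in \<open>L\<close> is uniform
  over shorter sums, as stopping at a random index requires.\<close>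

lemma D_tail:
  assumes \<eta>: "0 < \<eta>" and l: "l \<le> L" "0 < L"
  shows "prob {\<omega>\<in>space M. \<eta> \<le> \<bar>D s l \<omega>\<bar>} \<le> 4 * exp (- (\<eta>\<^sup>2 / (8 * real L * C\<^sup>2)))"
proof -
  have half: "prob {\<omega>\<in>space M. \<eta> / 2 \<le> \<bar>\<Sum>i\<in>J. \<xi> i \<omega>\<bar>} \<le> 2 * exp (- (\<eta>\<^sup>2 / (8 * real L * C\<^sup>2)))"
    if J: "finite J" "card J \<le> L" and gap: "\<And>i. i \<in> J \<Longrightarrow> Suc i \<notin> J" for J
  proof (cases "J = {}")
    case False
    interpret Hoeffding_ineq M J \<xi> "\<lambda>_. - C" "\<lambda>_. C" 0
    proof unfold_locales
      show "indep_vars (\<lambda>_. borel) \<xi> J"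
      proof (rule indep_vars_gen[where K = "\<lambda>i. {i, Suc i}"])
        show "disjoint_family_on (\<lambda>i. {i, Suc i}) J"
          using gap by (auto simp: disjoint_family_on_def)
      qed (auto intro: \<xi>_gen)
      have "(\<Sum>i\<in>J. expectation (\<xi> i)) = 0"
        using mean by (simp add: \<xi>_def[abs_def])
      then show "0 \<equiv> \<Sum>i\<in>J. expectation (\<xi> i)" by simp
      show "AE \<omega> in M. \<xi> i \<omega> \<in> {- C..C}" for i
        using \<xi>_bound[of i] by (auto simp: abs_le_iff minus_le_iff)
    qed (use J in auto)
    have card: "0 < card J" using False J by (simp add: card_gt_0_iff)
    have "prob {\<omega>\<in>space M. \<eta> / 2 \<le> \<bar>\<Sum>i\<in>J. \<xi> i \<omega>\<bar>} \<le>
        2 * exp (- 2 * (\<eta> / 2)\<^sup>2 / (\<Sum>i\<in>J. (C - - C)\<^sup>2))"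
      using Hoeffding_ineq_abs_ge[of "\<eta> / 2"] \<eta> card pos by simp
    also have "- 2 * (\<eta> / 2)\<^sup>2 / (\<Sum>i\<in>J. (C - - C)\<^sup>2) = - (\<eta>\<^sup>2 / (8 * real (card J) * C\<^sup>2))"
    proof -
      have "(\<Sum>i\<in>J. (C - - C)\<^sup>2) = 4 * (real (card J) * C\<^sup>2)"
        by (simp add: power2_eq_square)
      then show ?thesis by (simp add: power_divide)
    qed
    also have "exp \<dots> \<le> exp (- (\<eta>\<^sup>2 / (8 * real L * C\<^sup>2)))"
      using card pos J by (auto intro!: divide_left_mono mult_right_mono mult_left_mono mult_pos_pos)
    finally show ?thesis by simp
  qed (use \<eta> in simp)
  define I where "I = {s..<s + l}"
  have D_eq: "D s l \<omega> = (\<Sum>i\<in>{i\<in>I. even i}. \<xi> i \<omega>) + (\<Sum>i\<in>{i\<in>I. odd i}. \<xi> i \<omega>)" for \<omega>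
  proof -
    have "D s l \<omega> = (\<Sum>i\<in>I. \<xi> i \<omega>)"
      unfolding D_def I_def by (rule sum.reindex_bij_witness[of _ "\<lambda>i. i - s" "\<lambda>i. s + i"]) auto
    also have "\<dots> = (\<Sum>i\<in>{i\<in>I. even i} \<union> {i\<in>I. odd i}. \<xi> i \<omega>)"
      by (rule sum.cong) auto
    also have "\<dots> = (\<Sum>i\<in>{i\<in>I. even i}. \<xi> i \<omega>) + (\<Sum>i\<in>{i\<in>I. odd i}. \<xi> i \<omega>)"
      by (rule sum.union_disjoint) (auto simp: I_def)
    finally show ?thesis .
  qed
  have card: "card {i\<in>I. Q i} \<le> L" for Q
  proof -
    have "card {i\<in>I. Q i} \<le> card I" by (rule card_mono) (auto simp: I_def)
    then show ?thesis using l by (simp add: I_def)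
  qed
  let ?A = "{\<omega>\<in>space M. \<eta> / 2 \<le> \<bar>\<Sum>i\<in>{i\<in>I. even i}. \<xi> i \<omega>\<bar>}"
  let ?B = "{\<omega>\<in>space M. \<eta> / 2 \<le> \<bar>\<Sum>i\<in>{i\<in>I. odd i}. \<xi> i \<omega>\<bar>}"
  have "prob {\<omega>\<in>space M. \<eta> \<le> \<bar>D s l \<omega>\<bar>} \<le> prob (?A \<union> ?B)"
    unfolding D_eq by (intro finite_measure_mono) auto
  also have "\<dots> \<le> prob ?A + prob ?B"
    by (intro measure_Un_le) auto
  also have "prob ?A \<le> 2 * exp (- (\<eta>\<^sup>2 / (8 * real L * C\<^sup>2)))"
    by (intro half card) (auto simp: I_def)
  also have "prob ?B \<le> 2 * exp (- (\<eta>\<^sup>2 / (8 * real L * C\<^sup>2)))"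
    by (intro half card) (auto simp: I_def)
  finally show ?thesis by simp
qed

text \<open>Ottaviani's argument: after the first passage of the level, skipping one term makes the
  remaining sum independent of the past.\<close>

lemma D_maximal:
  assumes \<eta>: "0 < \<eta>" and L: "0 < L"
  shows "prob {\<omega>\<in>space M. \<exists>l\<le>L. 2 * \<eta> + C \<le> \<bar>D s l \<omega>\<bar>} \<le> 8 * exp (- (\<eta>\<^sup>2 / (8 * real L * C\<^sup>2)))"
proof -
  define p where "p = 4 * exp (- (\<eta>\<^sup>2 / (8 * real L * C\<^sup>2)))"
  define A where "A l = {\<omega>\<in>space M. 2 * \<eta> + C \<le> \<bar>D s l \<omega>\<bar> \<and> (\<forall>k<l. \<bar>D s k \<omega>\<bar> < 2 * \<eta> + C)}" for l
  define B where "B l = {\<omega>\<in>space M. \<eta> \<le> \<bar>D (s + Suc l) (L - Suc l) \<omega>\<bar>}" for l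
  have A_gen: "A l \<in> sets (gen {s..s + l})" for l
  proof -
    have m: "D s k \<in> borel_measurable (gen {s..s + l})" if "k \<le> l" for k
      using that by (intro D_gen) auto
    have "{\<omega>\<in>space (gen {s..s + l}). 2 * \<eta> + C \<le> \<bar>D s l \<omega>\<bar> \<and> (\<forall>k\<in>{..<l}. \<bar>D s k \<omega>\<bar> < 2 * \<eta> + C)} \<in> sets (gen {s..s + l})"
      by (intro sets.sets_Collect_conj sets.sets_Collect_finite_All borel_measurable_le
          borel_measurable_less borel_measurable_abs borel_measurable_const m) auto
    then show ?thesis by (simp add: A_def Ball_def)
  qed
  have B_gen: "B l \<in> sets (gen {s + Suc l..})" for l
  proof -
    have [measurable]: "D (s + Suc l) (L - Suc l) \<in> borel_measurable (gen {s + Suc l..})"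
      by (intro D_gen) auto
    have "{\<omega>\<in>space (gen {s + Suc l..}). \<eta> \<le> \<bar>D (s + Suc l) (L - Suc l) \<omega>\<bar>} \<in> sets (gen {s + Suc l..})"
      by measurable
    then show ?thesis by (simp add: B_def)
  qed
  have [measurable]: "A l \<in> events" "B l \<in> events" for l
    using A_gen B_gen sets_gen_subset by blast+
  have AB: "prob (A l \<inter> B l) = prob (A l) * prob (B l)" for l
  proof -
    have "indep_var borel (indicator (A l) :: _ \<Rightarrow> real) borel (indicator (B l) :: _ \<Rightarrow> real)"
      using A_gen B_gen by (intro indep_var_gen[of "{s..s + l}" "{s + Suc l..}"]) auto
    then have "(LINT \<omega>|M. indicator (A l) \<omega> * (indicator (B l) \<omega> :: real)) =
       (LINT \<omega>|M. indicator (A l) \<omega>) * (LINT \<omega>|M. indicator (B l) \<omega>)"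
      by (intro indep_var_lebesgue_integral) (auto intro!: integrable_real_indicator simp: less_top[symmetric])
    then show ?thesis by (simp flip: indicator_inter_arith)
  qed
  have pB: "prob (B l) \<le> p" for l
    unfolding B_def p_def by (intro D_tail \<eta> L) simp
  have disj: "disjoint_family_on A {..<L}"
  proof -
    have "A k \<inter> A l = {}" if "k < l" for k l
      using that by (auto simp: A_def)
    then show ?thesis
      unfolding disjoint_family_on_def by (metis Int_commute linorder_neq_iff)
  qed
  \<comment> \<open>At the first passage the sum is at least \<open>2 * \<eta> + C\<close>, the
    skipped term changes it by at most \<open>C\<close>, and the final value is below
    \<open>\<eta>\<close>; so the remaining sum is at least \<open>\<eta>\<close> in
    modulus.\<close>
  have sub: "{\<omega>\<in>space M. \<exists>l\<le>L. 2 * \<eta> + C \<le> \<bar>D s l \<omega>\<bar>} \<subseteq>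
      {\<omega>\<in>space M. \<eta> \<le> \<bar>D s L \<omega>\<bar>} \<union> (\<Union>l\<in>{..<L}. A l \<inter> B l)"
  proof
    fix \<omega> assume "\<omega> \<in> {\<omega>\<in>space M. \<exists>l\<le>L. 2 * \<eta> + C \<le> \<bar>D s l \<omega>\<bar>}"
    then have \<omega>: "\<omega> \<in> space M" and ex: "\<exists>l. l \<le> L \<and> 2 * \<eta> + C \<le> \<bar>D s l \<omega>\<bar>" by auto
    define l where "l = (LEAST l. l \<le> L \<and> 2 * \<eta> + C \<le> \<bar>D s l \<omega>\<bar>)"
    have l: "l \<le> L" "2 * \<eta> + C \<le> \<bar>D s l \<omega>\<bar>"
      using LeastI_ex[OF ex] unfolding l_def by auto
    have "\<bar>D s k \<omega>\<bar> < 2 * \<eta> + C" if "k < l" for k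
      using not_less_Least[of k "\<lambda>l. l \<le> L \<and> 2 * \<eta> + C \<le> \<bar>D s l \<omega>\<bar>"] that l unfolding l_def by auto
    then have A: "\<omega> \<in> A l" using l \<omega> by (simp add: A_def)
    show "\<omega> \<in> {\<omega>\<in>space M. \<eta> \<le> \<bar>D s L \<omega>\<bar>} \<union> (\<Union>l\<in>{..<L}. A l \<inter> B l)"
    proof (cases "\<eta> \<le> \<bar>D s L \<omega>\<bar>")
      case False
      then have "l \<noteq> L" using l \<eta> pos by auto
      then have lL: "l < L" using l by simp
      then have "L = l + (1 + (L - Suc l))" by simp
      then have "D s L \<omega> = D s l \<omega> + \<xi> (s + l) \<omega> + D (s + Suc l) (L - Suc l) \<omega>"
        using D_add[of s l "1 + (L - Suc l)" \<omega>] D_add[of "s + l" 1 "L - Suc l" \<omega>] by (simp add: D_Suc)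
      then have "\<eta> \<le> \<bar>D (s + Suc l) (L - Suc l) \<omega>\<bar>"
        using False l(2) \<xi>_bound[of "s + l" \<omega>] by linarith
      then have "\<omega> \<in> B l" using \<omega> by (simp add: B_def)
      then show ?thesis using A lL by blast
    qed (use \<omega> in simp)
  qed
  have "prob {\<omega>\<in>space M. \<exists>l\<le>L. 2 * \<eta> + C \<le> \<bar>D s l \<omega>\<bar>} \<le>
      prob ({\<omega>\<in>space M. \<eta> \<le> \<bar>D s L \<omega>\<bar>} \<union> (\<Union>l\<in>{..<L}. A l \<inter> B l))"
    by (intro finite_measure_mono sub) auto
  also have "\<dots> \<le> prob {\<omega>\<in>space M. \<eta> \<le> \<bar>D s L \<omega>\<bar>} + prob (\<Union>l\<in>{..<L}. A l \<inter> B l)"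
    by (intro measure_Un_le) auto
  also have "prob {\<omega>\<in>space M. \<eta> \<le> \<bar>D s L \<omega>\<bar>} \<le> p"
    unfolding p_def by (intro D_tail \<eta> L) simp
  also have "prob (\<Union>l\<in>{..<L}. A l \<inter> B l) \<le> (\<Sum>l<L. prob (A l \<inter> B l))"
    by (intro finite_measure_subadditive_finite) auto
  \<comment> \<open>The passage events are disjoint, so the whole sum is at most \<open>p\<close>.
    Together with the event at the endpoint this gives \<open>2 * p\<close>, hence the factor
    8.\<close>
  also have "\<dots> \<le> (\<Sum>l<L. prob (A l) * p)"
    unfolding AB by (intro sum_mono mult_left_mono pB) simp
  also have "\<dots> = prob (\<Union>l\<in>{..<L}. A l) * p"
    using finite_measure_finite_Union[of "{..<L}" A] disj by (simp add: sum_distrib_right image_subset_iff)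
  also have "\<dots> \<le> 1 * p"
    by (intro mult_right_mono prob_le_1) (simp add: p_def)
  finally show ?thesis by (simp add: p_def)
qed

section \<open>Asymptotic normality of blocks and convergence of the block skeleton\<close>

text \<open>The start \<open>s m\<close> may move with \<open>m\<close> because the estimate of the
  characteristic function is uniform in it. The argument \<open>\<theta>\<close> is of order
  \<open>1 / sqrt (real m)\<close>, so about \<open>m\<close> errors of third order vanish
  together.\<close>

lemma block_clt:
  assumes r: "0 < r"
  shows "weak_conv_m (\<lambda>m. distr M borel (\<lambda>\<omega>. sqrt (real r) * D (s m) (m div r - 1) \<omega> / sqrt ((v + 2 * c) * real m)))
    std_normal_distribution"
proof (rule levy_continuity)
  show "real_distribution (distr M borel (\<lambda>\<omega>. sqrt (real r) * D (s m) (m div r - 1) \<omega> / sqrt ((v + 2 * c) * real m)))" for m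
    by (intro real_distribution_distr) measurable
  show "real_distribution std_normal_distribution" by (rule real_dist_normal_dist)
  fix t :: real
  define V where "V = v + 2 * c"
  have V: "0 < V" using pos by (simp add: V_def)
  define \<theta> where "\<theta> m = t * sqrt (real r) / sqrt (V * real m)" for m
  \<comment> \<open>Chosen so that \<open>m div r - 1 = l m + 2\<close>, the index in
    \<open>\<phi>_approx\<close>, once \<open>m div r\<close> is at least 3. The rounding and the 3
    together lose at most 4 against \<open>m / r\<close>.\<close>
  define l where "l m = m div r - 3" for m
  have char_eq: "char (distr M borel (\<lambda>\<omega>. sqrt (real r) * D (s m) (m div r - 1) \<omega> / sqrt (V * real m))) t =
      \<phi> (\<theta> m) (s m) (m div r - 1)" for m
    unfolding char_def \<phi>_def by (subst integral_distr) (auto simp: \<theta>_def mult.assoc)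
  have \<theta>2: "(\<theta> m)\<^sup>2 * V = t\<^sup>2 * real r / real m" for m
    using V by (simp add: \<theta>_def power_divide power_mult_distrib)
  have lm: "real m / real r - 4 \<le> real (l m)" "real (l m) \<le> real m / real r" for m
    using real_div_bounds[OF r, of m] by (auto simp: l_def of_nat_diff_real)
  have main: "(\<lambda>m. complex_of_real ((1 - (\<theta> m)\<^sup>2 * V / 2) ^ l m)) \<longlonglongrightarrow> complex_of_real (exp (- (t\<^sup>2 / 2)))"
  proof (intro tendsto_of_real tendsto_power_exp)
    show "(\<lambda>m. (\<theta> m)\<^sup>2 * V / 2) \<longlonglongrightarrow> 0"
      unfolding \<theta>2 by real_asymp
    show "0 \<le> (\<theta> m)\<^sup>2 * V / 2" for m using V by simp
    have "(\<lambda>m. real (l m) * ((\<theta> m)\<^sup>2 * V / 2) - t\<^sup>2 / 2) \<longlonglongrightarrow> 0"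
    proof (rule Lim_null_comparison)
      show "\<forall>\<^sub>F m in sequentially. norm (real (l m) * ((\<theta> m)\<^sup>2 * V / 2) - t\<^sup>2 / 2) \<le> 4 * real r / real m * (t\<^sup>2 / 2)"
        using eventually_gt_at_top[of 0]
      proof eventually_elim
        case (elim m)
        have "real (l m) * ((\<theta> m)\<^sup>2 * V / 2) - t\<^sup>2 / 2 = (real (l m) - real m / real r) * (real r / real m) * (t\<^sup>2 / 2)"
          unfolding \<theta>2 using elim r by (simp add: field_simps)
        also have "norm \<dots> = \<bar>real (l m) - real m / real r\<bar> * (real r / real m) * (t\<^sup>2 / 2)"
          by (simp add: abs_mult)
        also have "\<dots> \<le> 4 * (real r / real m) * (t\<^sup>2 / 2)"
          using lm[of m] by (intro mult_right_mono) auto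
        finally show ?case by simp
      qed
      show "(\<lambda>m. 4 * real r / real m * (t\<^sup>2 / 2)) \<longlonglongrightarrow> 0" by real_asymp
    qed
    then show "(\<lambda>m. real (l m) * ((\<theta> m)\<^sup>2 * V / 2)) \<longlonglongrightarrow> t\<^sup>2 / 2"
      by (simp add: LIM_zero_iff)
  qed
  have "(\<lambda>m. \<phi> (\<theta> m) (s m) (m div r - 1) - complex_of_real ((1 - (\<theta> m)\<^sup>2 * V / 2) ^ l m)) \<longlonglongrightarrow> 0"
  proof (rule Lim_null_comparison)
    define K where "K = \<bar>t\<bar> * sqrt (real r) / sqrt V"
    have abs\<theta>: "\<bar>\<theta> m\<bar> = K / sqrt (real m)" for m
      using V by (simp add: K_def \<theta>_def real_sqrt_mult abs_mult)
    have "(\<lambda>m. (\<theta> m)\<^sup>2 * V) \<longlonglongrightarrow> 0" unfolding \<theta>2 by real_asymp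
    then have "\<forall>\<^sub>F m in sequentially. (\<theta> m)\<^sup>2 * V < 4"
      by (rule order_tendstoD) simp
    then show "\<forall>\<^sub>F m in sequentially. norm (\<phi> (\<theta> m) (s m) (m div r - 1) - complex_of_real ((1 - (\<theta> m)\<^sup>2 * V / 2) ^ l m))
       \<le> real m * (6 * ((K / sqrt (real m)) ^ 3 * C ^ 3)) + 2 * (K / sqrt (real m) * C)"
      using eventually_ge_at_top[of "3 * r"]
    proof eventually_elim
      case (elim m)
      have "3 \<le> m div r" using elim r by (simp add: less_eq_div_iff_mult_less_eq)
      then have "m div r - 1 = l m + 2" by (simp add: l_def)
      moreover have "cmod (\<phi> (\<theta> m) (s m) (l m + 2) - (1 - (\<theta> m)\<^sup>2 * V / 2) ^ l m) \<le>
          real (l m) * (6 * (\<bar>\<theta> m\<bar> ^ 3 * C ^ 3)) + 2 * (\<bar>\<theta> m\<bar> * C)"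
        using \<phi>_approx[of "\<theta> m" "s m" "l m"] elim unfolding V_def by simp
      moreover have "real (l m) * (6 * (\<bar>\<theta> m\<bar> ^ 3 * C ^ 3)) \<le> real m * (6 * (\<bar>\<theta> m\<bar> ^ 3 * C ^ 3))"
        using pos by (intro mult_right_mono) (auto simp: l_def intro: order_trans[OF diff_le_self div_le_dividend])
      ultimately show ?case unfolding abs\<theta> by simp
    qed
    show "(\<lambda>m. real m * (6 * ((K / sqrt (real m)) ^ 3 * C ^ 3)) + 2 * (K / sqrt (real m) * C)) \<longlonglongrightarrow> 0"
    proof -
      have "(\<lambda>m. real m * (1 / sqrt (real m)) ^ 3) \<longlonglongrightarrow> 0" "(\<lambda>m. 1 / sqrt (real m)) \<longlonglongrightarrow> 0"
        by real_asymp+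
      then have "(\<lambda>m. 6 * K ^ 3 * C ^ 3 * (real m * (1 / sqrt (real m)) ^ 3) + 2 * K * C * (1 / sqrt (real m)))
          \<longlonglongrightarrow> 6 * K ^ 3 * C ^ 3 * 0 + 2 * K * C * 0"
        by (intro tendsto_add tendsto_mult tendsto_const)
      then show ?thesis by (simp add: power_divide mult_ac)
    qed
  qed
  with main have "(\<lambda>m. \<phi> (\<theta> m) (s m) (m div r - 1)) \<longlonglongrightarrow> complex_of_real (exp (- (t\<^sup>2 / 2)))"
    by (rule Lim_transform)
  then show "(\<lambda>m. char (distr M borel (\<lambda>\<omega>. sqrt (real r) * D (s m) (m div r - 1) \<omega> / sqrt ((v + 2 * c) * real m))) t)
      \<longlonglongrightarrow> char std_normal_distribution t"
    using char_eq by (simp add: char_std_normal_distribution V_def)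
qed

text \<open>Up to scaling both step paths are the same continuous function of \<open>r\<close>
  independent variables, which for the Brownian path are standard normal. Convergence of each block
  separately therefore suffices.\<close>

lemma block_skeleton_conv:
  fixes G :: "skorohod \<Rightarrow> real"
  assumes B: "standard_brownian_motion N B" and r: "0 < r"
    and G: "continuous_on UNIV G" "bounded (range G)"
  shows "(\<lambda>m. LINT \<omega>|M. G (path (\<lambda>t. (\<Sum>j<nat \<lfloor>real r * t\<rfloor>. D (j * (m div r)) (m div r - 1) \<omega>) / sqrt ((v + 2 * c) * real m))))
    \<longlonglongrightarrow> (LINT \<omega>|N. G (path (\<lambda>t. B (real (nat \<lfloor>real r * t\<rfloor>) / real r) \<omega>)))"
proof -
  interpret N: prob_space N using B by (simp add: standard_brownian_motion_def)
  define \<Psi> where "\<Psi> u = G (path (\<lambda>t. (\<Sum>j<nat \<lfloor>real r * t\<rfloor>. u j) / sqrt (real r) - 0 * t))" for u :: "nat \<Rightarrow> real"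
  \<comment> \<open>The shift by \<open>r\<close> makes every block length positive, so that
    independence holds at every index; it is undone at the end by
    \<open>LIMSEQ_offset\<close>.\<close>
  define X where "X m j \<omega> = sqrt (real r) * D (j * ((m + r) div r)) ((m + r) div r - 1) \<omega> / sqrt ((v + 2 * c) * real (m + r))" for m j \<omega>
  define Z where "Z j \<omega> = sqrt (real r) * (B (real (Suc j) / real r) \<omega> - B (real j / real r) \<omega>)" for j \<omega>
  have "(\<lambda>m. LINT \<omega>|M. \<Psi> (\<lambda>i. if i \<in> {..<r} then X m i \<omega> else 0)) \<longlonglongrightarrow>
    (LINT \<omega>|N. \<Psi> (\<lambda>i. if i \<in> {..<r} then Z i \<omega> else 0))"
  proof (rule indep_vars_weak_conv)
    show "prob_space M" "prob_space N" "finite {..<r}" "{..<r} \<noteq> {}"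
      using r by (auto simp: prob_space_axioms N.prob_space_axioms)
    show "indep_vars (\<lambda>_. borel) (X m) {..<r}" for m
    proof -
      have "0 < (m + r) div r" using r by simp
      from indep_vars_compose2[OF indep_vars_blocks[OF this], of _ "\<lambda>_ y. sqrt (real r) * y / sqrt ((v + 2 * c) * real (m + r))" "\<lambda>_. borel"]
      show ?thesis unfolding X_def[abs_def] by simp
    qed
    show "N.indep_vars (\<lambda>_. borel) Z {..<r}"
      using N.indep_vars_compose2[OF brownian_indep_increments[OF B r], of "\<lambda>_ y. sqrt (real r) * y" "\<lambda>_. borel"]
      unfolding Z_def[abs_def] by simp
    show "weak_conv_m (\<lambda>m. distr M borel (X m j)) (distr N borel (Z j))" if "j \<in> {..<r}" for j
    proof -
      have "distr N borel (Z j) = std_normal_distribution"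
        unfolding Z_def using that by (intro brownian_increment_distr B r) auto
      moreover have "weak_conv_m (\<lambda>m. distr M borel (X m j)) std_normal_distribution"
        unfolding weak_conv_m_def weak_conv_def
      proof (intro allI impI)
        fix y assume "isCont (cdf std_normal_distribution) y"
        with block_clt[OF r, of "\<lambda>m. j * (m div r)"]
        have "(\<lambda>m. cdf (distr M borel (\<lambda>\<omega>. sqrt (real r) * D (j * (m div r)) (m div r - 1) \<omega> /
            sqrt ((v + 2 * c) * real m))) y) \<longlonglongrightarrow> cdf std_normal_distribution y"
          unfolding weak_conv_m_def weak_conv_def by blast
        from LIMSEQ_ignore_initial_segment[OF this, of r]
        show "(\<lambda>m. cdf (distr M borel (X m j)) y) \<longlonglongrightarrow> cdf std_normal_distribution y"
          unfolding X_def[abs_def] .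
      qed
      ultimately show ?thesis by simp
    qed
    have "continuous_on UNIV (\<lambda>u::nat \<Rightarrow> real. \<lambda>i. (\<Sum>j<i. u j) / sqrt (real r))"
      using r by (intro continuous_on_coordinatewise_then_product continuous_intros
          continuous_on_product_then_coordinatewise[OF continuous_on_id]) auto
    from continuous_on_compose2[OF continuous_on_path_step[of r 0] this]
    have "continuous_on UNIV (\<lambda>u. path (\<lambda>t. (\<Sum>j<nat \<lfloor>real r * t\<rfloor>. u j) / sqrt (real r) - 0 * t))" by simp
    from continuous_on_compose2[OF G(1) this] show "continuous_on UNIV \<Psi>"
      unfolding \<Psi>_def by simp
    show "bounded (range \<Psi>)"
      by (rule bounded_subset[OF G(2)]) (auto simp: \<Psi>_def)
  qed
  moreover have "\<Psi> (\<lambda>i. if i \<in> {..<r} then X m i \<omega> else 0) =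
      G (path (\<lambda>t. (\<Sum>j<nat \<lfloor>real r * t\<rfloor>. D (j * ((m + r) div r)) ((m + r) div r - 1) \<omega>) / sqrt ((v + 2 * c) * real (m + r))))" for m \<omega>
    unfolding \<Psi>_def
  proof (intro arg_cong[where f = G] path_cong)
    fix t :: real assume "t \<in> {0..1}"
    then have le: "nat \<lfloor>real r * t\<rfloor> \<le> r" by (rule floor_mult_le)
    have "(\<Sum>j<nat \<lfloor>real r * t\<rfloor>. if j \<in> {..<r} then X m j \<omega> else 0) = (\<Sum>j<nat \<lfloor>real r * t\<rfloor>. X m j \<omega>)"
      using le by (intro sum.cong) auto
    then show "(\<Sum>j<nat \<lfloor>real r * t\<rfloor>. if j \<in> {..<r} then X m j \<omega> else 0) / sqrt (real r) - 0 * t =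
      (\<Sum>j<nat \<lfloor>real r * t\<rfloor>. D (j * ((m + r) div r)) ((m + r) div r - 1) \<omega>) / sqrt ((v + 2 * c) * real (m + r))"
      using r by (simp add: X_def sum_divide_distrib)
  qed
  moreover have "(LINT \<omega>|N. \<Psi> (\<lambda>i. if i \<in> {..<r} then Z i \<omega> else 0)) =
      (LINT \<omega>|N. G (path (\<lambda>t. B (real (nat \<lfloor>real r * t\<rfloor>) / real r) \<omega>)))"
    unfolding \<Psi>_def
  proof (intro Bochner_Integration.integral_cong refl arg_cong[where f = G] path_cong)
    fix \<omega> and t :: real assume \<omega>: "\<omega> \<in> space N" and "t \<in> {0..1}"
    then have le: "nat \<lfloor>real r * t\<rfloor> \<le> r" by (simp add: floor_mult_le)
    have "(\<Sum>j<nat \<lfloor>real r * t\<rfloor>. if j \<in> {..<r} then Z j \<omega> else 0) = (\<Sum>j<nat \<lfloor>real r * t\<rfloor>. Z j \<omega>)"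
      using le by (intro sum.cong) auto
    also have "\<dots> = sqrt (real r) * (\<Sum>j<nat \<lfloor>real r * t\<rfloor>. B (real (Suc j) / real r) \<omega> - B (real j / real r) \<omega>)"
      by (simp add: Z_def sum_distrib_left)
    also have "(\<Sum>j<nat \<lfloor>real r * t\<rfloor>. B (real (Suc j) / real r) \<omega> - B (real j / real r) \<omega>) =
        B (real (nat \<lfloor>real r * t\<rfloor>) / real r) \<omega> - B (real 0 / real r) \<omega>"
      by (rule sum_lessThan_telescope)
    also have "B (real 0 / real r) \<omega> = 0"
      using B \<omega> by (simp add: standard_brownian_motion_def)
    finally show "(\<Sum>j<nat \<lfloor>real r * t\<rfloor>. if j \<in> {..<r} then Z j \<omega> else 0) / sqrt (real r) - 0 * t =
        B (real (nat \<lfloor>real r * t\<rfloor>) / real r) \<omega>"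
      using r by simp
  qed
  ultimately have "(\<lambda>m. LINT \<omega>|M. G (path (\<lambda>t. (\<Sum>j<nat \<lfloor>real r * t\<rfloor>. D (j * ((m + r) div r)) ((m + r) div r - 1) \<omega>) / sqrt ((v + 2 * c) * real (m + r)))))
    \<longlonglongrightarrow> (LINT \<omega>|N. G (path (\<lambda>t. B (real (nat \<lfloor>real r * t\<rfloor>) / real r) \<omega>)))"
    by simp
  then show ?thesis by (rule LIMSEQ_offset)
qed

section \<open>Distance between the path and its block skeleton\<close>

text \<open>The difference at time \<open>t\<close> consists of the sum from the start of the
  current block, bounded by \<open>K\<close>, and of one dropped term for each completed block, at
  most \<open>r\<close> in number.\<close>

lemma skeleton_distance:
  assumes r: "0 < r" and t: "t \<in> {0..1}"
    and osc: "\<And>i l. i \<le> r \<Longrightarrow> l \<le> m div r + r + 1 \<Longrightarrow> \<bar>D (i * (m div r)) l \<omega>\<bar> \<le> K"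
  shows "\<bar>D 0 (nat \<lfloor>real m * t\<rfloor>) \<omega> - (\<Sum>j<nat \<lfloor>real r * t\<rfloor>. D (j * (m div r)) (m div r - 1) \<omega>)\<bar> \<le> K + real r * C"
proof -
  define n i a where "n = m div r" and "i = nat \<lfloor>real r * t\<rfloor>" and "a = nat \<lfloor>real m * t\<rfloor>"
  have i: "i \<le> r" unfolding i_def using t by (rule floor_mult_le)
  have "0 \<le> real r * t" "0 \<le> real m * t" using t by auto
  then have it: "real i \<le> real r * t" "real r * t < real i + 1"
    and at: "real a \<le> real m * t" "real m * t < real a + 1"
    unfolding i_def a_def by linarith+
  have nr: "real n * real r \<le> real m" "real m \<le> (real n + 1) * real r"
    using real_div_bounds[OF r, of m] r unfolding n_def by (simp_all add: field_simps)
  have "i * n \<le> a"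
  proof -
    have "real i * real n \<le> (real r * t) * real n" using it by (intro mult_right_mono) auto
    also have "\<dots> = (real n * real r) * t" by simp
    also have "\<dots> \<le> real m * t" using nr t by (intro mult_right_mono) auto
    finally have "real (i * n) < real a + 1" using at by simp
    then show ?thesis by linarith
  qed
  \<comment> \<open>Rounding \<open>m / r\<close> down to \<open>n\<close> makes the grid of blocks
    lag by up to one term per block; this is the \<open>r\<close> added to the block length.\<close>
  moreover have "a \<le> i * n + (n + r + 1)"
  proof -
    have "real m * t \<le> (real n + 1) * real r * t" using nr t by (intro mult_right_mono) auto
    also have "\<dots> = (real n + 1) * (real r * t)" by simp
    also have "\<dots> \<le> (real n + 1) * (real i + 1)" using it by (intro mult_left_mono) auto
    also have "\<dots> = real (i * n + (n + i + 1))" by (simp add: algebra_simps)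
    finally have "real a \<le> real (i * n + (n + i + 1))" using at by linarith
    then show ?thesis using i by linarith
  qed
  ultimately obtain l where l: "a = i * n + l" "l \<le> n + r + 1"
    by (metis add_le_cancel_left le_Suc_ex)
  \<comment> \<open>Every completed block lacks exactly its last term. For \<open>n = 0\<close> all
    these sums are empty.\<close>
  have "\<bar>D 0 (i * n) \<omega> - (\<Sum>j<i. D (j * n) (n - 1) \<omega>)\<bar> \<le> real i * C"
  proof (cases "n = 0")
    case False
    show ?thesis
    proof (induction i)
      case (Suc i)
      have "D 0 (Suc i * n) \<omega> = D 0 (i * n) \<omega> + D (i * n) n \<omega>"
        using D_add[of 0 "i * n" n \<omega>] by (simp add: add.commute)
      also have "D (i * n) n \<omega> = D (i * n) (n - 1) \<omega> + \<xi> (i * n + (n - 1)) \<omega>"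
        using D_Suc[of "i * n" "n - 1" \<omega>] False by simp
      finally have "D 0 (Suc i * n) \<omega> = D 0 (i * n) \<omega> + (D (i * n) (n - 1) \<omega> + \<xi> (i * n + (n - 1)) \<omega>)" .
      moreover have "real (Suc i) * C = real i * C + C" by (simp add: distrib_right)
      ultimately show ?case using Suc \<xi>_bound[of "i * n + (n - 1)" \<omega>] unfolding sum.lessThan_Suc by linarith
    qed simp
  qed (use pos in simp)
  moreover have "real i * C \<le> real r * C" using i pos by (intro mult_right_mono) auto
  moreover have "D 0 a \<omega> = D 0 (i * n) \<omega> + D (i * n) l \<omega>"
    unfolding l(1) by (simp add: D_add)
  moreover have "\<bar>D (i * n) l \<omega>\<bar> \<le> K" using osc[OF i] l(2) unfolding n_def by simp
  ultimately have "\<bar>D 0 a \<omega> - (\<Sum>j<i. D (j * n) (n - 1) \<omega>)\<bar> \<le> K + real r * C"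
    by linarith
  then show ?thesis unfolding n_def i_def a_def .
qed

text \<open>The lower bound on \<open>m\<close> keeps the extended block length \<open>L\<close>
  below twice \<open>m / r\<close>. With half of
  \<open>\<delta> * sqrt ((v + 2 * c) * real m)\<close> as level in \<open>D_maximal\<close>,
  \<open>m\<close> cancels from the exponent, which becomes linear in \<open>r\<close> and beats the
  factor \<open>r + 1\<close>; the 64 is 4 * 8 * 2.\<close>

lemma oscillation_prob:
  assumes r: "0 < r" and m: "r * (r + 1) \<le> m" and \<delta>: "0 < \<delta>"
  shows "prob {\<omega>\<in>space M. \<exists>i\<le>r. \<exists>l\<le>m div r + r + 1. \<delta> * sqrt ((v + 2 * c) * real m) + C \<le> \<bar>D (i * (m div r)) l \<omega>\<bar>}
    \<le> (real r + 1) * (8 * exp (- (\<delta>\<^sup>2 * (v + 2 * c) / (64 * C\<^sup>2) * real r)))"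
proof -
  define V n L where "V = v + 2 * c" and "n = m div r" and "L = n + r + 1"
  define \<eta> where "\<eta> = \<delta> * sqrt (V * real m) / 2"
  have V: "0 < V" using pos by (simp add: V_def)
  have m0: "0 < m" using m r by (metis Suc_eq_plus1 mult_pos_pos order_less_le_trans zero_less_Suc)
  have \<eta>: "0 < \<eta>" using \<delta> V m0 by (simp add: \<eta>_def)
  have L: "0 < L" "real L \<le> 2 * (real m / real r)"
  proof -
    have "real (r * (r + 1)) \<le> real m" using m by (simp only: of_nat_le_iff)
    then have "real r + 1 \<le> real m / real r"
      using r by (simp add: pos_le_divide_eq algebra_simps)
    then show "real L \<le> 2 * (real m / real r)"
      using real_div_bounds(1)[OF r, of m] by (simp add: L_def n_def)
  qed (simp add: L_def)
  have exponent: "\<delta>\<^sup>2 * V / (64 * C\<^sup>2) * real r \<le> \<eta>\<^sup>2 / (8 * real L * C\<^sup>2)"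
  proof -
    have "\<delta>\<^sup>2 * V / (64 * C\<^sup>2) * real r = \<eta>\<^sup>2 / (8 * (2 * (real m / real r)) * C\<^sup>2)"
      using V m0 r pos by (simp add: \<eta>_def power_divide power_mult_distrib)
    also have "\<dots> \<le> \<eta>\<^sup>2 / (8 * real L * C\<^sup>2)"
      using L pos by (intro divide_left_mono mult_right_mono mult_left_mono mult_pos_pos) auto
    finally show ?thesis .
  qed
  let ?E = "\<lambda>i. {\<omega>\<in>space M. \<exists>l\<le>L. 2 * \<eta> + C \<le> \<bar>D (i * n) l \<omega>\<bar>}"
  have E: "?E i \<in> events" for i
  proof -
    have "{\<omega>\<in>space M. \<exists>l\<in>{..L}. 2 * \<eta> + C \<le> \<bar>D (i * n) l \<omega>\<bar>} \<in> events"
      by (intro sets.sets_Collect_finite_Ex borel_measurable_le borel_measurable_abs) auto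
    then show ?thesis by (simp add: Bex_def)
  qed
  have "prob (\<Union>i\<in>{..r}. ?E i) \<le> (\<Sum>i\<le>r. prob (?E i))"
    using E by (intro finite_measure_subadditive_finite) auto
  also have "\<dots> \<le> (\<Sum>i\<le>r. 8 * exp (- (\<delta>\<^sup>2 * V / (64 * C\<^sup>2) * real r)))"
  proof (rule sum_mono)
    fix i
    have "prob (?E i) \<le> 8 * exp (- (\<eta>\<^sup>2 / (8 * real L * C\<^sup>2)))"
      by (rule D_maximal[OF \<eta> L(1)])
    also have "\<dots> \<le> 8 * exp (- (\<delta>\<^sup>2 * V / (64 * C\<^sup>2) * real r))"
      using exponent by simp
    finally show "prob (?E i) \<le> 8 * exp (- (\<delta>\<^sup>2 * V / (64 * C\<^sup>2) * real r))" .
  qed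
  also have "\<dots> = (real r + 1) * (8 * exp (- (\<delta>\<^sup>2 * V / (64 * C\<^sup>2) * real r)))" by simp
  also have "(\<Union>i\<in>{..r}. ?E i) = {\<omega>\<in>space M. \<exists>i\<le>r. \<exists>l\<le>L. 2 * \<eta> + C \<le> \<bar>D (i * n) l \<omega>\<bar>}" by auto
  also have "2 * \<eta> = \<delta> * sqrt (V * real m)" by (simp add: \<eta>_def)
  finally show ?thesis unfolding V_def L_def n_def .
qed

text \<open>Off the oscillation event the Lipschitz bound applies; on it only boundedness is
  available, at the price \<open>2 * K\<close>. Of the \<open>r + 1\<close> multiples of
  \<open>C\<close>, one comes from the maximal inequality and \<open>r\<close> from the dropped
  terms.\<close>

lemma donsker_lipschitz_bound:
  fixes G :: "skorohod \<Rightarrow> real"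
  assumes r: "0 < r" and m: "r * (r + 1) \<le> m" and \<delta>: "0 < \<delta>"
    and G: "\<And>f g. \<bar>G f - G g\<bar> \<le> A * dist f g" "\<And>f. \<bar>G f\<bar> \<le> K" "G \<in> borel_measurable borel"
    and Z: "random_function M Z"
    and close: "AE \<omega> in M. \<forall>t\<in>{0..1}.
      \<bar>Z t \<omega> - D 0 (nat \<lfloor>real m * t\<rfloor>) \<omega> / sqrt ((v + 2 * c) * real m)\<bar> \<le> \<epsilon>"
  shows "\<bar>(LINT \<omega>|M. G (path (\<lambda>t. Z t \<omega>))) -
      (LINT \<omega>|M. G (path (\<lambda>t. (\<Sum>j<nat \<lfloor>real r * t\<rfloor>. D (j * (m div r)) (m div r - 1) \<omega>) / sqrt ((v + 2 * c) * real m))))\<bar>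
    \<le> \<bar>A\<bar> * (\<epsilon> + (\<delta> + (real r + 1) * C / sqrt ((v + 2 * c) * real m))) +
      2 * K * ((real r + 1) * (8 * exp (- (\<delta>\<^sup>2 * (v + 2 * c) / (64 * C\<^sup>2) * real r))))"
proof -
  define R where "R = sqrt ((v + 2 * c) * real m)"
  have "0 < m" using m r by (metis Suc_eq_plus1 mult_pos_pos order_less_le_trans zero_less_Suc)
  then have R: "0 < R" using pos by (simp add: R_def)
  define X where "X \<omega> = path (\<lambda>t. Z t \<omega>)" for \<omega>
  define Y where "Y \<omega> = path (\<lambda>t. (\<Sum>j<nat \<lfloor>real r * t\<rfloor>. D (j * (m div r)) (m div r - 1) \<omega>) / R)" for \<omega>
  define E where "E = {\<omega>\<in>space M. \<exists>i\<le>r. \<exists>l\<le>m div r + r + 1. \<delta> * R + C \<le> \<bar>D (i * (m div r)) l \<omega>\<bar>}"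
  define H where "H = \<epsilon> + (\<delta> + (real r + 1) * C / R)"
  have X[measurable]: "X \<in> borel_measurable M" and cadlagZ: "\<And>\<omega>. \<omega> \<in> space M \<Longrightarrow> cadlag (\<lambda>t. Z t \<omega>)"
    using Z unfolding random_function_def X_def by auto
  have Y[measurable]: "Y \<in> borel_measurable M"
    using measurable_path_step[of "\<lambda>i \<omega>. (\<Sum>j<i. D (j * (m div r)) (m div r - 1) \<omega>) / R" M r 0]
    unfolding Y_def by simp
  have E[measurable]: "E \<in> events"
  proof -
    have "{\<omega>\<in>space M. \<exists>i\<in>{..r}. \<exists>l\<in>{..m div r + r + 1}. \<delta> * R + C \<le> \<bar>D (i * (m div r)) l \<omega>\<bar>} \<in> events"
      by (intro sets.sets_Collect_finite_Ex borel_measurable_le borel_measurable_abs) auto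
    then show ?thesis by (simp add: E_def Bex_def)
  qed
  have K: "0 \<le> K" using G(2)[of "path (\<lambda>_. 0)"] by linarith
  note [measurable] = G(3)
  have "\<bar>LINT \<omega>|M. G (X \<omega>) - G (Y \<omega>)\<bar> \<le> (LINT \<omega>|M. \<bar>G (X \<omega>) - G (Y \<omega>)\<bar>)"
    by (rule integral_abs_bound)
  also have "\<dots> \<le> (LINT \<omega>|M. \<bar>A\<bar> * H + 2 * K * indicator E \<omega>)"
  proof (rule integral_mono_AE)
    have "\<bar>G f - G g\<bar> \<le> 2 * K" for f g using G(2)[of f] G(2)[of g] by linarith
    then show "integrable M (\<lambda>\<omega>. \<bar>G (X \<omega>) - G (Y \<omega>)\<bar>)"
      by (intro integrable_const_bound[where B = "2 * K"]) auto
    show "integrable M (\<lambda>\<omega>. \<bar>A\<bar> * H + 2 * K * indicator E \<omega>)"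
      by (auto intro!: integrable_real_indicator simp: less_top[symmetric])
    show "AE \<omega> in M. \<bar>G (X \<omega>) - G (Y \<omega>)\<bar> \<le> \<bar>A\<bar> * H + 2 * K * indicator E \<omega>"
      using close AE_space
    proof eventually_elim
      case (elim \<omega>)
      have "0 \<le> \<epsilon>" using bspec[OF elim(1), of 0] by simp
      then have H: "0 \<le> H" using \<delta> R pos by (simp add: H_def)
      show ?case
      proof (cases "\<omega> \<in> E")
        case True
        have "\<bar>G (X \<omega>) - G (Y \<omega>)\<bar> \<le> 2 * K" using G(2)[of "X \<omega>"] G(2)[of "Y \<omega>"] by linarith
        moreover have "0 \<le> \<bar>A\<bar> * H" using H by simp
        ultimately show ?thesis using True by simp
      next
        case False
        have "dist (X \<omega>) (Y \<omega>) \<le> H"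
          unfolding X_def Y_def
        proof (rule dist_path_le)
          show "cadlag (\<lambda>t. Z t \<omega>)" using cadlagZ elim(2) .
          show "cadlag (\<lambda>t. (\<Sum>j<nat \<lfloor>real r * t\<rfloor>. D (j * (m div r)) (m div r - 1) \<omega>) / R)"
            by (rule cadlag_step[where a = "\<lambda>i. (\<Sum>j<i. D (j * (m div r)) (m div r - 1) \<omega>) / R"]) simp
          fix t :: real assume t: "t \<in> {0..1}"
          let ?d = "D 0 (nat \<lfloor>real m * t\<rfloor>) \<omega>" and ?s = "\<Sum>j<nat \<lfloor>real r * t\<rfloor>. D (j * (m div r)) (m div r - 1) \<omega>"
          have "\<bar>?d - ?s\<bar> \<le> (\<delta> * R + C) + real r * C"
          proof (rule skeleton_distance[OF r t])
            fix i l assume "i \<le> r" "l \<le> m div r + r + 1"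
            then have "\<not> \<delta> * R + C \<le> \<bar>D (i * (m div r)) l \<omega>\<bar>"
              using False elim(2) unfolding E_def by blast
            then show "\<bar>D (i * (m div r)) l \<omega>\<bar> \<le> \<delta> * R + C" by simp
          qed
          then have "\<bar>?d - ?s\<bar> / R \<le> (\<delta> * R + C + real r * C) / R"
            using R by (intro divide_right_mono) auto
          moreover have "(\<delta> * R + C + real r * C) / R = \<delta> + (real r + 1) * C / R"
            using R by (simp add: field_simps)
          moreover have "\<bar>?d / R - ?s / R\<bar> = \<bar>?d - ?s\<bar> / R"
            using R by (simp add: diff_divide_distrib[symmetric])
          moreover have "\<bar>Z t \<omega> - ?d / R\<bar> \<le> \<epsilon>" using elim(1) t unfolding R_def by blast
          ultimately show "\<bar>Z t \<omega> - ?s / R\<bar> \<le> H" unfolding H_def by linarith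
        qed
        then have "\<bar>A\<bar> * dist (X \<omega>) (Y \<omega>) \<le> \<bar>A\<bar> * H" by (intro mult_left_mono) auto
        moreover have "A * dist (X \<omega>) (Y \<omega>) \<le> \<bar>A\<bar> * dist (X \<omega>) (Y \<omega>)" by (intro mult_right_mono) auto
        ultimately show ?thesis using False G(1)[of "X \<omega>" "Y \<omega>"] by simp
      qed
    qed
  qed
  also have "\<dots> = \<bar>A\<bar> * H + 2 * K * prob E"
    by (subst Bochner_Integration.integral_add)
      (auto intro!: integrable_real_indicator simp: less_top[symmetric] prob_space)
  also have "\<dots> \<le> \<bar>A\<bar> * H + 2 * K * ((real r + 1) * (8 * exp (- (\<delta>\<^sup>2 * (v + 2 * c) / (64 * C\<^sup>2) * real r))))"
    using oscillation_prob[OF r m \<delta>] K unfolding E_def R_def by (intro add_left_mono mult_left_mono) auto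
  also have "(LINT \<omega>|M. G (X \<omega>) - G (Y \<omega>)) = (LINT \<omega>|M. G (X \<omega>)) - (LINT \<omega>|M. G (Y \<omega>))"
    using G(2) by (intro Bochner_Integration.integral_diff integrable_const_bound[where B = K]) auto
  finally show ?thesis unfolding X_def Y_def H_def R_def .
qed

text \<open>\<open>Z\<close> is only tied to the scaled sums up to a deterministic error and almost
  surely, which leaves room for a centring by \<open>m * t\<close> instead of its floor and for
  letters outside the alphabet on a null set.\<close>

theorem donsker:
  assumes B: "standard_brownian_motion N B"
    and Z: "\<And>m. random_function M (Z m)"
    and \<epsilon>: "\<epsilon> \<longlonglongrightarrow> 0"
    and close: "\<And>m. AE \<omega> in M. \<forall>t\<in>{0..1}.
      \<bar>Z m t \<omega> - D 0 (nat \<lfloor>real m * t\<rfloor>) \<omega> / sqrt ((v + 2 * c) * real m)\<bar> \<le> \<epsilon> m"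
  shows "weak_conv_skorohod M Z N B"
proof -
  interpret N: prob_space N using B by (simp add: standard_brownian_motion_def)
  have contB: "continuous_on {0..1} (\<lambda>t. B t \<omega>)" if "\<omega> \<in> space N" for \<omega>
    using B that by (simp add: standard_brownian_motion_def)
  have rfB: "random_function N B"
    using B by (intro random_function_continuous) (auto simp: standard_brownian_motion_def)
  have measB[measurable]: "(\<lambda>\<omega>. path (\<lambda>t. B t \<omega>)) \<in> borel_measurable N"
    using rfB by (simp add: random_function_def)
  have lip: "(\<lambda>m. LINT \<omega>|M. G (path (\<lambda>t. Z m t \<omega>))) \<longlonglongrightarrow> (LINT \<omega>|N. G (path (\<lambda>t. B t \<omega>)))"
    if G: "\<And>f g. \<bar>G f - G g\<bar> \<le> A * dist f g" "bounded (range G)" for G :: "skorohod \<Rightarrow> real" and A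
  proof -
    obtain K where K: "\<And>f. \<bar>G f\<bar> \<le> K" using G(2) unfolding bounded_iff by auto
    have "\<bar>A\<bar>-lipschitz_on UNIV G"
    proof (rule lipschitz_onI)
      fix f g :: skorohod
      have "A * dist f g \<le> \<bar>A\<bar> * dist f g" by (intro mult_right_mono) auto
      then show "dist (G f) (G g) \<le> \<bar>A\<bar> * dist f g"
        unfolding dist_real_def using G(1)[of f g] by linarith
    qed simp
    then have contG: "continuous_on UNIV G" by (rule lipschitz_on_continuous_on)
    then have [measurable]: "G \<in> borel_measurable borel" by (rule borel_measurable_continuous_onI)
    define BR where "BR r = (LINT \<omega>|N. G (path (\<lambda>t. B (real (nat \<lfloor>real r * t\<rfloor>) / real r) \<omega>)))" for r
    define SK where "SK r m = (LINT \<omega>|M. G (path (\<lambda>t. (\<Sum>j<nat \<lfloor>real r * t\<rfloor>. D (j * (m div r)) (m div r - 1) \<omega>) / sqrt ((v + 2 * c) * real m))))" for r m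
    have BR: "(\<lambda>r. BR (Suc r)) \<longlonglongrightarrow> (LINT \<omega>|N. G (path (\<lambda>t. B t \<omega>)))"
      unfolding BR_def
    proof (rule integral_dominated_convergence[where w = "\<lambda>_. K"])
      show "(\<lambda>\<omega>. G (path (\<lambda>t. B t \<omega>))) \<in> borel_measurable N" by measurable
      show "(\<lambda>\<omega>. G (path (\<lambda>t. B (real (nat \<lfloor>real (Suc r) * t\<rfloor>) / real (Suc r)) \<omega>))) \<in> borel_measurable N" for r
      proof -
        have "(\<lambda>\<omega>. path (\<lambda>t. B (real (nat \<lfloor>real (Suc r) * t\<rfloor>) / real (Suc r)) \<omega>)) \<in> borel_measurable N"
          using B by (intro measurable_path_sample) (auto simp: standard_brownian_motion_def)
        then show ?thesis by measurable
      qed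
      show "AE \<omega> in N. (\<lambda>r. G (path (\<lambda>t. B (real (nat \<lfloor>real (Suc r) * t\<rfloor>) / real (Suc r)) \<omega>))) \<longlonglongrightarrow> G (path (\<lambda>t. B t \<omega>))"
      proof (rule AE_I2)
        fix \<omega> assume "\<omega> \<in> space N"
        from path_step_tendsto[OF contB[OF this]]
        show "(\<lambda>r. G (path (\<lambda>t. B (real (nat \<lfloor>real (Suc r) * t\<rfloor>) / real (Suc r)) \<omega>))) \<longlonglongrightarrow> G (path (\<lambda>t. B t \<omega>))"
          by (intro continuous_on_tendsto_compose[OF contG]) auto
      qed
    qed (use K in auto)
    show ?thesis
    proof (rule LIMSEQ_I)
      fix e :: real assume e: "0 < e"
      \<comment> \<open>Four errors get a quarter of \<open>e\<close> each: Lipschitz distance,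
        oscillation, discretised Brownian motion, and the skeleton limit. Only
        \<open>\<delta>\<close> and \<open>r\<close> are fixed before \<open>m\<close> grows. The
        added 1 covers \<open>A = 0\<close>.\<close>
      define \<delta> where "\<delta> = e / (4 * (\<bar>A\<bar> + 1))"
      have \<delta>: "0 < \<delta>" "\<bar>A\<bar> * \<delta> < e / 4"
        using e by (auto simp: \<delta>_def field_simps add_nonneg_pos intro!: add_nonneg_pos)
      define \<kappa> where "\<kappa> = \<delta>\<^sup>2 * (v + 2 * c) / (64 * C\<^sup>2)"
      have \<kappa>: "0 < \<kappa>" using \<delta> pos by (simp add: \<kappa>_def)
      have "(\<lambda>r. (real (Suc r) + 1) * (8 * exp (- (\<kappa> * real (Suc r))))) \<longlonglongrightarrow> 0"
        using \<kappa> by real_asymp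
      then have "(\<lambda>r. 2 * K * ((real (Suc r) + 1) * (8 * exp (- (\<kappa> * real (Suc r)))))) \<longlonglongrightarrow> 2 * K * 0"
        by (rule tendsto_mult_left)
      then have "\<forall>\<^sub>F r in sequentially. 2 * K * ((real (Suc r) + 1) * (8 * exp (- (\<kappa> * real (Suc r))))) < e / 4"
        by (rule order_tendstoD) (use e in simp)
      moreover have "\<forall>\<^sub>F r in sequentially. dist (BR (Suc r)) (LINT \<omega>|N. G (path (\<lambda>t. B t \<omega>))) < e / 4"
        by (rule tendstoD[OF BR]) (use e in simp)
      ultimately have "\<forall>\<^sub>F r in sequentially. 2 * K * ((real (Suc r) + 1) * (8 * exp (- (\<kappa> * real (Suc r))))) < e / 4 \<and>
          dist (BR (Suc r)) (LINT \<omega>|N. G (path (\<lambda>t. B t \<omega>))) < e / 4"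
        by (rule eventually_conj)
      then obtain r' where r': "2 * K * ((real (Suc r') + 1) * (8 * exp (- (\<kappa> * real (Suc r'))))) < e / 4"
          "dist (BR (Suc r')) (LINT \<omega>|N. G (path (\<lambda>t. B t \<omega>))) < e / 4"
        by (metis (no_types, lifting) eventually_sequentially order_refl)
      define r where "r = Suc r'"
      have r: "0 < r" by (simp add: r_def)
      have "(\<lambda>m. 1 / sqrt (real m)) \<longlonglongrightarrow> 0" by real_asymp
      then have "(\<lambda>m. (real r + 1) * C / sqrt (v + 2 * c) * (1 / sqrt (real m))) \<longlonglongrightarrow> (real r + 1) * C / sqrt (v + 2 * c) * 0"
        by (rule tendsto_mult_left)
      then have "(\<lambda>m. (real r + 1) * C / sqrt ((v + 2 * c) * real m)) \<longlonglongrightarrow> 0"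
        by (simp add: real_sqrt_mult)
      then have "(\<lambda>m. \<bar>A\<bar> * (\<epsilon> m + (\<delta> + (real r + 1) * C / sqrt ((v + 2 * c) * real m)))) \<longlonglongrightarrow> \<bar>A\<bar> * (0 + (\<delta> + 0))"
        by (intro tendsto_intros \<epsilon>)
      then have "\<forall>\<^sub>F m in sequentially. \<bar>A\<bar> * (\<epsilon> m + (\<delta> + (real r + 1) * C / sqrt ((v + 2 * c) * real m))) < e / 4"
        by (rule order_tendstoD) (use \<delta> in simp)
      moreover have "\<forall>\<^sub>F m in sequentially. dist (SK r m) (BR r) < e / 4"
        unfolding SK_def BR_def by (rule tendstoD[OF block_skeleton_conv[OF B r contG G(2)]]) (use e in simp)
      moreover have "\<forall>\<^sub>F m in sequentially. r * (r + 1) \<le> m" by (rule eventually_ge_at_top)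
      ultimately have "\<forall>\<^sub>F m in sequentially.
          norm ((LINT \<omega>|M. G (path (\<lambda>t. Z m t \<omega>))) - (LINT \<omega>|N. G (path (\<lambda>t. B t \<omega>)))) < e"
      proof eventually_elim
        case (elim m)
        have "\<bar>(LINT \<omega>|M. G (path (\<lambda>t. Z m t \<omega>))) - SK r m\<bar> \<le>
            \<bar>A\<bar> * (\<epsilon> m + (\<delta> + (real r + 1) * C / sqrt ((v + 2 * c) * real m))) +
            2 * K * ((real r + 1) * (8 * exp (- (\<kappa> * real r))))"
          unfolding SK_def \<kappa>_def
          by (rule donsker_lipschitz_bound[OF r elim(3) \<delta>(1) G(1) K _ Z close]) measurable
        then show ?case
          using elim(1,2) r' unfolding r_def dist_real_def real_norm_def by linarith
      qed
      then show "\<exists>m0. \<forall>m\<ge>m0. norm ((LINT \<omega>|M. G (path (\<lambda>t. Z m t \<omega>))) - (LINT \<omega>|N. G (path (\<lambda>t. B t \<omega>)))) < e"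
        by (simp add: eventually_sequentially)
    qed
  qed
  show ?thesis
    unfolding weak_conv_skorohod_def
  proof (intro conjI allI impI)
    show "random_function M (Z m)" for m by (rule Z)
    show "random_function N B" by (rule rfB)
    fix F :: "skorohod \<Rightarrow> real" assume F: "continuous_on UNIV F \<and> bounded (range F)"
    show "(\<lambda>m. LINT \<omega>|M. F (path (\<lambda>t. Z m t \<omega>))) \<longlonglongrightarrow> (LINT \<omega>|N. F (path (\<lambda>t. B t \<omega>)))"
    proof (rule lipschitz_portmanteau[where X = "\<lambda>m \<omega>. path (\<lambda>t. Z m t \<omega>)" and Y = "\<lambda>\<omega>. path (\<lambda>t. B t \<omega>)"])
      show "(\<lambda>\<omega>. path (\<lambda>t. Z m t \<omega>)) \<in> borel_measurable M" for m
        using Z[of m] by (simp add: random_function_def)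
    qed (use F lip measB in \<open>auto intro: prob_space_axioms N.prob_space_axioms\<close>)
  qed
qed

end

section \<open>Uniform words\<close>

lemma sum_int_atLeastAtMost: "(\<Sum>a\<in>{1..int k}. f a) = (\<Sum>a=1..k. f (int a))"
proof -
  have "{1..int k} = int ` {1..k}" by (simp add: image_int_atLeastAtMost)
  then show ?thesis by (simp add: sum.reindex)
qed

lemma sum_powers:
  "(\<Sum>a=1..n. real a) = real n * (real n + 1) / 2"
  "(\<Sum>a=1..n. (real a)\<^sup>2) = real n * (real n + 1) * (2 * real n + 1) / 6"
  "(\<Sum>a=1..n. (real a) ^ 3) = (real n)\<^sup>2 * (real n + 1)\<^sup>2 / 4"
  "(\<Sum>a=1..n. (real a) ^ 4) = real n * (real n + 1) * (2 * real n + 1) * (3 * (real n)\<^sup>2 + 3 * real n - 1) / 30"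
  by (induction n) (simp_all add: field_simps power2_eq_square power3_eq_cube power4_eq_xxxx)

text \<open>Induction on \<open>k\<close> from \<open>b\<close> upwards: at the start all signs are
  known, and each later letter lies above \<open>b\<close>. Divided by \<open>k\<close>, this is the
  conditional mean of a difference given one of its letters.\<close>

lemma sum_abs_diff:
  assumes "b \<in> {1..k}"
  shows "(\<Sum>a=1..k. \<bar>real a - real b\<bar>) = (real b)\<^sup>2 - (real k + 1) * real b + real k * (real k + 1) / 2"
proof -
  have low: "(\<Sum>a=1..b. \<bar>real a - real b\<bar>) = real b * (real b - 1) / 2"
  proof -
    have "(\<Sum>a=1..b. \<bar>real a - real b\<bar>) = (\<Sum>a=1..b. real b - real a)" by (rule sum.cong) auto
    also have "\<dots> = real b * real b - (\<Sum>a=1..b. real a)" by (simp add: sum_subtractf)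
    finally show ?thesis unfolding sum_powers by (simp add: field_simps)
  qed
  have "b \<le> k" using assms by simp
  then show ?thesis
  proof (induction k rule: dec_induct)
    case base
    then show ?case unfolding low by (simp add: field_simps power2_eq_square)
  next
    case (step k)
    then have "\<bar>real (Suc k) - real b\<bar> = real k + 1 - real b" by simp
    then show ?case using step assms by (simp add: field_simps)
  qed
qed

lemma sum_abs_diff_total:
  "(\<Sum>b=1..k. \<Sum>a=1..k. \<bar>real a - real b\<bar>) = real k * ((real k)\<^sup>2 - 1) / 3"
proof -
  have "(\<Sum>b=1..k. \<Sum>a=1..k. \<bar>real a - real b\<bar>) =
      (\<Sum>b=1..k. (real b)\<^sup>2 - (real k + 1) * real b + real k * (real k + 1) / 2)"
    by (intro sum.cong sum_abs_diff refl)
  also have "\<dots> = (\<Sum>b=1..k. (real b)\<^sup>2) - (real k + 1) * (\<Sum>b=1..k. real b) + real k * (real k * (real k + 1) / 2)"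
    by (simp add: sum.distrib sum_subtractf sum_distrib_left)
  finally show ?thesis unfolding sum_powers by (simp add: field_simps power2_eq_square)
qed

lemma sum_square_diff_total:
  "(\<Sum>b=1..k. \<Sum>a=1..k. (\<bar>real a - real b\<bar>)\<^sup>2) = (real k)\<^sup>2 * ((real k)\<^sup>2 - 1) / 6"
proof -
  have "(\<Sum>b=1..k. \<Sum>a=1..k. (\<bar>real a - real b\<bar>)\<^sup>2) =
      (\<Sum>b=1..k. \<Sum>a=1..k. (real a)\<^sup>2 + (real b)\<^sup>2 - 2 * real b * real a)"
    by (simp add: power2_diff mult_ac)
  also have "\<dots> = (\<Sum>b=1..k. (\<Sum>a=1..k. (real a)\<^sup>2) + real k * (real b)\<^sup>2 - 2 * real b * (\<Sum>a=1..k. real a))"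
    by (simp add: sum.distrib sum_subtractf sum_distrib_left)
  also have "\<dots> = real k * (\<Sum>a=1..k. (real a)\<^sup>2) + real k * (\<Sum>b=1..k. (real b)\<^sup>2) -
      2 * (\<Sum>b=1..k. real b) * (\<Sum>a=1..k. real a)"
    by (simp add: sum.distrib sum_subtractf flip: sum_distrib_left sum_distrib_right)
  finally show ?thesis unfolding sum_powers by (simp add: field_simps power2_eq_square)
qed

text \<open>Divided by the cube of \<open>k\<close>, this is the mean product of two neighbouring
  differences. Squaring the quadratic polynomial in \<open>b\<close> is what calls for power sums up
  to degree four.\<close>

lemma sum_abs_diff_squared:
  "(\<Sum>b=1..k. (\<Sum>a=1..k. \<bar>real a - real b\<bar>)\<^sup>2) = real k * ((real k)\<^sup>2 - 1) * (7 * (real k)\<^sup>2 - 8) / 60"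
proof -
  let ?K = "real k + 1" and ?h = "real k * (real k + 1) / 2"
  have "(\<Sum>b=1..k. (\<Sum>a=1..k. \<bar>real a - real b\<bar>)\<^sup>2) = (\<Sum>b=1..k. ((real b)\<^sup>2 - ?K * real b + ?h)\<^sup>2)"
    by (intro sum.cong refl) (simp only: sum_abs_diff)
  also have "\<dots> = (\<Sum>b=1..k. real b ^ 4 - 2 * ?K * real b ^ 3 + (?K\<^sup>2 + 2 * ?h) * (real b)\<^sup>2 - 2 * ?K * ?h * real b + ?h\<^sup>2)"
  proof (intro sum.cong refl)
    have "(y\<^sup>2 - K * y + h)\<^sup>2 = y ^ 4 - 2 * K * y ^ 3 + (K\<^sup>2 + 2 * h) * y\<^sup>2 - 2 * K * h * y + h\<^sup>2" for y K h :: real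
      by (simp add: power2_eq_square power3_eq_cube power4_eq_xxxx algebra_simps)
    then show "((real b)\<^sup>2 - ?K * real b + ?h)\<^sup>2 =
      real b ^ 4 - 2 * ?K * real b ^ 3 + (?K\<^sup>2 + 2 * ?h) * (real b)\<^sup>2 - 2 * ?K * ?h * real b + ?h\<^sup>2" for b .
  qed
  also have "\<dots> = (\<Sum>b=1..k. real b ^ 4) - 2 * ?K * (\<Sum>b=1..k. real b ^ 3) + (?K\<^sup>2 + 2 * ?h) * (\<Sum>b=1..k. (real b)\<^sup>2)
      - 2 * ?K * ?h * (\<Sum>b=1..k. real b) + real k * ?h\<^sup>2"
    by (simp only: sum.distrib sum_subtractf sum_distrib_left[symmetric] sum_constant card_atLeastAtMost) simp
  finally show ?thesis unfolding sum_powers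
    by (simp add: field_simps power2_eq_square power3_eq_cube power4_eq_xxxx)
qed

section \<open>Moments of a uniform word\<close>

locale uniform_word = prob_space P for P :: "'a measure" +
  fixes x :: "nat \<Rightarrow> 'a \<Rightarrow> int" and k :: nat
  assumes k: "2 \<le> k"
    and indep: "indep_vars (\<lambda>_. count_space UNIV) x UNIV"
    and unif: "\<And>i. distr P (count_space UNIV) (x i) = measure_pmf (pmf_of_set {1..int k})"
begin

lemma x_meas [measurable]: "x i \<in> measurable P (count_space UNIV)"
  using indep unfolding indep_vars_def by simp

lemma AE_range: "AE \<omega> in P. \<forall>i. x i \<omega> \<in> {1..int k}"
proof (subst AE_all_countable, intro allI)
  fix i
  have "AE a in measure_pmf (pmf_of_set {1..int k}). a \<in> {1..int k}"
    using k by (simp add: AE_measure_pmf_iff)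
  then have "AE a in distr P (count_space UNIV) (x i). a \<in> {1..int k}" by (simp only: unif)
  then show "AE \<omega> in P. x i \<omega> \<in> {1..int k}" by (subst (asm) AE_distr_iff) auto
qed

lemma prob_eq: "a \<in> {1..int k} \<Longrightarrow> prob (x i -` {a} \<inter> space P) = 1 / real k"
proof -
  assume a: "a \<in> {1..int k}"
  have "prob (x i -` {a} \<inter> space P) = measure (distr P (count_space UNIV) (x i)) {a}"
    by (simp add: measure_distr)
  then show ?thesis using a k by (simp add: unif measure_pmf_single)
qed

lemma prob_triple:
  assumes "a \<in> {1..int k}" "b \<in> {1..int k}" "c \<in> {1..int k}"
  shows "prob {\<omega>\<in>space P. x i \<omega> = a \<and> x (Suc i) \<omega> = b \<and> x (Suc (Suc i)) \<omega> = c} = 1 / real k ^ 3"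
proof -
  let ?A = "\<lambda>j. if j = i then {a} else if j = Suc i then {b} else {c}"
  have "{\<omega>\<in>space P. x i \<omega> = a \<and> x (Suc i) \<omega> = b \<and> x (Suc (Suc i)) \<omega> = c} =
      (\<Inter>j\<in>{i, Suc i, Suc (Suc i)}. x j -` ?A j \<inter> space P)" by auto
  also have "prob \<dots> = (\<Prod>j\<in>{i, Suc i, Suc (Suc i)}. prob (x j -` ?A j \<inter> space P))"
    by (rule indep_varsD[OF indep]) auto
  also have "\<dots> = 1 / real k ^ 3"
    using assms by (simp add: prob_eq power3_eq_cube)
  finally show ?thesis .
qed

text \<open>Three consecutive letters cover two neighbouring differences, so every moment needed
  reduces to a finite sum of this kind.\<close>

lemma expectation_triple:
  fixes f :: "int \<Rightarrow> int \<Rightarrow> int \<Rightarrow> real"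
  shows "expectation (\<lambda>\<omega>. f (x i \<omega>) (x (Suc i) \<omega>) (x (Suc (Suc i)) \<omega>)) =
    (\<Sum>a\<in>{1..int k}. \<Sum>b\<in>{1..int k}. \<Sum>c\<in>{1..int k}. f a b c) / real k ^ 3"
proof -
  let ?I = "{1..int k}"
  define E where "E a b c = {\<omega>\<in>space P. x i \<omega> = a \<and> x (Suc i) \<omega> = b \<and> x (Suc (Suc i)) \<omega> = c}" for a b c
  have E: "E a b c \<in> events" for a b c unfolding E_def by measurable
  have int: "integrable P (indicat_real (E a b c))" for a b c
    using E by (intro integrable_real_indicator) (auto simp: less_top[symmetric])
  have "expectation (\<lambda>\<omega>. f (x i \<omega>) (x (Suc i) \<omega>) (x (Suc (Suc i)) \<omega>)) =
      expectation (\<lambda>\<omega>. \<Sum>a\<in>?I. \<Sum>b\<in>?I. \<Sum>c\<in>?I. f a b c * indicator (E a b c) \<omega>)"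
  proof (rule integral_cong_AE)
    show "AE \<omega> in P. f (x i \<omega>) (x (Suc i) \<omega>) (x (Suc (Suc i)) \<omega>) =
        (\<Sum>a\<in>?I. \<Sum>b\<in>?I. \<Sum>c\<in>?I. f a b c * indicator (E a b c) \<omega>)"
      using AE_range AE_space
    proof eventually_elim
      case (elim \<omega>)
      \<comment> \<open>Nested conditionals let each sum collapse to the letter that occurred, which
        almost surely lies in the alphabet.\<close>
      have "f a b c * indicator (E a b c) \<omega> =
          (if x i \<omega> = a then if x (Suc i) \<omega> = b then if x (Suc (Suc i)) \<omega> = c then f a b c else 0 else 0 else 0)" for a b c
        using elim(2) by (simp add: indicator_def E_def)
      moreover have "(\<Sum>b\<in>?I. if q then g b else (0::real)) = (if q then \<Sum>b\<in>?I. g b else 0)" for q and g :: "int \<Rightarrow> real"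
        by simp
      ultimately show ?case using elim(1) by (simp add: sum.delta' del: atLeastAtMost_iff)
    qed
    show "(\<lambda>\<omega>. f (x i \<omega>) (x (Suc i) \<omega>) (x (Suc (Suc i)) \<omega>)) \<in> borel_measurable P"
      by measurable
    show "(\<lambda>\<omega>. \<Sum>a\<in>?I. \<Sum>b\<in>?I. \<Sum>c\<in>?I. f a b c * indicator (E a b c) \<omega>) \<in> borel_measurable P"
      using E by measurable
  qed
  also have "\<dots> = (\<Sum>a\<in>?I. \<Sum>b\<in>?I. \<Sum>c\<in>?I. f a b c * prob (E a b c))"
  proof -
    have "expectation (indicat_real (E a b c)) = prob (E a b c)" for a b c
      using E by simp
    then show ?thesis
      by (simp only: Bochner_Integration.integral_sum Bochner_Integration.integrable_sum
          integrable_mult_right integral_mult_right_zero int)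
  qed
  also have "\<dots> = (\<Sum>a\<in>?I. \<Sum>b\<in>?I. \<Sum>c\<in>?I. f a b c * (1 / real k ^ 3))"
    unfolding E_def by (intro sum.cong refl) (simp only: prob_triple)
  finally show ?thesis by (simp add: sum_divide_distrib)
qed

lemma expectation_pair:
  fixes f :: "int \<Rightarrow> int \<Rightarrow> real"
  shows "expectation (\<lambda>\<omega>. f (x i \<omega>) (x (Suc i) \<omega>)) = (\<Sum>a\<in>{1..int k}. \<Sum>b\<in>{1..int k}. f a b) / (real k)\<^sup>2"
  using expectation_triple[of "\<lambda>a b _. f a b" i] k
  by (simp add: power2_eq_square power3_eq_cube flip: sum_distrib_left)

definition \<mu> :: real where
  "\<mu> = (real k - 1) * (real k + 1) / (3 * real k)"

text \<open>Truncated outside the alphabet, so that the bound on the terms holds everywhere and not only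
  almost surely.\<close>

definition h :: "int \<Rightarrow> int \<Rightarrow> real" where
  "h a b = (if a \<in> {1..int k} \<and> b \<in> {1..int k} then \<bar>real_of_int a - real_of_int b\<bar> - \<mu> else 0)"

lemma \<mu>_eq: "\<mu> = ((real k)\<^sup>2 - 1) / (3 * real k)"
  by (simp add: \<mu>_def power2_eq_square algebra_simps)

lemma expectation_abs_diff:
  "expectation (\<lambda>\<omega>. \<bar>real_of_int (x i \<omega>) - real_of_int (x (Suc i) \<omega>)\<bar>) = \<mu>"
proof -
  have "(\<Sum>a\<in>{1..int k}. \<Sum>b\<in>{1..int k}. \<bar>real_of_int a - real_of_int b\<bar>) = real k * ((real k)\<^sup>2 - 1) / 3"
    unfolding sum_int_atLeastAtMost using sum_abs_diff_total[of k] by (simp add: abs_minus_commute)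
  then show ?thesis
    unfolding expectation_pair[of "\<lambda>a b. \<bar>real_of_int a - real_of_int b\<bar>" i]
    using k by (simp only: \<mu>_eq) (simp add: power2_eq_square)
qed

lemma expectation_h: "expectation (\<lambda>\<omega>. h (x i \<omega>) (x (Suc i) \<omega>)) = 0"
proof -
  have "(\<Sum>a\<in>{1..int k}. \<Sum>b\<in>{1..int k}. h a b) = (\<Sum>a\<in>{1..int k}. \<Sum>b\<in>{1..int k}. \<bar>real_of_int a - real_of_int b\<bar> - \<mu>)"
    by (intro sum.cong refl) (simp add: h_def)
  also have "\<dots> = (\<Sum>a=1..k. \<Sum>b=1..k. \<bar>real b - real a\<bar>) - (real k)\<^sup>2 * \<mu>"
    unfolding sum_int_atLeastAtMost by (simp add: sum_subtractf abs_minus_commute power2_eq_square)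
  also have "\<dots> = 0"
    unfolding sum_abs_diff_total using k by (simp add: \<mu>_eq power2_eq_square)
  finally show ?thesis by (subst expectation_pair) simp
qed

lemma expectation_h_square:
  "expectation (\<lambda>\<omega>. (h (x i \<omega>) (x (Suc i) \<omega>))\<^sup>2) = ((real k)\<^sup>2 - 1) / 6 - \<mu>\<^sup>2"
proof -
  have "(\<Sum>a\<in>{1..int k}. \<Sum>b\<in>{1..int k}. (h a b)\<^sup>2) =
      (\<Sum>a\<in>{1..int k}. \<Sum>b\<in>{1..int k}. (\<bar>real_of_int b - real_of_int a\<bar>)\<^sup>2 - 2 * \<mu> * \<bar>real_of_int b - real_of_int a\<bar> + \<mu>\<^sup>2)"
    by (intro sum.cong refl) (simp add: h_def power2_diff abs_minus_commute)
  also have "\<dots> = (\<Sum>a=1..k. \<Sum>b=1..k. (\<bar>real b - real a\<bar>)\<^sup>2) - 2 * \<mu> * (\<Sum>a=1..k. \<Sum>b=1..k. \<bar>real b - real a\<bar>) + (real k)\<^sup>2 * \<mu>\<^sup>2"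
    unfolding sum_int_atLeastAtMost
    by (simp add: sum.distrib sum_subtractf sum_distrib_left power2_eq_square[of "real k"] del: power2_abs)
  also have "\<dots> = (real k)\<^sup>2 * (((real k)\<^sup>2 - 1) / 6 - \<mu>\<^sup>2)"
    unfolding sum_abs_diff_total sum_square_diff_total using k by (simp add: \<mu>_eq field_simps power2_eq_square)
  finally show ?thesis using k by (subst expectation_pair) simp
qed

text \<open>For a fixed middle letter the sums over the outer letters factorise, and since
  \<open>h\<close> is symmetric the two factors agree and form a square.\<close>

lemma expectation_h_h:
  "expectation (\<lambda>\<omega>. h (x i \<omega>) (x (Suc i) \<omega>) * h (x (Suc i) \<omega>) (x (Suc (Suc i)) \<omega>)) =
    ((real k)\<^sup>2 - 1) * (7 * (real k)\<^sup>2 - 8) / (60 * (real k)\<^sup>2) - \<mu>\<^sup>2"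
proof -
  let ?I = "{1..int k}"
  have "(\<Sum>a\<in>?I. \<Sum>b\<in>?I. \<Sum>c\<in>?I. h a b * h b c) = (\<Sum>b\<in>?I. \<Sum>a\<in>?I. \<Sum>c\<in>?I. h a b * h b c)"
    by (rule sum.swap)
  also have "\<dots> = (\<Sum>b\<in>?I. (\<Sum>a\<in>?I. h a b) * (\<Sum>c\<in>?I. h b c))"
    by (simp add: sum_product)
  also have "\<dots> = (\<Sum>b\<in>?I. ((\<Sum>a\<in>?I. \<bar>real_of_int a - real_of_int b\<bar>) - real k * \<mu>)\<^sup>2)"
  proof (intro sum.cong refl)
    fix b assume b: "b \<in> ?I"
    have "(\<Sum>a\<in>?I. h a b) = (\<Sum>a\<in>?I. \<bar>real_of_int a - real_of_int b\<bar> - \<mu>)"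
      using b by (intro sum.cong refl) (simp add: h_def)
    moreover have "(\<Sum>c\<in>?I. h b c) = (\<Sum>a\<in>?I. \<bar>real_of_int a - real_of_int b\<bar> - \<mu>)"
      using b by (intro sum.cong refl) (simp add: h_def abs_minus_commute)
    ultimately show "(\<Sum>a\<in>?I. h a b) * (\<Sum>c\<in>?I. h b c) = ((\<Sum>a\<in>?I. \<bar>real_of_int a - real_of_int b\<bar>) - real k * \<mu>)\<^sup>2"
      by (simp add: sum_subtractf power2_eq_square)
  qed
  also have "\<dots> = (\<Sum>b=1..k. (\<Sum>a=1..k. \<bar>real a - real b\<bar>)\<^sup>2) - 2 * (real k * \<mu>) * (\<Sum>b=1..k. \<Sum>a=1..k. \<bar>real a - real b\<bar>)
      + real k * (real k * \<mu>)\<^sup>2"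
    unfolding sum_int_atLeastAtMost
    by (simp add: power2_diff sum.distrib sum_subtractf flip: sum_distrib_left sum_distrib_right)
  also have "\<dots> = real k ^ 3 * (((real k)\<^sup>2 - 1) * (7 * (real k)\<^sup>2 - 8) / (60 * (real k)\<^sup>2) - \<mu>\<^sup>2)"
    unfolding sum_abs_diff_total sum_abs_diff_squared using k by (simp add: \<mu>_eq field_simps power2_eq_square power3_eq_cube)
  finally show ?thesis
    using k expectation_triple[of "\<lambda>a b c. h a b * h b c" i] by simp
qed


text \<open>Identifies \<open>v + 2 * c\<close> with the constant under the root in the
  normalisation.\<close>

lemma limit_variance:
  "((real k)\<^sup>2 - 1) / 6 - \<mu>\<^sup>2 + 2 * (((real k)\<^sup>2 - 1) * (7 * (real k)\<^sup>2 - 8) / (60 * (real k)\<^sup>2) - \<mu>\<^sup>2) =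
    (real k - 1) * (real k + 1) * ((real k)\<^sup>2 + 1) / (15 * (real k)\<^sup>2)"
  using k unfolding \<mu>_def by (simp add: field_simps power2_eq_square)

lemma limit_variance_pos:
  "0 < (real k - 1) * (real k + 1) * ((real k)\<^sup>2 + 1) / (15 * (real k)\<^sup>2)"
  using k by (intro divide_pos_pos mult_pos_pos add_nonneg_pos) auto

lemma \<mu>_bounds: "0 \<le> \<mu>" "\<mu> \<le> real k"
proof -
  show "0 \<le> \<mu>" using k by (simp add: \<mu>_def)
  have "(real k)\<^sup>2 - 1 \<le> real k * (3 * real k)" 
    using zero_le_power2[of "real k"] unfolding power2_eq_square by linarith
  then show "\<mu> \<le> real k" using k by (simp add: \<mu>_eq pos_divide_le_eq)
qed

sublocale one_dependent_sequence P "count_space UNIV" x h "real k"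
  "((real k)\<^sup>2 - 1) / 6 - \<mu>\<^sup>2" "((real k)\<^sup>2 - 1) * (7 * (real k)\<^sup>2 - 8) / (60 * (real k)\<^sup>2) - \<mu>\<^sup>2"
proof unfold_locales
  show "case_prod h \<in> borel_measurable (count_space UNIV \<Otimes>\<^sub>M count_space UNIV)"
    by (simp add: pair_measure_countable)
  \<comment> \<open>The distance of two letters and \<open>\<mu>\<close> both lie between 0 and
    \<open>k\<close>, hence so does the modulus of their difference.\<close>
  show "\<bar>h a b\<bar> \<le> real k" for a b
  proof (cases "a \<in> {1..int k} \<and> b \<in> {1..int k}")
    case True
    then have "\<bar>a - b\<bar> \<le> int k" by auto
    then have "\<bar>real_of_int a - real_of_int b\<bar> \<le> real k"
      by (metis of_int_abs of_int_diff of_int_le_iff of_int_of_nat_eq)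
    then show ?thesis using \<mu>_bounds True by (simp add: h_def)
  qed (auto simp: h_def)
  show "0 < ((real k)\<^sup>2 - 1) / 6 - \<mu>\<^sup>2 +
      2 * (((real k)\<^sup>2 - 1) * (7 * (real k)\<^sup>2 - 8) / (60 * (real k)\<^sup>2) - \<mu>\<^sup>2)"
    unfolding limit_variance by (rule limit_variance_pos)
qed (use k indep expectation_h expectation_h_square expectation_h_h in simp_all)

text \<open>\<open>\<xi> j\<close> is the centred difference with index \<open>j + 1\<close>, so the
  sum on the right starts at 1. The truncation in \<open>h\<close> is invisible once all letters lie
  in the alphabet, which almost surely happens for all indices at once.\<close>

lemma AE_D_eq:
  "AE \<omega> in P. \<forall>j. D 0 j \<omega> = real_of_int (\<Sum>i=1..j. \<bar>x i \<omega> - x (i - 1) \<omega>\<bar>) - \<mu> * real j"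
  using AE_range
proof eventually_elim
  case (elim \<omega>)
  have "D 0 j \<omega> = real_of_int (\<Sum>i=1..j. \<bar>x i \<omega> - x (i - 1) \<omega>\<bar>) - \<mu> * real j" for j
  proof (induction j)
    case (Suc j)
    have "\<xi> j \<omega> = \<bar>real_of_int (x (Suc j) \<omega>) - real_of_int (x j \<omega>)\<bar> - \<mu>"
      using elim by (simp add: \<xi>_def h_def abs_minus_commute del: atLeastAtMost_iff)
    then show ?case using Suc by (simp add: D_Suc algebra_simps)
  qed simp
  then show ?case by blast
qed

end

theorem theorem5p1:
  fixes P :: "'a measure" and x :: "nat \<Rightarrow> 'a \<Rightarrow> int" and k :: nat
    and y :: "nat \<Rightarrow> 'a \<Rightarrow> int" and Q :: "nat \<Rightarrow> 'a \<Rightarrow> int" and M \<sigma> :: real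
    and N :: "'b measure" and B :: "real \<Rightarrow> 'b \<Rightarrow> real"
  assumes "prob_space P"
    and "k \<ge> 2"
    and "prob_space.indep_vars P (\<lambda>_. count_space UNIV) x UNIV"
    and "\<And>i. distr P (count_space UNIV) (x i) = measure_pmf (pmf_of_set {1..int k})"
    and "standard_brownian_motion N B"
  defines "y \<equiv> \<lambda>i \<omega>. \<bar>x i \<omega> - x (i - 1) \<omega>\<bar>"
    and "M \<equiv> (real k - 1) * (real k + 1) / (3 * real k)"
    and "Q \<equiv> \<lambda>j \<omega>. \<Sum>i=1..j. y i \<omega>"
    and "\<sigma> \<equiv> sqrt ((real k - 1) * (real k + 1) * ((real k)\<^sup>2 + 1) / (15 * (real k)\<^sup>2))"
  shows "(\<forall>i\<ge>1. prob_space.expectation P (\<lambda>\<omega>. real_of_int (y i \<omega>)) = M) \<and>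
    weak_conv_skorohod P
      (\<lambda>m t \<omega>. (real_of_int (Q (nat \<lfloor>real m * t\<rfloor>) \<omega>) - M * real m * t) / (\<sigma> * sqrt (real m)))
      N B"
proof -
  interpret uniform_word P x k
    by (intro uniform_word.intro uniform_word_axioms.intro assms(1-4))
  have M: "M = \<mu>" by (simp add: M_def \<mu>_def)
  have \<sigma>: "0 < \<sigma>" using limit_variance_pos by (simp add: \<sigma>_def)
  have norm: "sqrt ((((real k)\<^sup>2 - 1) / 6 - \<mu>\<^sup>2 +
      2 * (((real k)\<^sup>2 - 1) * (7 * (real k)\<^sup>2 - 8) / (60 * (real k)\<^sup>2) - \<mu>\<^sup>2)) * real m) = \<sigma> * sqrt (real m)" for m
    unfolding limit_variance \<sigma>_def by (rule real_sqrt_mult)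
  have mean: "expectation (\<lambda>\<omega>. real_of_int (y i \<omega>)) = M" if "i \<ge> 1" for i
    using expectation_abs_diff[of "i - 1"] that by (simp add: y_def M abs_minus_commute)
  have "weak_conv_skorohod P
      (\<lambda>m t \<omega>. (real_of_int (Q (nat \<lfloor>real m * t\<rfloor>) \<omega>) - M * real m * t) / (\<sigma> * sqrt (real m))) N B"
  proof (rule donsker[OF assms(5)])
    show "random_function P (\<lambda>t \<omega>. (real_of_int (Q (nat \<lfloor>real m * t\<rfloor>) \<omega>) - M * real m * t) / (\<sigma> * sqrt (real m)))" for m
    proof -
      \<comment> \<open>Splitting into a step function and a linear drift brings the path into the
        form of \<open>cadlag_step_drift\<close> and \<open>measurable_path_step\<close>.\<close>
      define a where "a i \<omega> = real_of_int (Q i \<omega>) / (\<sigma> * sqrt (real m))" for i \<omega>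
      define d where "d = M * real m / (\<sigma> * sqrt (real m))"
      have eq: "(real_of_int (Q (nat \<lfloor>real m * t\<rfloor>) \<omega>) - M * real m * t) / (\<sigma> * sqrt (real m)) =
          a (nat \<lfloor>real m * t\<rfloor>) \<omega> - d * t" for t \<omega>
        by (simp add: a_def d_def diff_divide_distrib)
      have [measurable]: "a i \<in> borel_measurable P" for i
        unfolding a_def[abs_def] Q_def y_def of_int_sum of_int_abs of_int_diff
        by (intro borel_measurable_divide borel_measurable_const borel_measurable_sum
            borel_measurable_abs borel_measurable_diff) measurable
      show ?thesis
        unfolding random_function_def eq
        using cadlag_step_drift[of "real m" "\<lambda>i. a i \<omega>" d for \<omega>] measurable_path_step[of a P m d] by simp
    qed
    \<comment> \<open>\<open>D\<close> is centred by \<open>\<mu>\<close> times the floor of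
      \<open>m * t\<close>, the claim by \<open>\<mu> * m * t\<close>; the two differ by at most
      \<open>\<mu>\<close>, hence this error sequence. For \<open>m = 0\<close> every quotient is
      0.\<close>
    have "(\<lambda>m. 1 / sqrt (real m)) \<longlonglongrightarrow> 0" by real_asymp
    then have "(\<lambda>m. \<mu> / \<sigma> * (1 / sqrt (real m))) \<longlonglongrightarrow> \<mu> / \<sigma> * 0" by (rule tendsto_mult_left)
    then show "(\<lambda>m. \<mu> / (\<sigma> * sqrt (real m))) \<longlonglongrightarrow> 0" by simp
    show "AE \<omega> in P. \<forall>t\<in>{0..1}. \<bar>(real_of_int (Q (nat \<lfloor>real m * t\<rfloor>) \<omega>) - M * real m * t) / (\<sigma> * sqrt (real m)) -
        D 0 (nat \<lfloor>real m * t\<rfloor>) \<omega> / sqrt ((((real k)\<^sup>2 - 1) / 6 - \<mu>\<^sup>2 +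
        2 * (((real k)\<^sup>2 - 1) * (7 * (real k)\<^sup>2 - 8) / (60 * (real k)\<^sup>2) - \<mu>\<^sup>2)) * real m)\<bar> \<le> \<mu> / (\<sigma> * sqrt (real m))" for m
      using AE_D_eq unfolding norm
    proof eventually_elim
      case (elim \<omega>)
      show ?case
      proof
        fix t :: real assume t: "t \<in> {0..1}"
        define j where "j = nat \<lfloor>real m * t\<rfloor>"
        have "0 \<le> real m * t" using t by simp
        then have j: "\<bar>real j - real m * t\<bar> \<le> 1" unfolding j_def by linarith
        have "D 0 j \<omega> = real_of_int (Q j \<omega>) - \<mu> * real j" using elim by (simp add: Q_def y_def)
        then have "(real_of_int (Q j \<omega>) - M * real m * t) / (\<sigma> * sqrt (real m)) - D 0 j \<omega> / (\<sigma> * sqrt (real m)) =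
            \<mu> * (real j - real m * t) / (\<sigma> * sqrt (real m))"
          by (simp add: M algebra_simps flip: diff_divide_distrib)
        also have "\<bar>\<dots>\<bar> = \<mu> * \<bar>real j - real m * t\<bar> / (\<sigma> * sqrt (real m))"
          using \<mu>_bounds(1) \<sigma> by (simp add: abs_mult)
        also have "\<dots> \<le> \<mu> / (\<sigma> * sqrt (real m))"
          using j \<mu>_bounds(1) \<sigma> by (intro divide_right_mono mult_left_le) auto
        finally show "\<bar>(real_of_int (Q (nat \<lfloor>real m * t\<rfloor>) \<omega>) - M * real m * t) / (\<sigma> * sqrt (real m)) -
            D 0 (nat \<lfloor>real m * t\<rfloor>) \<omega> / (\<sigma> * sqrt (real m))\<bar> \<le> \<mu> / (\<sigma> * sqrt (real m))"
          unfolding j_def .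
      qed
    qed
  qed
  then show ?thesis using mean by blast
qed

end
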